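(* Let $(A,\mathfrak a)$ be a good pair over $\Bbbk$ with $(A,\mathfrak a)$-basis $B=B_{\mathfrak a}\sqcup B_{\mathfrak c}\sqcup B_{\bar1}$, and let $n\ge1$, $d\ge0$. Put $Y:=\mathrm{span}_\Bbbk(\xi^b_{r,s}\mid r,s\in[1,n],\ b\in B_{\mathfrak c}\sqcup B_{\bar1})\subseteq M_n(A)$ and, for $e\ge0$, $\mathtt{Star}^eY:=Y*\cdots*Y$ ($e$ factors). Then $$T^A_{\mathfrak a}(n,d)=\bigoplus_{e=0}^dS^{\mathfrak a}(n,d-e)*\mathtt{Star}^eY.$$
   Context: $\Bbbk$ is a commutative domain of characteristic $0$. Superalgebras are $\mathbb Z/2$-graded associative (not necessarily unital) $\Bbbk$-algebras $A=A_{\bar 0}\oplus A_{\bar 1}$; $\bar a$ denotes the parity of a homogeneous element $a$; tensor products of superalgebras carry the product $(x\otimes y)(z\otimes w)=(-1)^{\bar y\bar z}xz\otimes yw$. A good pair $(A,\mathfrak a)$ consists of a superalgebra $A$ with $A_{\bar 0},A_{\bar 1}$ free over $\Bbbk$ and a subalgebra $\mathfrak a\subseteq A_{\bar 0}$ such that $\mathfrak a$ and $A/\mathfrak a$ are free $\Bbbk$-modules. An $(A,\mathfrak a)$-basis is a $\Bbbk$-basis $B=B_{\mathfrak a}\sqcup B_{\mathfrak c}\sqcup B_{\bar 1}$ of $A$, where $B_{\mathfrak a}$, $B_{\mathfrak c}$, $B_{\bar 1}$ are bases of $\mathfrak a$, of a chosen $\Bbbk$-module complement $\mathfrak c$ of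 $\mathfrak a$ in $A_{\bar 0}$, and of $A_{\bar 1}$, respectively. For $a\in A$ put $\xi^a_{r,s}:=aE_{r,s}\in M_n(A)$ ($E_{r,s}$ the matrix units; $M_n(A)$ is a superalgebra via parities of entries). Write $[1,n]=\{1,\dots,n\}$. The symmetric group $\mathfrak S_d$ acts on the right on words by $(x_1\cdots x_d)\sigma=x_{\sigma 1}\cdots x_{\sigma d}$, diagonally on tuples of words, and on $M_n(A)^{\otimes d}$ by superalgebra automorphisms $(\xi^{a_1}_{r_1,s_1}\otimes\cdots\otimes\xi^{a_d}_{r_d,s_d})^\sigma=(-1)^{\langle\sigma;\boldsymbol a\rangle}\xi^{a_{\sigma1}}_{r_{\sigma1},s_{\sigma1}}\otimes\cdots\otimes\xi^{a_{\sigma d}}_{r_{\sigma d},s_{\sigma d}}$ for homogeneous $a_i$, where $\langle\sigma;\boldsymbol a\rangle=\#\{(k,l): k<l,\ \sigma^{-1}k>\sigma^{-1}l,\ a_k,a_l \text{ odd}\}$. Define $S^A(n,d):=(M_n(A)^{\otimes d})^{\mathfrak S_d}$; likewise $S^{\mathfrak a}(n,d):=(M_n(\mathfrak a)^{\otimes d})^{\mathfrak S_d}\subseteq S^A(n,d)$. $\mathrm{Tri}^B(n,d)$ is the set of triples $(\boldsymbol b,\boldsymbol r,\boldsymbol s)\in B^d\times[1,n]^d\times[1,n]^d$ such that for $k\ne l$ the equality $(b_k,r_k,s_k)=(b_l,r_l,s_l)$ holds only if $b_k$ is even. For such a triple let $\xi^{\boldsymbol b}_{\boldsymbol r,\boldsymbol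 s}:=\sum_\sigma(\xi^{b_1}_{r_1,s_1}\otimes\cdots\otimes\xi^{b_d}_{r_d,s_d})^\sigma\in S^A(n,d)$, with $\sigma$ over representatives of the cosets $\mathfrak S_{\boldsymbol b,\boldsymbol r,\boldsymbol s}\backslash\mathfrak S_d$, where $\mathfrak S_{\boldsymbol b,\boldsymbol r,\boldsymbol s}$ is the stabilizer of the triple. Let $[\boldsymbol b,\boldsymbol r,\boldsymbol s]^b_{r,s}:=\#\{k: (b_k,r_k,s_k)=(b,r,s)\}$, $[\boldsymbol b,\boldsymbol r,\boldsymbol s]^!_{\mathfrak c}:=\prod_{b\in B_{\mathfrak c},\,r,s\in[1,n]}[\boldsymbol b,\boldsymbol r,\boldsymbol s]^b_{r,s}!$, and $\eta^{\boldsymbol b}_{\boldsymbol r,\boldsymbol s}:=[\boldsymbol b,\boldsymbol r,\boldsymbol s]^!_{\mathfrak c}\,\xi^{\boldsymbol b}_{\boldsymbol r,\boldsymbol s}$. $T^A_{\mathfrak a}(n,d)$ is the $\Bbbk$-span of all $\eta^{\boldsymbol b}_{\boldsymbol r,\boldsymbol s}$ with $(\boldsymbol b,\boldsymbol r,\boldsymbol s)\in\mathrm{Tri}^B(n,d)$. Star product: for $x\in M_n(A)^{\otimes d}$, $y\in M_n(A)^{\otimes e}$, $x*y:=\sum_\sigma(x\otimes y)^\sigma$, with $\sigma$ over the shortest representatives of the cosets $(\mathfrak S_d\times\mathfrak S_e)\backslash\mathfrak S_{d+e}$; it is associative, with unit $1\in\Bbbk=M_n(A)^{\otimes0}$. For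 submodules $U,V$, $U*V$ denotes the $\Bbbk$-span of all $u*v$; $\mathtt{Star}^0Y=\Bbbk$. *)

theory Defs
  imports
    "HOL-Analysis.Finite_Cartesian_Product"
    "HOL-Combinatorics.Permutations"
    "HOL-Library.Poly_Mapping"
    "HOL-Library.Z2"
begin

section \<open>Free modules and direct sums\<close>

definition module_basis :: "('k::comm_ring_1 \<Rightarrow> 'b::ab_group_add \<Rightarrow> 'b) \<Rightarrow> 'b set \<Rightarrow> 'b set \<Rightarrow> bool" where
  "module_basis smul B U \<longleftrightarrow> \<not> module.dependent smul B \<and> module.span smul B = U"

definition free_submodule :: "('k::comm_ring_1 \<Rightarrow> 'b::ab_group_add \<Rightarrow> 'b) \<Rightarrow> 'b set \<Rightarrow> bool" where
  "free_submodule smul U \<longleftrightarrow> (\<exists>B. module_basis smul B U)"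

text \<open>The quotient by the submodule \<open>U\<close> is free: the cosets of the elements of \<open>C\<close> generate
  the quotient and are (pairwise distinct and) linearly independent.\<close>

definition free_quotient :: "('k::comm_ring_1 \<Rightarrow> 'b::ab_group_add \<Rightarrow> 'b) \<Rightarrow> 'b set \<Rightarrow> bool" where
  "free_quotient smul U \<longleftrightarrow>
     (\<exists>C. module.span smul (C \<union> U) = UNIV \<and>
        (\<forall>t u. finite t \<longrightarrow> t \<subseteq> C \<longrightarrow> (\<Sum>v\<in>t. smul (u v) v) \<in> U \<longrightarrow> (\<forall>v\<in>t. u v = 0)))"

definition is_direct_sum :: "'i set \<Rightarrow> ('i \<Rightarrow> 'b::ab_group_add set) \<Rightarrow> 'b set \<Rightarrow> bool" where
  "is_direct_sum I U W \<longleftrightarrow>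
     W = {\<Sum>i\<in>I. u i | u. \<forall>i\<in>I. u i \<in> U i} \<and>
     (\<forall>u. (\<forall>i\<in>I. u i \<in> U i) \<longrightarrow> (\<Sum>i\<in>I. u i) = 0 \<longrightarrow> (\<forall>i\<in>I. u i = 0))"


section \<open>Good pairs\<close>

text \<open>The class \<^class>\<open>ring\<close> does not require a unit. The parts of even and odd elements are
  \<open>A 0\<close> and \<open>A 1\<close>.\<close>

locale superalgebra = module smul
  for smul :: "'k::comm_ring_1 \<Rightarrow> 'a::ring \<Rightarrow> 'a" +
  fixes A :: "bit \<Rightarrow> 'a set"
  assumes smul_mult_left: "smul c (x * y) = smul c x * y"
    and smul_mult_right: "smul c (x * y) = x * smul c y"
    and subspace_parity: "subspace (A p)"
    and parity_direct_sum: "is_direct_sum UNIV A UNIV"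
    and parity_mult: "x \<in> A p \<Longrightarrow> y \<in> A q \<Longrightarrow> x * y \<in> A (p + q)"

locale good_pair = superalgebra smul A
  for smul :: "'k::{idom,ring_char_0} \<Rightarrow> 'a::ring \<Rightarrow> 'a" and A :: "bit \<Rightarrow> 'a set" +
  fixes \<aa> :: "'a set"
  assumes free_parity: "free_submodule smul (A p)"
    and subalgebra_subset: "\<aa> \<subseteq> A 0"
    and subalgebra_subspace: "subspace \<aa>"
    and subalgebra_mult: "x \<in> \<aa> \<Longrightarrow> y \<in> \<aa> \<Longrightarrow> x * y \<in> \<aa>"
    and free_subalgebra: "free_submodule smul \<aa>"
    and free_quotient_subalgebra: "free_quotient smul \<aa>"

text \<open>Here \<open>\<cc>\<close> is the chosen complement of \<open>\<aa>\<close> in the even part. The three parts of the basis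
  are automatically disjoint.\<close>

locale good_pair_basis = good_pair smul A \<aa>
  for smul :: "'k::{idom,ring_char_0} \<Rightarrow> 'a::ring \<Rightarrow> 'a" and A :: "bit \<Rightarrow> 'a set" and \<aa> :: "'a set" +
  fixes \<cc> B\<^sub>\<aa> B\<^sub>\<cc> B\<^sub>1 :: "'a set"
  assumes complement_subspace: "subspace \<cc>"
    and complement: "\<aa> \<inter> \<cc> = {0}" "{x + y | x y. x \<in> \<aa> \<and> y \<in> \<cc>} = A 0"
    and basis_subalgebra: "module_basis smul B\<^sub>\<aa> \<aa>"
    and basis_complement: "module_basis smul B\<^sub>\<cc> \<cc>"
    and basis_odd: "module_basis smul B\<^sub>1 (A 1)"


section \<open>Matrices\<close>

text \<open>The index set $[1,n]$ is the (nonempty) finite type \<open>'n\<close>.\<close>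

definition mat_scale :: "('k \<Rightarrow> 'a \<Rightarrow> 'a) \<Rightarrow> 'k \<Rightarrow> 'a^'n^'n \<Rightarrow> 'a^'n^'n" where
  "mat_scale smul c X = (\<chi> i j. smul c (X $ i $ j))"

definition mat_elt :: "'a::zero \<Rightarrow> 'n \<Rightarrow> 'n \<Rightarrow> 'a^'n^'n" where
  "mat_elt a r s = (\<chi> i j. if i = r \<and> j = s then a else 0)"


section \<open>Tensor powers\<close>

text \<open>All tensor powers of a module \<open>M\<close> live in its tensor algebra \<open>T\<close>, as its homogeneous
  components. The word \<open>[x\<^sub>1, \<dots>, x\<^sub>d]\<close> over \<open>M\<close> gives the pure tensor
  \<open>\<iota> x\<^sub>1 * \<dots> * \<iota> x\<^sub>d\<close>, so that the product of \<open>T\<close> is the outer tensor product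
  \<open>x \<otimes> y\<close> of an element of the \<open>d\<close>-th and an element of the \<open>e\<close>-th tensor power.
  (It is not the product of the individual superalgebras $M_n(A)^{\otimes d}$.)

  As a module, \<open>T\<close> is presented by the words over \<open>M\<close> as generators and the
  multilinearity relations; this determines \<open>T\<close> up to unique isomorphism.\<close>

definition pure_tensor :: "('m \<Rightarrow> 't::ring_1) \<Rightarrow> 'm list \<Rightarrow> 't" where
  "pure_tensor \<iota> w = prod_list (map \<iota> w)"

definition multilinear_relators :: "('k::comm_ring_1 \<Rightarrow> 'm::ab_group_add \<Rightarrow> 'm) \<Rightarrow> ('m list \<Rightarrow>\<^sub>0 'k) set" where
  "multilinear_relators mscale =
     {Poly_Mapping.single (v @ (x + y) # w) 1 - Poly_Mapping.single (v @ x # w) 1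
        - Poly_Mapping.single (v @ y # w) 1 | v w x y. True} \<union>
     {Poly_Mapping.single (v @ mscale c x # w) 1 - Poly_Mapping.single (v @ x # w) c | v w c x. True}"

locale tensor_algebra = module_hom mscale tscale \<iota>
  for mscale :: "'k::comm_ring_1 \<Rightarrow> 'm::ab_group_add \<Rightarrow> 'm"
    and tscale :: "'k \<Rightarrow> 't::ring_1 \<Rightarrow> 't"
    and \<iota> :: "'m \<Rightarrow> 't" +
  assumes tscale_mult_left: "tscale c (x * y) = tscale c x * y"
    and tscale_mult_right: "tscale c (x * y) = x * tscale c y"
    and generated: "module.span tscale (range (pure_tensor \<iota>)) = UNIV"
    and presented: "(\<Sum>w\<in>Poly_Mapping.keys f. tscale (Poly_Mapping.lookup f w) (pure_tensor \<iota> w)) = 0 \<Longrightarrow>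
      f \<in> module.span (\<lambda>c. Poly_Mapping.map ((*) c)) (multilinear_relators mscale)"


section \<open>The algebras $S^A(n,d)$ and $T^A_{\mathfrak a}(n,d)$, and the star product\<close>

text \<open>Positions in a word are numbered from \<open>0\<close>; the product \<open>\<sigma>\<tau>\<close> in the symmetric group is
  \<open>\<sigma> \<circ> \<tau>\<close>, for which \<open>permute_list\<close> is a right action on words.\<close>

definition sym_grp :: "nat \<Rightarrow> (nat \<Rightarrow> nat) set" where
  "sym_grp d = {\<sigma>. \<sigma> permutes {..<d}}"

text \<open>$\langle\sigma;\boldsymbol a\rangle$, as a function of the word of parities of $\boldsymbol a$.\<close>

definition odd_inversions :: "(nat \<Rightarrow> nat) \<Rightarrow> bit list \<Rightarrow> nat" where
  "odd_inversions \<sigma> ps =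
     card {(k, l). k < l \<and> l < length ps \<and> inv \<sigma> k > inv \<sigma> l \<and> ps ! k = 1 \<and> ps ! l = 1}"

definition perm_length :: "nat \<Rightarrow> (nat \<Rightarrow> nat) \<Rightarrow> nat" where
  "perm_length d \<sigma> = card {(k, l). k < l \<and> l < d \<and> \<sigma> k > \<sigma> l}"

definition young_subgrp :: "nat \<Rightarrow> nat \<Rightarrow> (nat \<Rightarrow> nat) set" where
  "young_subgrp d e = {\<tau> \<in> sym_grp (d + e). \<tau> ` {..<d} = {..<d}}"

definition shortest_reps :: "nat \<Rightarrow> nat \<Rightarrow> (nat \<Rightarrow> nat) set" where
  "shortest_reps d e = {\<sigma> \<in> sym_grp (d + e).
     \<forall>\<tau>\<in>young_subgrp d e. perm_length (d + e) \<sigma> \<le> perm_length (d + e) (\<tau> \<circ> \<sigma>)}"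

text \<open>A triple $(\boldsymbol b,\boldsymbol r,\boldsymbol s)$ of words of length $d$ is encoded as
  one word of length $d$ of triples $(b_k,r_k,s_k)$.\<close>

definition stabilizer :: "'x list \<Rightarrow> (nat \<Rightarrow> nat) set" where
  "stabilizer w = {\<sigma> \<in> sym_grp (length w). permute_list \<sigma> w = w}"

definition stabilizer_cosets :: "'x list \<Rightarrow> (nat \<Rightarrow> nat) set set" where
  "stabilizer_cosets w = (\<lambda>\<sigma>. (\<lambda>\<tau>. \<tau> \<circ> \<sigma>) ` stabilizer w) ` sym_grp (length w)"

definition Tri :: "(bit \<Rightarrow> 'a set) \<Rightarrow> 'a set \<Rightarrow> nat \<Rightarrow> ('a \<times> 'n \<times> 'n) list set" where
  "Tri A B d = {w. length w = d \<and> fst ` set w \<subseteq> B \<and>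
     (\<forall>k<d. \<forall>l<d. k \<noteq> l \<longrightarrow> w ! k = w ! l \<longrightarrow> fst (w ! k) \<in> A 0)}"

text \<open>Only the letters of the word contribute a factor other than \<open>0! = 1\<close>, and restricting to
  them keeps the product finite.\<close>

definition fact_mult :: "'a set \<Rightarrow> ('a \<times> 'n::finite \<times> 'n) list \<Rightarrow> nat" where
  "fact_mult B w = (\<Prod>b\<in>B \<inter> fst ` set w. \<Prod>r\<in>UNIV. \<Prod>s\<in>UNIV. fact (count_list w (b, r, s)))"

context
  fixes smul :: "'k::comm_ring_1 \<Rightarrow> 'a::ring \<Rightarrow> 'a"
    and A :: "bit \<Rightarrow> 'a set"
    and tscale :: "'k \<Rightarrow> 't::ring_1 \<Rightarrow> 't"
    and \<iota> :: "'a^'n::finite^'n \<Rightarrow> 't"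
begin

definition tensor_power :: "('a^'n^'n) set \<Rightarrow> nat \<Rightarrow> 't set" where
  "tensor_power M d = module.span tscale {pure_tensor \<iota> w | w. length w = d \<and> set w \<subseteq> M}"

definition elt_tensor :: "('a \<times> 'n \<times> 'n) list \<Rightarrow> 't" where
  "elt_tensor w = pure_tensor \<iota> (map (\<lambda>(a, r, s). mat_elt a r s) w)"

text \<open>The formula is multilinear in the word, so such a linear map exists. It is unique on
  \<open>tensor_power UNIV d\<close>, the only place where \<open>perm_act d \<sigma>\<close> is used; its values on other
  homogeneous components are irrelevant.\<close>

definition perm_act :: "nat \<Rightarrow> (nat \<Rightarrow> nat) \<Rightarrow> 't \<Rightarrow> 't" where
  "perm_act d \<sigma> = (SOME f. module_hom tscale tscale f \<and>
     (\<forall>w ps. length w = d \<longrightarrow> length ps = d \<longrightarrow> (\<forall>k<d. fst (w ! k) \<in> A (ps ! k)) \<longrightarrow>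
        f (elt_tensor w) = tscale ((- 1) ^ odd_inversions \<sigma> ps) (elt_tensor (permute_list \<sigma> w))))"

definition perm_invariants :: "'t set \<Rightarrow> nat \<Rightarrow> 't set" where
  "perm_invariants U d = {x \<in> U. \<forall>\<sigma>\<in>sym_grp d. perm_act d \<sigma> x = x}"

text \<open>For a subalgebra \<open>\<aa>\<close> of \<open>A 0\<close> this is $S^{\mathfrak a}(n,d)$; for \<open>\<aa> = UNIV\<close> it
  is $S^A(n,d)$.\<close>

definition schur_alg :: "'a set \<Rightarrow> nat \<Rightarrow> 't set" where
  "schur_alg \<aa> d = perm_invariants (tensor_power {X. \<forall>i j. X $ i $ j \<in> \<aa>} d) d"

definition xi_elt :: "('a \<times> 'n \<times> 'n) list \<Rightarrow> 't" where
  "xi_elt w = (\<Sum>C\<in>stabilizer_cosets w. perm_act (length w) (SOME \<sigma>. \<sigma> \<in> C) (elt_tensor w))"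

definition eta_elt :: "'a set \<Rightarrow> ('a \<times> 'n \<times> 'n) list \<Rightarrow> 't" where
  "eta_elt B\<^sub>\<cc> w = tscale (of_nat (fact_mult B\<^sub>\<cc> w)) (xi_elt w)"

definition T_alg :: "'a set \<Rightarrow> 'a set \<Rightarrow> 'a set \<Rightarrow> nat \<Rightarrow> 't set" where
  "T_alg B\<^sub>\<aa> B\<^sub>\<cc> B\<^sub>1 d = module.span tscale (eta_elt B\<^sub>\<cc> ` Tri A (B\<^sub>\<aa> \<union> B\<^sub>\<cc> \<union> B\<^sub>1) d)"

definition star :: "nat \<Rightarrow> nat \<Rightarrow> 't \<Rightarrow> 't \<Rightarrow> 't" where
  "star d e x y = (\<Sum>\<sigma>\<in>shortest_reps d e. perm_act (d + e) \<sigma> (x * y))"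

definition star_span :: "nat \<Rightarrow> nat \<Rightarrow> 't set \<Rightarrow> 't set \<Rightarrow> 't set" where
  "star_span d e U V = module.span tscale {star d e u v | u v. u \<in> U \<and> v \<in> V}"

primrec star_power :: "nat \<Rightarrow> 't set \<Rightarrow> 't set" where
  "star_power 0 Y = module.span tscale {1}"
| "star_power (Suc e) Y = star_span e 1 (star_power e Y) Y"

text \<open>The submodule $Y$ of $M_n(A)$, viewed in the first tensor power.\<close>

definition Y_sub :: "'a set \<Rightarrow> 't set" where
  "Y_sub B = \<iota> ` module.span (mat_scale smul) {mat_elt b r s | b r s. b \<in> B}"

end

end

theory Submission
  imports Defs "HOL-Combinatorics.Multiset_Permutations"
begin

text \<open>The tensors \<open>E\<^sub>w\<close> of the words \<open>w\<close> in the letters \<open>(b, r, s)\<close> with \<open>b \<in> B\<close> form a basis of the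
  tensor algebra, which is therefore torsion free. Let \<open>Sym\<close> be the sum over the whole symmetric group.
  Since every permutation is uniquely a Young subgroup element times a shortest representative,
  \<open>Sym x * Sym y = Sym (x \<otimes> y)\<close>; hence \<open>Star\<^sup>e Y\<close> is spanned by the \<open>Sym E\<^sub>v\<close> with \<open>v\<close> a word in the
  letters with \<open>b \<notin> B\<^sub>\<aa>\<close>. Moreover \<open>Sym E\<^sub>w\<close> is \<open>\<xi>\<^sub>w\<close> times the order of the stabilizer of \<open>w\<close> if \<open>w\<close>
  lies in \<open>Tri\<close>, and \<open>0\<close> if an odd letter is repeated. Cancelling the order of the stabilizer of \<open>u\<close>
  gives \<open>\<xi>\<^sub>u * Sym E\<^sub>v = \<eta>\<^sub>u\<^sub>v\<close> for words \<open>u\<close> in the letters with \<open>b \<in> B\<^sub>\<aa>\<close>, and the \<open>\<xi>\<^sub>u\<close> span \<open>S\<^sup>\<aa>\<close>. Up to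
  sign every \<open>\<eta>\<^sub>w\<close> is of this form, and \<open>e\<close> is the number of letters of \<open>w\<close> with \<open>b \<notin> B\<^sub>\<aa>\<close>.\<close>

section \<open>Signs of permutations\<close>

text \<open>Both \<open>xi_elt\<close> and \<open>star\<close> are sums over cosets, so a head-on
  computation of their products would run into double cosets. Sums over the whole group differ from
  them only by positive integer factors, and such factors can be cancelled because the ground ring
  is a domain of characteristic 0 and tensors of basis words are linearly independent. The tensor
  algebra is abstract, known only by generators and relations, and \<open>perm_act\<close> is a mere
  choice. Hence the existence of the action and the independence of the basis tensors are both
  derived from the presentation: each multilinear function on words gives a linear map on the tensor
  algebra. The factor in \<open>eta_elt\<close> is what remains after the cancellation. The
  stabilizer of uv has order the product of the orders for u and v, as u and v share no letter; and
  for a word in \<open>Tri\<close> the order for v is exactly the product of factorials over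
  \<open>B\<^sub>\<cc>\<close>, since odd letters occur once. Directness holds because the basis
  tensors occurring in \<eta> of w are rearrangements of w, so that different e involve disjoint
  sets of basis tensors.\<close>

lemma neg_one_power_card:
  assumes "finite S"
  shows "(- 1 :: 'k::comm_ring_1) ^ card {x \<in> S. P x} = (\<Prod>x\<in>S. if P x then - 1 else 1)"
  using assms by (simp add: prod.If_cases Int_def)

text \<open>Stands for the two-element subsets of \<open>S\<close>, each listed once in its
  increasing order.\<close>

definition increasing_pairs :: "nat set \<Rightarrow> (nat \<times> nat) set" where
  "increasing_pairs S = {(k, l). k \<in> S \<and> l \<in> S \<and> k < l}"

lemma finite_increasing_pairs: "finite S \<Longrightarrow> finite (increasing_pairs S)"
  by (rule finite_subset[of _ "S \<times> S"]) (auto simp: increasing_pairs_def)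

text \<open>An injection induces a bijection on two-element subsets. It may reverse a pair;
  \<open>min\<close> and \<open>max\<close> restore the order, and the symmetry of \<open>h\<close>
  absorbs the exchange.\<close>

lemma prod_increasing_pairs_image:
  assumes inj: "inj_on f S" and sym: "\<And>i j. h i j = h j i"
  shows "(\<Prod>(k, l)\<in>increasing_pairs (f ` S). h k l) = (\<Prod>(k, l)\<in>increasing_pairs S. h (f k) (f l))"
proof -
  define g where "g = inv_into S f"
  have g: "g (f k) = k" if "k \<in> S" for k
    using that inj by (simp add: g_def)
  have f: "f k = f l \<longleftrightarrow> k = l" if "k \<in> S" "l \<in> S" for k l
    using that inj by (simp add: inj_on_eq_iff)
  show ?thesis
    by (rule prod.reindex_bij_witness
        [where i = "\<lambda>(k, l). (min (f k) (f l), max (f k) (f l))" and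
           j = "\<lambda>(k, l). (min (g k) (g l), max (g k) (g l))"])
      (auto simp: increasing_pairs_def g f min_def max_def intro: sym split: if_splits,
        (metis f less_le less_irrefl)+)
qed

definition odd_positions :: "bit list \<Rightarrow> nat set" where
  "odd_positions ps = {k. k < length ps \<and> ps ! k = 1}"

lemma finite_odd_positions: "finite (odd_positions ps)"
  by (simp add: odd_positions_def)

text \<open>As a product over pairs of odd positions, the sign of a composite can be compared factor
  by factor.\<close>

lemma neg_one_power_odd_inversions:
  "(- 1 :: 'k::comm_ring_1) ^ odd_inversions \<sigma> ps =
     (\<Prod>(k, l)\<in>increasing_pairs (odd_positions ps). if inv \<sigma> l < inv \<sigma> k then - 1 else 1)"
proof -
  have "odd_inversions \<sigma> ps =
      card {x \<in> increasing_pairs (odd_positions ps). case x of (k, l) \<Rightarrow> inv \<sigma> l < inv \<sigma> k}"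
    unfolding odd_inversions_def
    by (rule arg_cong[of _ _ card]) (auto simp: increasing_pairs_def odd_positions_def)
  then show ?thesis
    by (simp add: neg_one_power_card finite_increasing_pairs finite_odd_positions case_prod_beta)
qed

text \<open>The cocycle identity that makes the signed permutations of tensors a right action. A
  pair of odd positions is inverted by the composite exactly when one of the two steps, but not
  both, inverts it.\<close>

lemma neg_one_power_odd_inversions_comp:
  assumes \<sigma>: "\<sigma> \<in> sym_grp (length ps)" and \<tau>: "\<tau> \<in> sym_grp (length ps)"
  shows "(- 1 :: 'k::comm_ring_1) ^ odd_inversions (\<sigma> \<circ> \<tau>) ps =
     (- 1) ^ odd_inversions \<sigma> ps * (- 1) ^ odd_inversions \<tau> (permute_list \<sigma> ps)"
proof -
  let ?O = "odd_positions ps"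
  have p: "\<sigma> permutes {..<length ps}" "\<tau> permutes {..<length ps}"
    using assms by (auto simp: sym_grp_def)
  have "bij \<sigma>" "bij \<tau>"
    using p permutes_bij by auto
  then have inv_comp: "inv (\<sigma> \<circ> \<tau>) = inv \<tau> \<circ> inv \<sigma>"
    by (rule o_inv_distrib)
  \<comment> \<open>The sign tells whether \<open>inv \<tau>\<close> keeps the relative order of i
    and j. It is symmetric in i and j, so it does not matter whether \<open>inv \<sigma>\<close> has
    already reversed the pair.\<close>
  define h where "h i j = (if (i < j) = (inv \<tau> i < inv \<tau> j) then 1 else - 1 :: 'k)" for i j
  have inj: "inj (inv \<sigma>)" "inj (inv \<tau>)"
    using p permutes_inv permutes_inj by metis+
  have h_sym: "h i j = h j i" for i j
    using injD[OF inj(2), of i j] by (cases i j rule: linorder_cases) (auto simp: h_def)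
  have odd': "odd_positions (permute_list \<sigma> ps) = inv \<sigma> ` ?O"
  proof (rule set_eqI)
    fix k
    have "k \<in> inv \<sigma> ` ?O \<longleftrightarrow> \<sigma> k \<in> ?O"
      using p(1) by (metis (no_types, lifting) image_iff permutes_inverses)
    also have "\<dots> \<longleftrightarrow> k \<in> odd_positions (permute_list \<sigma> ps)"
      using p(1) permutes_in_image[OF p(1), of k] by (auto simp: odd_positions_def permute_list_nth)
    finally show "k \<in> odd_positions (permute_list \<sigma> ps) \<longleftrightarrow> k \<in> inv \<sigma> ` ?O" ..
  qed
  have "(- 1) ^ odd_inversions \<tau> (permute_list \<sigma> ps) =
      (\<Prod>(k, l)\<in>increasing_pairs (inv \<sigma> ` ?O). h k l)"
    unfolding neg_one_power_odd_inversions odd'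
    by (rule prod.cong) (auto simp: increasing_pairs_def h_def inj_eq[OF inj(2)])
  also have "\<dots> = (\<Prod>(k, l)\<in>increasing_pairs ?O. h (inv \<sigma> k) (inv \<sigma> l))"
    by (rule prod_increasing_pairs_image) (use inj(1) h_sym in \<open>auto intro: inj_on_subset\<close>)
  finally have "(- 1) ^ odd_inversions \<sigma> ps * (- 1) ^ odd_inversions \<tau> (permute_list \<sigma> ps) =
      (\<Prod>(k, l)\<in>increasing_pairs ?O.
         (if inv \<sigma> l < inv \<sigma> k then - 1 else 1) * h (inv \<sigma> k) (inv \<sigma> l))"
    unfolding neg_one_power_odd_inversions by (simp add: prod.distrib case_prod_beta)
  also have "\<dots> = (- 1) ^ odd_inversions (\<sigma> \<circ> \<tau>) ps"
    unfolding neg_one_power_odd_inversions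
  proof (rule prod.cong[OF refl], clarify)
    fix k l assume "(k, l) \<in> increasing_pairs ?O"
    then have "k \<noteq> l" by (auto simp: increasing_pairs_def)
    then have "inv \<sigma> k \<noteq> inv \<sigma> l" "inv \<tau> (inv \<sigma> k) \<noteq> inv \<tau> (inv \<sigma> l)"
      using inj by (auto dest!: injD)
    then show "(if inv \<sigma> l < inv \<sigma> k then - 1 else 1) * h (inv \<sigma> k) (inv \<sigma> l) =
        (if inv (\<sigma> \<circ> \<tau>) l < inv (\<sigma> \<circ> \<tau>) k then - 1 else 1)"
      by (auto simp: h_def inv_comp)
  qed
  finally show ?thesis ..
qed

section \<open>The symmetric group\<close>

lemma sym_grp_id: "id \<in> sym_grp d"
  by (simp add: sym_grp_def permutes_id)

lemma sym_grp_comp: "\<sigma> \<in> sym_grp d \<Longrightarrow> \<tau> \<in> sym_grp d \<Longrightarrow> \<sigma> \<circ> \<tau> \<in> sym_grp d"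
  by (simp add: sym_grp_def permutes_compose)

lemma sym_grp_inv: "\<sigma> \<in> sym_grp d \<Longrightarrow> inv \<sigma> \<in> sym_grp d"
  by (simp add: sym_grp_def permutes_inv)

lemma sym_grp_inv_o: "\<sigma> \<in> sym_grp d \<Longrightarrow> inv \<sigma> \<circ> \<sigma> = id" "\<sigma> \<in> sym_grp d \<Longrightarrow> \<sigma> \<circ> inv \<sigma> = id"
  by (auto simp: sym_grp_def permutes_inv_o)

lemma finite_sym_grp: "finite (sym_grp d)"
  by (simp add: sym_grp_def finite_permutations)

lemma card_sym_grp: "card (sym_grp d) = fact d"
  by (simp add: sym_grp_def card_permutations)

lemma bij_betw_sym_grp_comp:
  assumes "\<rho> \<in> sym_grp d"
  shows "bij_betw (\<lambda>\<sigma>. \<rho> \<circ> \<sigma>) (sym_grp d) (sym_grp d)" "bij_betw (\<lambda>\<sigma>. \<sigma> \<circ> \<rho>) (sym_grp d) (sym_grp d)"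
proof -
  note [simp] = sym_grp_comp sym_grp_inv assms sym_grp_inv_o[OF assms]
  show "bij_betw (\<lambda>\<sigma>. \<rho> \<circ> \<sigma>) (sym_grp d) (sym_grp d)"
    by (rule bij_betw_byWitness[where f' = "\<lambda>\<sigma>. inv \<rho> \<circ> \<sigma>"])
      (auto simp flip: comp_assoc simp del: comp_apply)
  show "bij_betw (\<lambda>\<sigma>. \<sigma> \<circ> \<rho>) (sym_grp d) (sym_grp d)"
    by (rule bij_betw_byWitness[where f' = "\<lambda>\<sigma>. \<sigma> \<circ> inv \<rho>"]) (auto simp: comp_assoc)
qed

lemma permute_list_comp:
  "\<sigma> \<in> sym_grp (length w) \<Longrightarrow> \<tau> \<in> sym_grp (length w) \<Longrightarrow>
    permute_list (\<sigma> \<circ> \<tau>) w = permute_list \<tau> (permute_list \<sigma> w)"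
  by (simp add: sym_grp_def permute_list_compose)

section \<open>Block permutations and the Young subgroup\<close>

text \<open>The second branch has no upper bound: for k \<ge> d + e it returns k when
  \<open>\<tau>\<close> permutes {..<e}, as \<open>\<tau>\<close> then fixes k - d.\<close>

definition block_perm :: "nat \<Rightarrow> (nat \<Rightarrow> nat) \<Rightarrow> (nat \<Rightarrow> nat) \<Rightarrow> nat \<Rightarrow> nat" where
  "block_perm d \<sigma> \<tau> k = (if k < d then \<sigma> k else \<tau> (k - d) + d)"

lemma block_perm_comp_inv:
  assumes "\<sigma> permutes {..<d}" "\<tau> permutes {..<e}"
  shows "block_perm d \<sigma> \<tau> (block_perm d (inv \<sigma>) (inv \<tau>) k) = k"
    and "block_perm d (inv \<sigma>) (inv \<tau>) (block_perm d \<sigma> \<tau> k) = k"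
  using permutes_in_image[OF assms(1), of k] permutes_in_image[OF permutes_inv[OF assms(1)], of k]
    permutes_inverses[OF assms(1)] permutes_inverses[OF assms(2)]
  by (auto simp: block_perm_def)

lemma block_perm_permutes:
  assumes "\<sigma> permutes {..<d}" "\<tau> permutes {..<e}"
  shows "block_perm d \<sigma> \<tau> permutes {..<d + e}"
proof -
  have "bij (block_perm d \<sigma> \<tau>)"
    by (rule o_bij[where g = "block_perm d (inv \<sigma>) (inv \<tau>)"])
      (auto simp: block_perm_comp_inv[OF assms])
  moreover have "block_perm d \<sigma> \<tau> k = k" if "k \<notin> {..<d + e}" for k
    using that permutes_not_in[OF assms(2), of "k - d"] by (auto simp: block_perm_def)
  ultimately show ?thesis
    by (simp add: permutes_def bij_iff)
qed

lemma inv_block_perm: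
  assumes "\<sigma> permutes {..<d}" "\<tau> permutes {..<e}"
  shows "inv (block_perm d \<sigma> \<tau>) = block_perm d (inv \<sigma>) (inv \<tau>)"
  by (rule inv_unique_comp) (auto simp: fun_eq_iff block_perm_comp_inv[OF assms])

lemma block_perm_mem_young_subgrp:
  assumes "\<sigma> \<in> sym_grp d" "\<tau> \<in> sym_grp e"
  shows "block_perm d \<sigma> \<tau> \<in> young_subgrp d e"
proof -
  have p: "\<sigma> permutes {..<d}" "\<tau> permutes {..<e}"
    using assms by (auto simp: sym_grp_def)
  have "block_perm d \<sigma> \<tau> ` {..<d} = \<sigma> ` {..<d}"
    by (rule image_cong) (auto simp: block_perm_def)
  then show ?thesis
    using block_perm_permutes[OF p] permutes_image[OF p(1)] by (simp add: young_subgrp_def sym_grp_def)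
qed

text \<open>Since {..<d} is mapped onto itself, injectivity keeps every other point out of
  it.\<close>

lemma young_subgrp_less_iff:
  assumes "\<tau> \<in> young_subgrp d e"
  shows "\<tau> k < d \<longleftrightarrow> k < d"
proof -
  have "inj \<tau>" using assms by (auto simp: young_subgrp_def sym_grp_def permutes_inj)
  then show ?thesis using assms by (auto simp: young_subgrp_def set_eq_iff image_iff dest: injD)
qed

lemma bij_betw_block_perm:
  "bij_betw (\<lambda>(\<sigma>, \<tau>). block_perm d \<sigma> \<tau>) (sym_grp d \<times> sym_grp e) (young_subgrp d e)"
proof (rule bij_betwI')
  fix x y assume "x \<in> sym_grp d \<times> sym_grp e" "y \<in> sym_grp d \<times> sym_grp e"
  then obtain \<sigma> \<tau> \<sigma>' \<tau>' where xy: "x = (\<sigma>, \<tau>)" "y = (\<sigma>', \<tau>')"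
    and p: "\<sigma> permutes {..<d}" "\<tau> permutes {..<e}" "\<sigma>' permutes {..<d}" "\<tau>' permutes {..<e}"
    by (auto simp: sym_grp_def)
  have "\<sigma> = \<sigma>' \<and> \<tau> = \<tau>'" if eq: "block_perm d \<sigma> \<tau> = block_perm d \<sigma>' \<tau>'"
  proof
    have "\<sigma> k = \<sigma>' k" for k
      using fun_cong[OF eq, of k] permutes_not_in[OF p(1), of k] permutes_not_in[OF p(3), of k]
      by (cases "k < d") (auto simp: block_perm_def)
    then show "\<sigma> = \<sigma>'" ..
    have "\<tau> k = \<tau>' k" for k
      using fun_cong[OF eq, of "k + d"] by (auto simp: block_perm_def)
    then show "\<tau> = \<tau>'" ..
  qed
  then show "(case x of (\<sigma>, \<tau>) \<Rightarrow> block_perm d \<sigma> \<tau>) = (case y of (\<sigma>, \<tau>) \<Rightarrow> block_perm d \<sigma> \<tau>) \<longleftrightarrow> x = y"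
    by (auto simp: xy)
next
  fix x assume "x \<in> sym_grp d \<times> sym_grp e"
  then show "(case x of (\<sigma>, \<tau>) \<Rightarrow> block_perm d \<sigma> \<tau>) \<in> young_subgrp d e"
    by (auto intro: block_perm_mem_young_subgrp)
next
  fix \<rho> assume \<rho>: "\<rho> \<in> young_subgrp d e"
  then have perm: "\<rho> permutes {..<d + e}" by (auto simp: young_subgrp_def sym_grp_def)
  have less: "\<rho> k < d \<longleftrightarrow> k < d" for k
    by (rule young_subgrp_less_iff[OF \<rho>])
  have inj: "\<rho> k = \<rho> l \<Longrightarrow> k = l" for k l
    using permutes_inj[OF perm] by (auto dest: injD)
  \<comment> \<open>The two components are the restriction to the first d positions and the
    restriction to the rest, shifted down by d. The subtraction never truncates, as
    \<open>ge\<close> records.\<close>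
  define \<sigma> where "\<sigma> k = (if k < d then \<rho> k else k)" for k
  define \<tau> where "\<tau> k = \<rho> (k + d) - d" for k
  have ge: "d \<le> \<rho> (k + d)" for k
    using less[of "k + d"] by simp
  have "\<sigma> permutes {..<d}"
  proof (rule bij_imp_permutes)
    show "bij_betw \<sigma> {..<d} {..<d}"
      using \<rho> by (auto simp: bij_betw_def \<sigma>_def young_subgrp_def intro!: inj_onI dest: inj)
  qed (simp add: \<sigma>_def)
  moreover have "\<tau> permutes {..<e}"
  proof (rule bij_imp_permutes)
    have "inj_on \<tau> {..<e}"
    proof (rule inj_onI)
      fix k l assume "\<tau> k = \<tau> l"
      then have "\<rho> (k + d) = \<rho> (l + d)" using ge[of k] ge[of l] by (simp add: \<tau>_def)
      then show "k = l" using inj by fastforce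
    qed
    moreover have "\<tau> ` {..<e} \<subseteq> {..<e}"
    proof safe
      fix k assume "k < e"
      then have "\<rho> (k + d) < d + e" using permutes_in_image[OF perm, of "k + d"] by simp
      then show "\<tau> k < e" using ge[of k] by (simp add: \<tau>_def)
    qed
    ultimately show "bij_betw \<tau> {..<e} {..<e}"
      by (simp add: bij_betw_def endo_inj_surj)
    show "\<tau> k = k" if "k \<notin> {..<e}" for k
      using that permutes_not_in[OF perm, of "k + d"] by (simp add: \<tau>_def)
  qed
  moreover have "\<rho> = block_perm d \<sigma> \<tau>"
    using ge by (auto simp: fun_eq_iff block_perm_def \<sigma>_def \<tau>_def) (metis le_add_diff_inverse2 linorder_not_less)
  ultimately show "\<exists>x\<in>sym_grp d \<times> sym_grp e. \<rho> = (case x of (\<sigma>, \<tau>) \<Rightarrow> block_perm d \<sigma> \<tau>)"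
    by (auto simp: sym_grp_def)
qed

lemma permute_list_block_perm:
  assumes "\<sigma> \<in> sym_grp (length v)" "\<tau> \<in> sym_grp (length w)"
  shows "permute_list (block_perm (length v) \<sigma> \<tau>) (v @ w) = permute_list \<sigma> v @ permute_list \<tau> w"
proof -
  have p: "\<sigma> permutes {..<length v}" "\<tau> permutes {..<length w}"
    using assms by (auto simp: sym_grp_def)
  show ?thesis
    using permutes_in_image[OF p(1)] permutes_in_image[OF p(2)] block_perm_permutes[OF p]
    by (intro nth_equalityI)
      (auto simp: permute_list_nth nth_append block_perm_def p)
qed

text \<open>Positions in different blocks keep their order under the inverse, so every inversion
  lies within one block.\<close>

lemma odd_inversions_block_perm:
  assumes "\<sigma> \<in> sym_grp (length ps)" "\<tau> \<in> sym_grp (length qs)"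
  shows "odd_inversions (block_perm (length ps) \<sigma> \<tau>) (ps @ qs) = odd_inversions \<sigma> ps + odd_inversions \<tau> qs"
proof -
  let ?d = "length ps"
  have p: "\<sigma> permutes {..<length ps}" "\<tau> permutes {..<length qs}"
    using assms by (auto simp: sym_grp_def)
  have less: "inv \<sigma> k < ?d" if "k < ?d" for k
    using permutes_in_image[OF permutes_inv[OF p(1)], of k] that by simp
  let ?P = "{(k, l). k < l \<and> l < length ps \<and> inv \<sigma> k > inv \<sigma> l \<and> ps ! k = 1 \<and> ps ! l = 1}"
  let ?Q = "{(k, l). k < l \<and> l < length qs \<and> inv \<tau> k > inv \<tau> l \<and> qs ! k = 1 \<and> qs ! l = 1}"
  let ?s = "\<lambda>(k, l). (k + ?d, l + ?d)"
  have split: "{(k, l). k < l \<and> l < length (ps @ qs) \<and>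
        inv (block_perm ?d \<sigma> \<tau>) k > inv (block_perm ?d \<sigma> \<tau>) l \<and> (ps @ qs) ! k = 1 \<and> (ps @ qs) ! l = 1}
      = ?P \<union> ?s ` ?Q" (is "?R = _")
  proof (rule set_eqI, clarify)
    fix k l
    consider "k < ?d" "l < ?d" | "k < ?d" "?d \<le> l" | "?d \<le> k" "l < ?d" | "?d \<le> k" "?d \<le> l"
      by linarith
    then show "(k, l) \<in> ?R \<longleftrightarrow> (k, l) \<in> ?P \<union> ?s ` ?Q"
    proof cases
      case 2
      then show ?thesis using less[of k] by (auto simp: inv_block_perm[OF p] block_perm_def)
    next
      case 4
      then obtain k' l' where "k = k' + ?d" "l = l' + ?d"
        by (metis le_add_diff_inverse2)
      then show ?thesis by (auto simp: inv_block_perm[OF p] block_perm_def nth_append)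
    qed (auto simp: inv_block_perm[OF p] block_perm_def nth_append)
  qed
  have fin: "finite ?P" "finite ?Q"
    by (rule finite_subset[of _ "{..<length ps} \<times> {..<length ps}"]; auto)
      (rule finite_subset[of _ "{..<length qs} \<times> {..<length qs}"]; auto)
  have "card (?P \<union> ?s ` ?Q) = card ?P + card (?s ` ?Q)"
    by (rule card_Un_disjoint) (use fin in auto)
  also have "card (?s ` ?Q) = card ?Q"
    by (rule card_image) (auto intro: inj_onI)
  finally show ?thesis
    unfolding odd_inversions_def split .
qed

section \<open>Shortest coset representatives and stabilizers\<close>

text \<open>Monotonicity and surjectivity make the image of {..<k} the initial segment below
  \<open>\<tau> k\<close>; comparing cardinalities gives the claim.\<close>

lemma strict_mono_permutes_id:
  assumes perm: "\<tau> permutes {..<N :: nat}" and mono: "\<And>k l. k < l \<Longrightarrow> l < N \<Longrightarrow> \<tau> k < \<tau> l"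
  shows "\<tau> = id"
proof
  fix k show "\<tau> k = id k"
  proof (cases "k < N")
    case True
    have "\<tau> ` {..<k} = {..<\<tau> k}"
    proof
      show "\<tau> ` {..<k} \<subseteq> {..<\<tau> k}" using mono True by auto
      show "{..<\<tau> k} \<subseteq> \<tau> ` {..<k}"
      proof
        fix j assume "j \<in> {..<\<tau> k}"
        then have j: "j < \<tau> k" by simp
        have "\<tau> k < N" using permutes_in_image[OF perm, of k] True by simp
        define i where "i = inv \<tau> j"
        have i: "j = \<tau> i" "i < N"
          using less_trans[OF j \<open>\<tau> k < N\<close>] permutes_inverses(1)[OF perm, of j]
            permutes_in_image[OF perm, of i] by (auto simp: i_def)
        then have "i < k" using mono[of k i] j by (cases i k rule: linorder_cases) auto
        with i show "j \<in> \<tau> ` {..<k}" by auto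
      qed
    qed
    then have "card {..<\<tau> k} = card {..<k}"
      using card_image[of \<tau> "{..<k}"] permutes_inj_on[OF perm] by metis
    then show ?thesis by simp
  qed (simp add: permutes_not_in[OF perm])
qed

section \<open>Shortest representatives as inverse shuffles\<close>

text \<open>These are the inverses of the (d, e)-shuffles. In contrast to minimal length, the
  condition can be tested on pairs of positions.\<close>

definition unshuffles :: "nat \<Rightarrow> nat \<Rightarrow> (nat \<Rightarrow> nat) set" where
  "unshuffles d e = {\<sigma> \<in> sym_grp (d + e).
     \<forall>k l. k < l \<longrightarrow> l < d + e \<longrightarrow> (\<sigma> k < d \<longleftrightarrow> \<sigma> l < d) \<longrightarrow> \<sigma> k < \<sigma> l}"

lemma young_subgrp_sym_grp: "\<tau> \<in> young_subgrp d e \<Longrightarrow> \<tau> \<in> sym_grp (d + e)"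
  by (simp add: young_subgrp_def)

text \<open>The coset of a permutation modulo the Young subgroup is determined by which positions it
  sends below d. The special case of the identity shows closure under inverses.\<close>

lemma young_subgrp_comp_inv:
  assumes "\<sigma> \<in> sym_grp (d + e)" "\<rho> \<in> sym_grp (d + e)" "\<And>k. k < d + e \<Longrightarrow> \<rho> k < d \<longleftrightarrow> \<sigma> k < d"
  shows "\<rho> \<circ> inv \<sigma> \<in> young_subgrp d e"
proof -
  have mem: "\<rho> \<circ> inv \<sigma> \<in> sym_grp (d + e)"
    by (intro sym_grp_comp sym_grp_inv assms)
  have p: "\<sigma> permutes {..<d + e}" using assms by (simp add: sym_grp_def)
  have "(\<rho> \<circ> inv \<sigma>) k < d" if "k < d" for k
    using assms(3)[of "inv \<sigma> k"] permutes_in_image[OF permutes_inv[OF p], of k]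
      permutes_inverses[OF p] that by auto
  then have "(\<rho> \<circ> inv \<sigma>) ` {..<d} \<subseteq> {..<d}" by blast
  moreover have "inj_on (\<rho> \<circ> inv \<sigma>) {..<d}"
    using mem permutes_inj_on by (auto simp: sym_grp_def)
  ultimately have "(\<rho> \<circ> inv \<sigma>) ` {..<d} = {..<d}"
    by (intro endo_inj_surj) auto
  then show ?thesis
    using mem by (simp add: young_subgrp_def)
qed

text \<open>Standardization: sorting the values within each block, without changing which positions
  are sent to it, stays in the coset and removes all inversions inside the blocks.\<close>

lemma exists_unshuffle:
  assumes \<sigma>: "\<sigma> \<in> sym_grp (d + e)"
  shows "\<exists>\<tau>\<in>young_subgrp d e. \<tau> \<circ> \<sigma> \<in> unshuffles d e"
proof -
  let ?N = "d + e"
  have p: "\<sigma> permutes {..<?N}" using \<sigma> by (simp add: sym_grp_def)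
  define P where "P k = {j. j < k \<and> \<sigma> j < d}" for k
  define Q where "Q k = {j. j < k \<and> d \<le> \<sigma> j}" for k
  \<comment> \<open>A position is sent to the number of earlier positions of its own kind, counted
    from 0 or from d.\<close>
  define \<rho> where "\<rho> k = (if k < ?N then if \<sigma> k < d then card (P k) else d + card (Q k) else k)" for k
  have fin: "finite (P k)" "finite (Q k)" for k
    by (auto simp: P_def Q_def)
  have less_P: "card (P k) < card (P l)" if "k < l" "\<sigma> k < d" for k l
  proof (rule psubset_card_mono)
    have "k \<in> P l - P k" "P k \<subseteq> P l" using that by (auto simp: P_def)
    then show "P k \<subset> P l" by blast
  qed (rule fin)
  have less_Q: "card (Q k) < card (Q l)" if "k < l" "\<not> \<sigma> k < d" for k l
  proof (rule psubset_card_mono)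
    have "k \<in> Q l - Q k" "Q k \<subseteq> Q l" using that by (auto simp: Q_def)
    then show "Q k \<subset> Q l" by blast
  qed (rule fin)
  have lt: "\<sigma> k < ?N \<longleftrightarrow> k < ?N" for k
    using permutes_in_image[OF p, of k] by simp
  \<comment> \<open>There are exactly d positions of the first kind, as \<open>\<sigma>\<close> hits
    each value once. This keeps the two ranges of \<open>\<rho>\<close> apart and below d +
    e.\<close>
  have "card (P ?N) = card (\<sigma> ` P ?N)"
    by (rule card_image[symmetric]) (rule permutes_inj_on[OF p])
  also have "\<sigma> ` P ?N = {..<d}"
  proof -
    have "j \<in> \<sigma> ` P ?N" if "j < d" for j
      using lt[of "inv \<sigma> j"] permutes_inverses[OF p] that by (intro image_eqI[of _ _ "inv \<sigma> j"]) (auto simp: P_def)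
    then show ?thesis by (auto simp: P_def)
  qed
  finally have card_P: "card (P ?N) = d" by simp
  have "P ?N \<union> Q ?N = {..<?N}" "P ?N \<inter> Q ?N = {}"
    by (auto simp: P_def Q_def)
  then have "card (P ?N) + card (Q ?N) = ?N"
    using card_Un_disjoint[OF fin, of ?N ?N] by simp
  with card_P have card_Q: "card (Q ?N) = e" by simp
  have \<rho>_less: "\<rho> k < d \<longleftrightarrow> \<sigma> k < d" if "k < ?N" for k
    using less_P[OF that] card_P that by (auto simp: \<rho>_def)
  have \<rho>_N: "\<rho> k < ?N" if "k < ?N" for k
    using less_P[OF that] less_Q[OF that] card_P card_Q that by (cases "\<sigma> k < d") (auto simp: \<rho>_def)
  have \<rho>_mono: "\<rho> k < \<rho> l" if "k < l" "l < ?N" "\<sigma> k < d \<longleftrightarrow> \<sigma> l < d" for k l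
    using that less_P less_Q by (auto simp: \<rho>_def)
  have "\<rho> permutes {..<?N}"
  proof (rule bij_imp_permutes)
    have "inj_on \<rho> {..<?N}"
    proof (rule linorder_inj_onI)
      fix k l assume "k < l" "k \<in> {..<?N}" "l \<in> {..<?N}"
      then show "\<rho> k \<noteq> \<rho> l"
        using \<rho>_mono[of k l] \<rho>_less[of k] \<rho>_less[of l] by auto
    qed auto
    then show "bij_betw \<rho> {..<?N} {..<?N}"
      using \<rho>_N by (simp add: bij_betw_def) (intro endo_inj_surj, auto)
  qed (simp add: \<rho>_def)
  then have \<rho>: "\<rho> \<in> sym_grp ?N" by (simp add: sym_grp_def)
  then have "\<rho> \<in> unshuffles d e"
    using \<rho>_mono \<rho>_less by (auto simp: unshuffles_def)
  moreover have "(\<rho> \<circ> inv \<sigma>) \<circ> \<sigma> = \<rho>"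
    by (simp add: comp_assoc sym_grp_inv_o[OF \<sigma>])
  ultimately show ?thesis
    using young_subgrp_comp_inv[OF \<sigma> \<rho> \<rho>_less] by metis
qed

text \<open>Two unshuffles in one coset are increasing on the same two sets of positions, so
  \<open>\<tau>\<close> is increasing on each block. As it also preserves the blocks, it is
  increasing altogether.\<close>

lemma young_subgrp_unshuffles_eq_id:
  assumes \<rho>: "\<rho> \<in> unshuffles d e" and \<tau>: "\<tau> \<in> young_subgrp d e" and \<tau>\<rho>: "\<tau> \<circ> \<rho> \<in> unshuffles d e"
  shows "\<tau> = id"
proof (rule strict_mono_permutes_id)
  show "\<tau> permutes {..<d + e}"
    using \<tau> by (simp add: young_subgrp_def sym_grp_def)
  fix a b assume ab: "a < b" "b < d + e"
  have p: "\<rho> permutes {..<d + e}" using \<rho> by (simp add: unshuffles_def sym_grp_def)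
  have \<rho>_mono: "\<rho> k < \<rho> l" if "k < l" "l < d + e" "\<rho> k < d \<longleftrightarrow> \<rho> l < d" for k l
    using \<rho> that by (simp add: unshuffles_def)
  show "\<tau> a < \<tau> b"
  proof (cases "a < d \<longleftrightarrow> b < d")
    case True
    define k l where "k = inv \<rho> a" and "l = inv \<rho> b"
    then have kl: "a = \<rho> k" "b = \<rho> l" "k < d + e" "l < d + e"
      using permutes_in_image[OF p, of "inv \<rho> a"] permutes_in_image[OF p, of "inv \<rho> b"]
        permutes_inverses[OF p] ab by auto
    have "k < l"
      using \<rho>_mono[of l k] kl ab True by (cases k l rule: linorder_cases) auto
    then have "(\<tau> \<circ> \<rho>) k < (\<tau> \<circ> \<rho>) l"
      using \<tau>\<rho> kl True young_subgrp_less_iff[OF \<tau>] by (auto simp: unshuffles_def)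
    then show ?thesis using kl by simp
  next
    case False
    then show ?thesis using ab young_subgrp_less_iff[OF \<tau>, of a] young_subgrp_less_iff[OF \<tau>, of b] by auto
  qed
qed

text \<open>Left multiplication by the Young subgroup does not affect the inversions between a position
  mapped below \<open>d\<close> and one that is not, and the unshuffles are the permutations that have no others.\<close>

lemma shortest_reps_eq_unshuffles: "shortest_reps d e = unshuffles d e"
proof -
  let ?N = "d + e"
  define I where "I \<sigma> = {(k, l). k < l \<and> l < ?N \<and> \<sigma> k > \<sigma> l}" for \<sigma> :: "nat \<Rightarrow> nat"
  define C where "C \<sigma> = {(k, l). k < l \<and> l < ?N \<and> \<sigma> l < d \<and> \<not> \<sigma> k < d}" for \<sigma> :: "nat \<Rightarrow> nat"
  have fin: "finite (I \<sigma>)" for \<sigma>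
    by (rule finite_subset[of _ "{..<?N} \<times> {..<?N}"]) (auto simp: I_def)
  have sub: "C \<sigma> \<subseteq> I \<sigma>" for \<sigma>
    by (auto simp: C_def I_def)
  have len: "perm_length ?N \<sigma> = card (I \<sigma>)" for \<sigma>
    by (simp add: perm_length_def I_def)
  have eq_iff: "C \<sigma> = I \<sigma> \<longleftrightarrow> \<sigma> \<in> unshuffles d e" if "\<sigma> \<in> sym_grp ?N" for \<sigma>
  proof -
    have ne: "\<sigma> k \<noteq> \<sigma> l" if "k < l" for k l
      using that \<open>\<sigma> \<in> sym_grp ?N\<close> permutes_inj by (fastforce simp: sym_grp_def dest: injD)
    show ?thesis
    proof
      assume eq: "C \<sigma> = I \<sigma>"
      have "\<sigma> k < \<sigma> l" if "k < l" "l < ?N" "\<sigma> k < d \<longleftrightarrow> \<sigma> l < d" for k l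
      proof (rule ccontr)
        assume "\<not> \<sigma> k < \<sigma> l"
        then have "(k, l) \<in> I \<sigma>" using ne[of k l] that by (auto simp: I_def)
        then show False using that eq by (auto simp: C_def)
      qed
      then show "\<sigma> \<in> unshuffles d e" using \<open>\<sigma> \<in> sym_grp ?N\<close> by (auto simp: unshuffles_def)
    next
      assume "\<sigma> \<in> unshuffles d e"
      then have "I \<sigma> \<subseteq> C \<sigma>" by (fastforce simp: unshuffles_def C_def I_def)
      with sub show "C \<sigma> = I \<sigma>" by blast
    qed
  qed
  have C_eq: "C (\<tau> \<circ> \<sigma>) = C \<sigma>" if "\<tau> \<in> young_subgrp d e" for \<tau> \<sigma>
    by (simp add: C_def young_subgrp_less_iff[OF that])
  show ?thesis
  proof (intro equalityI subsetI)
    fix \<sigma> assume "\<sigma> \<in> shortest_reps d e"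
    then have \<sigma>: "\<sigma> \<in> sym_grp ?N" and short: "\<And>\<tau>. \<tau> \<in> young_subgrp d e \<Longrightarrow> card (I \<sigma>) \<le> card (I (\<tau> \<circ> \<sigma>))"
      by (auto simp: shortest_reps_def len)
    obtain \<tau> where \<tau>: "\<tau> \<in> young_subgrp d e" "\<tau> \<circ> \<sigma> \<in> unshuffles d e"
      using exists_unshuffle[OF \<sigma>] by blast
    then have "I (\<tau> \<circ> \<sigma>) = C \<sigma>"
      using eq_iff[of "\<tau> \<circ> \<sigma>"] C_eq[of \<tau> \<sigma>] by (auto simp: unshuffles_def)
    \<comment> \<open>Minimality is tested against the unshuffle in the same coset, whose length is
      the lower bound \<open>card (C \<sigma>)\<close> common to the whole coset.\<close>
    then have "card (I \<sigma>) \<le> card (C \<sigma>)"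
      using short[OF \<tau>(1)] by simp
    then have "C \<sigma> = I \<sigma>"
      using sub fin by (intro card_seteq)
    then show "\<sigma> \<in> unshuffles d e" using eq_iff[OF \<sigma>] by simp
  next
    fix \<sigma> assume un: "\<sigma> \<in> unshuffles d e"
    then have \<sigma>: "\<sigma> \<in> sym_grp ?N" by (simp add: unshuffles_def)
    have "card (I \<sigma>) \<le> card (I (\<tau> \<circ> \<sigma>))" if "\<tau> \<in> young_subgrp d e" for \<tau>
      using eq_iff[OF \<sigma>] un C_eq[OF that, of \<sigma>] sub[of "\<tau> \<circ> \<sigma>"] fin card_mono by metis
    then show "\<sigma> \<in> shortest_reps d e"
      using \<sigma> by (simp add: shortest_reps_def len)
  qed
qed

lemma bij_betw_young_subgrp_shortest_reps:
  "bij_betw (\<lambda>(\<rho>, \<tau>). \<tau> \<circ> \<rho>) (shortest_reps d e \<times> young_subgrp d e) (sym_grp (d + e))"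
proof -
  note comp_young = young_subgrp_comp_inv
  have inv_young: "inv \<tau> \<in> young_subgrp d e" if "\<tau> \<in> young_subgrp d e" for \<tau>
    using young_subgrp_comp_inv[OF young_subgrp_sym_grp[OF that] sym_grp_id] young_subgrp_less_iff[OF that]
    by simp
  show ?thesis
  proof (rule bij_betwI')
    fix x y assume "x \<in> shortest_reps d e \<times> young_subgrp d e" "y \<in> shortest_reps d e \<times> young_subgrp d e"
    then obtain \<rho> \<tau> \<rho>' \<tau>' where xy: "x = (\<rho>, \<tau>)" "y = (\<rho>', \<tau>')"
      and \<rho>: "\<rho> \<in> unshuffles d e" "\<rho>' \<in> unshuffles d e"
      and \<tau>: "\<tau> \<in> young_subgrp d e" "\<tau>' \<in> young_subgrp d e"
      by (auto simp: shortest_reps_eq_unshuffles)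
    note sg = \<tau>[THEN young_subgrp_sym_grp]
    have "\<rho> = \<rho>' \<and> \<tau> = \<tau>'" if eq: "\<tau> \<circ> \<rho> = \<tau>' \<circ> \<rho>'"
    proof -
      have "inv \<tau>' \<circ> \<tau> \<circ> \<rho> = inv \<tau>' \<circ> (\<tau>' \<circ> \<rho>')" by (simp add: eq comp_assoc)
      also have "\<dots> = \<rho>'" by (simp add: sym_grp_inv_o[OF sg(2)] flip: comp_assoc)
      finally have 1: "inv \<tau>' \<circ> \<tau> \<circ> \<rho> = \<rho>'" .
      \<comment> \<open>The double inverse gives the product the shape
        \<open>\<rho> \<circ> inv \<sigma>\<close> to which the coset criterion applies.\<close>
      have "inv \<tau>' \<circ> \<tau> = inv \<tau>' \<circ> inv (inv \<tau>)"
        using sg by (simp add: sym_grp_def permutes_bij inv_inv_eq)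
      also have "\<dots> \<in> young_subgrp d e"
        using inv_young[OF \<tau>(1)] inv_young[OF \<tau>(2)]
        by (intro comp_young) (auto simp: young_subgrp_sym_grp young_subgrp_less_iff)
      finally have id: "inv \<tau>' \<circ> \<tau> = id"
        by (rule young_subgrp_unshuffles_eq_id[OF \<rho>(1)]) (simp add: 1 \<rho>)
      then have "\<tau>' \<circ> (inv \<tau>' \<circ> \<tau>) = \<tau>'" by simp
      then have "\<tau> = \<tau>'" by (simp add: sym_grp_inv_o[OF sg(2)] flip: comp_assoc)
      with 1 id show ?thesis by simp
    qed
    then show "(case x of (\<rho>, \<tau>) \<Rightarrow> \<tau> \<circ> \<rho>) = (case y of (\<rho>, \<tau>) \<Rightarrow> \<tau> \<circ> \<rho>) \<longleftrightarrow> x = y"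
      by (auto simp: xy)
  next
    fix x assume "x \<in> shortest_reps d e \<times> young_subgrp d e"
    then show "(case x of (\<rho>, \<tau>) \<Rightarrow> \<tau> \<circ> \<rho>) \<in> sym_grp (d + e)"
      by (auto simp: shortest_reps_def young_subgrp_def intro: sym_grp_comp)
  next
    fix \<sigma> assume \<sigma>: "\<sigma> \<in> sym_grp (d + e)"
    then obtain \<tau> where \<tau>: "\<tau> \<in> young_subgrp d e" "\<tau> \<circ> \<sigma> \<in> unshuffles d e"
      using exists_unshuffle by blast
    have "\<sigma> = inv \<tau> \<circ> (\<tau> \<circ> \<sigma>)"
      by (simp add: sym_grp_inv_o[OF young_subgrp_sym_grp[OF \<tau>(1)]] flip: comp_assoc)
    with \<tau> inv_young[OF \<tau>(1)]
    show "\<exists>x\<in>shortest_reps d e \<times> young_subgrp d e. \<sigma> = (case x of (\<rho>, \<tau>) \<Rightarrow> \<tau> \<circ> \<rho>)"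
      by (intro bexI[of _ "(\<tau> \<circ> \<sigma>, inv \<tau>)"]) (auto simp: shortest_reps_eq_unshuffles)
  qed
qed

text \<open>The form in which unique factorization is used: the symmetrizer of d + e letters
  consists of the symmetrizers of the two blocks followed by the representatives.\<close>

lemma sum_sym_grp_shortest_reps:
  "(\<Sum>\<sigma>\<in>sym_grp (d + e). g \<sigma>) =
     (\<Sum>\<rho>\<in>shortest_reps d e. \<Sum>\<sigma>\<in>sym_grp d. \<Sum>\<tau>\<in>sym_grp e. g (block_perm d \<sigma> \<tau> \<circ> \<rho>))"
proof -
  have "(\<Sum>\<sigma>\<in>sym_grp (d + e). g \<sigma>) = (\<Sum>(\<rho>, \<tau>)\<in>shortest_reps d e \<times> young_subgrp d e. g (\<tau> \<circ> \<rho>))"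
    using sum.reindex_bij_betw[OF bij_betw_young_subgrp_shortest_reps, of g d e]
    by (simp add: case_prod_beta)
  also have "\<dots> = (\<Sum>\<rho>\<in>shortest_reps d e. \<Sum>\<tau>\<in>young_subgrp d e. g (\<tau> \<circ> \<rho>))"
    by (simp add: sum.cartesian_product)
  also have "\<dots> = (\<Sum>\<rho>\<in>shortest_reps d e.
      \<Sum>\<sigma>\<in>sym_grp d. \<Sum>\<tau>\<in>sym_grp e. g (block_perm d \<sigma> \<tau> \<circ> \<rho>))"
  proof (rule sum.cong[OF refl])
    fix \<rho> show "(\<Sum>\<tau>\<in>young_subgrp d e. g (\<tau> \<circ> \<rho>)) =
        (\<Sum>\<sigma>\<in>sym_grp d. \<Sum>\<tau>\<in>sym_grp e. g (block_perm d \<sigma> \<tau> \<circ> \<rho>))"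
      using sum.reindex_bij_betw[OF bij_betw_block_perm, of "\<lambda>\<tau>. g (\<tau> \<circ> \<rho>)" d e]
      by (simp add: case_prod_beta sum.cartesian_product)
  qed
  finally show ?thesis .
qed

section \<open>Cosets of the stabilizer of a word\<close>

definition stabilizer_coset :: "'x list \<Rightarrow> (nat \<Rightarrow> nat) \<Rightarrow> (nat \<Rightarrow> nat) set" where
  "stabilizer_coset w \<sigma> = (\<lambda>\<tau>. \<tau> \<circ> \<sigma>) ` stabilizer w"

text \<open>If two permutations produce the same word, then one times the inverse of the other fixes
  w. The cosets are thus the fibres of
  \<open>\<lambda>\<sigma>. permute_list \<sigma> w\<close>.\<close>

lemma stabilizer_coset_eq:
  assumes \<sigma>: "\<sigma> \<in> sym_grp (length w)"
  shows "stabilizer_coset w \<sigma> = {\<rho> \<in> sym_grp (length w). permute_list \<rho> w = permute_list \<sigma> w}"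
proof (intro equalityI subsetI)
  fix \<rho> assume "\<rho> \<in> stabilizer_coset w \<sigma>"
  then show "\<rho> \<in> {\<rho> \<in> sym_grp (length w). permute_list \<rho> w = permute_list \<sigma> w}"
    using \<sigma> by (auto simp: stabilizer_coset_def stabilizer_def sym_grp_comp permute_list_comp)
next
  fix \<rho> assume "\<rho> \<in> {\<rho> \<in> sym_grp (length w). permute_list \<rho> w = permute_list \<sigma> w}"
  then have \<rho>: "\<rho> \<in> sym_grp (length w)" "permute_list \<rho> w = permute_list \<sigma> w" by auto
  have "permute_list (\<rho> \<circ> inv \<sigma>) w = permute_list (inv \<sigma>) (permute_list \<sigma> w)"
    using \<rho> \<sigma> by (simp add: permute_list_comp sym_grp_inv)
  also have "\<dots> = w"
    using \<sigma> by (simp add: sym_grp_inv sym_grp_inv_o[OF \<sigma>] flip: permute_list_comp)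
  finally have "\<rho> \<circ> inv \<sigma> \<in> stabilizer w"
    using \<rho> \<sigma> by (simp add: stabilizer_def sym_grp_comp sym_grp_inv)
  moreover have "\<rho> = \<rho> \<circ> inv \<sigma> \<circ> \<sigma>"
    by (simp add: comp_assoc sym_grp_inv_o[OF \<sigma>])
  ultimately show "\<rho> \<in> stabilizer_coset w \<sigma>"
    unfolding stabilizer_coset_def by blast
qed

lemma card_stabilizer_coset:
  assumes "\<sigma> \<in> sym_grp (length w)"
  shows "card (stabilizer_coset w \<sigma>) = card (stabilizer w)"
  unfolding stabilizer_coset_def
proof (rule card_image, rule inj_onI)
  fix \<tau> \<tau>' assume "\<tau> \<circ> \<sigma> = \<tau>' \<circ> \<sigma>"
  then have "\<tau> \<circ> \<sigma> \<circ> inv \<sigma> = \<tau>' \<circ> \<sigma> \<circ> inv \<sigma>" by simp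
  then show "\<tau> = \<tau>'" by (simp add: comp_assoc sym_grp_inv_o[OF assms])
qed

lemma stabilizer_cosets_eq: "stabilizer_cosets w = stabilizer_coset w ` sym_grp (length w)"
  by (simp add: stabilizer_cosets_def stabilizer_coset_def)

text \<open>The arbitrary representatives chosen in \<open>xi_elt\<close> are controlled through the
  word that they produce.\<close>

lemma some_mem_stabilizer_coset:
  assumes "\<sigma> \<in> sym_grp (length w)" "C = stabilizer_coset w \<sigma>"
  shows "(SOME \<sigma>. \<sigma> \<in> C) \<in> sym_grp (length w)" "permute_list (SOME \<sigma>. \<sigma> \<in> C) w = permute_list \<sigma> w"
proof -
  have "\<sigma> \<in> C" using assms by (simp add: stabilizer_coset_eq)
  then have "(SOME \<sigma>. \<sigma> \<in> C) \<in> C" by (rule someI[of "\<lambda>\<sigma>. \<sigma> \<in> C"])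
  then show "(SOME \<sigma>. \<sigma> \<in> C) \<in> sym_grp (length w)" "permute_list (SOME \<sigma>. \<sigma> \<in> C) w = permute_list \<sigma> w"
    using assms by (auto simp: stabilizer_coset_eq)
qed

lemma bij_betw_stabilizer_cosets:
  "bij_betw (\<lambda>C. permute_list (SOME \<sigma>. \<sigma> \<in> C) w) (stabilizer_cosets w) (permutations_of_multiset (mset w))"
proof (rule bij_betwI')
  fix C D assume "C \<in> stabilizer_cosets w" "D \<in> stabilizer_cosets w"
  then show "permute_list (SOME \<sigma>. \<sigma> \<in> C) w = permute_list (SOME \<sigma>. \<sigma> \<in> D) w \<longleftrightarrow> C = D"
    by (auto simp: stabilizer_cosets_eq some_mem_stabilizer_coset(2)[OF _ refl])
      (auto simp: stabilizer_coset_eq)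
next
  fix C assume "C \<in> stabilizer_cosets w"
  then show "permute_list (SOME \<sigma>. \<sigma> \<in> C) w \<in> permutations_of_multiset (mset w)"
    by (auto simp: stabilizer_cosets_eq some_mem_stabilizer_coset(2)[OF _ refl]
        permutations_of_multiset_def sym_grp_def)
next
  fix u assume "u \<in> permutations_of_multiset (mset w)"
  then have "mset u = mset w" by (simp add: permutations_of_multiset_def)
  then obtain \<sigma> where "\<sigma> permutes {..<length w}" "permute_list \<sigma> w = u"
    by (rule mset_eq_permutation)
  then show "\<exists>C\<in>stabilizer_cosets w. u = permute_list (SOME \<sigma>. \<sigma> \<in> C) w"
    by (intro bexI[of _ "stabilizer_coset w \<sigma>"])
      (auto simp: stabilizer_cosets_eq some_mem_stabilizer_coset(2)[OF _ refl] sym_grp_def)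
qed

lemma sum_sym_grp_stabilizer_cosets:
  "(\<Sum>\<sigma>\<in>sym_grp (length w). g \<sigma>) = (\<Sum>C\<in>stabilizer_cosets w. \<Sum>\<sigma>\<in>C. g \<sigma>)"
proof -
  have "\<Union>(stabilizer_cosets w) = sym_grp (length w)"
    by (auto simp: stabilizer_cosets_eq stabilizer_coset_eq)
  moreover have "\<forall>C\<in>stabilizer_cosets w. finite C"
    by (auto simp: stabilizer_cosets_eq stabilizer_coset_eq finite_sym_grp)
  moreover have "\<forall>C\<in>stabilizer_cosets w. \<forall>D\<in>stabilizer_cosets w. C \<noteq> D \<longrightarrow> C \<inter> D = {}"
    by (auto simp: stabilizer_cosets_eq stabilizer_coset_eq)
  ultimately show ?thesis
    using sum.Union_disjoint[of "stabilizer_cosets w" g] by simp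
qed

text \<open>Proved by counting, without exhibiting the stabilizer as a product of symmetric groups:
  its order times the number of cosets is d!, and the number of cosets is the multinomial
  coefficient that counts rearrangements.\<close>

lemma card_stabilizer: "card (stabilizer w) = (\<Prod>x\<in>set w. fact (count_list w x))"
proof -
  have "fact (length w) = (\<Sum>\<sigma>\<in>sym_grp (length w). 1 :: nat)"
    by (simp add: card_sym_grp)
  also have "\<dots> = (\<Sum>C\<in>stabilizer_cosets w. card C)"
    unfolding sum_sym_grp_stabilizer_cosets by simp
  also have "\<dots> = (\<Sum>C\<in>stabilizer_cosets w. card (stabilizer w))"
    by (rule sum.cong) (auto simp: stabilizer_cosets_eq card_stabilizer_coset)
  also have "\<dots> = card (permutations_of_multiset (mset w)) * card (stabilizer w)"
    by (simp add: bij_betw_same_card[OF bij_betw_stabilizer_cosets])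
  finally have "card (permutations_of_multiset (mset w)) * card (stabilizer w) =
      card (permutations_of_multiset (mset w)) * (\<Prod>x\<in>set w. fact (count_list w x))"
    using card_permutations_of_multiset_aux[of "mset w"] by (simp add: count_mset)
  moreover have "card (permutations_of_multiset (mset w)) \<noteq> 0"
    using card_permutations_of_multiset_aux[of "mset w"] fact_nonzero[of "length w", where 'a = nat] by (metis mult_0 size_mset)
  ultimately show ?thesis by simp
qed

lemma card_stabilizer_pos: "0 < card (stabilizer w)"
  by (auto simp: card_stabilizer intro: prod_pos)

lemma card_stabilizer_mset_cong: "mset v = mset w \<Longrightarrow> card (stabilizer v) = card (stabilizer w)"
  by (simp add: card_stabilizer flip: set_mset_mset count_mset)

lemma card_stabilizer_append:
  assumes "set v \<inter> set w = {}"
  shows "card (stabilizer (v @ w)) = card (stabilizer v) * card (stabilizer w)"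
proof -
  have "(\<Prod>x\<in>set v. fact (count_list v x + count_list w x)) = (\<Prod>x\<in>set v. fact (count_list v x) :: nat)"
    by (rule prod.cong) (use assms in \<open>auto simp: disjoint_iff\<close>)
  moreover have "(\<Prod>x\<in>set w. fact (count_list v x + count_list w x)) = (\<Prod>x\<in>set w. fact (count_list w x) :: nat)"
  proof (rule prod.cong)
    fix x assume "x \<in> set w"
    then have "x \<notin> set v" using assms by auto
    then show "fact (count_list v x + count_list w x) = (fact (count_list w x) :: nat)" by simp
  qed simp
  ultimately show ?thesis
    using assms by (simp add: card_stabilizer prod.union_disjoint)
qed

section \<open>The universal property of the tensor algebra\<close>

lemma lookup_map_times: "Poly_Mapping.lookup (Poly_Mapping.map ((*) (c :: 'k::comm_ring_1)) p) x = c * Poly_Mapping.lookup p x"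
  by (simp add: Poly_Mapping.map.rep_eq when_def)

lemma module_poly_mapping: "module (\<lambda>c :: 'k::comm_ring_1. Poly_Mapping.map ((*) c) :: ('x \<Rightarrow>\<^sub>0 'k) \<Rightarrow> _)"
  by standard (simp_all add: poly_mapping_eq_iff fun_eq_iff lookup_map_times lookup_add algebra_simps)

text \<open>Linear extension of \<open>F\<close> to formal combinations of words. For
  \<open>pure_tensor \<iota>\<close> it is the sum in the assumption
  \<open>presented\<close>.\<close>

definition lincomb :: "('k::comm_ring_1 \<Rightarrow> 'b::ab_group_add \<Rightarrow> 'b) \<Rightarrow> ('x \<Rightarrow> 'b) \<Rightarrow> ('x \<Rightarrow>\<^sub>0 'k) \<Rightarrow> 'b" where
  "lincomb s F p = (\<Sum>w\<in>Poly_Mapping.keys p. s (Poly_Mapping.lookup p w) (F w))"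

context module
begin

lemma lincomb_add: "lincomb scale F (p + q) = lincomb scale F p + lincomb scale F q"
  unfolding lincomb_def
  by (rule setsum_keys_plus_distrib[where f = "\<lambda>w c. scale c (F w)"]) (simp_all add: scale_left_distrib)

lemma lincomb_single: "lincomb scale F (Poly_Mapping.single w c) = scale c (F w)"
  by (simp add: lincomb_def)

lemma lincomb_scale: "lincomb scale F (Poly_Mapping.map ((*) (c :: 'a)) p) = scale c (lincomb scale F p)"
proof -
  have "lincomb scale F (Poly_Mapping.map ((*) c) p) =
      (\<Sum>w\<in>Poly_Mapping.keys p. scale (Poly_Mapping.lookup (Poly_Mapping.map ((*) c) p) w) (F w))"
    unfolding lincomb_def
    by (rule sum.mono_neutral_left) (auto simp: in_keys_iff lookup_map_times)
  then show ?thesis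
    by (simp add: lookup_map_times lincomb_def scale_sum_right)
qed

lemma lincomb_diff: "lincomb scale F (p - q) = lincomb scale F p - lincomb scale F q"
  using lincomb_add[of F "p - q" q] by simp

lemma module_hom_lincomb: "module_hom (\<lambda>c. Poly_Mapping.map ((*) c)) scale (lincomb scale F)"
  by (intro module_hom.intro module_hom_axioms.intro module_poly_mapping module_axioms
      lincomb_add lincomb_scale)

end

section \<open>Linear maps from multilinear functions on words\<close>

text \<open>Multilinearity in all arities at once, for a single function on words of every length.
  The two conditions say that the linear extension of \<open>F\<close> kills
  \<open>multilinear_relators\<close>.\<close>

definition word_multilinear ::
    "('k::comm_ring_1 \<Rightarrow> 'm::ab_group_add \<Rightarrow> 'm) \<Rightarrow> ('k \<Rightarrow> 'b::ab_group_add \<Rightarrow> 'b) \<Rightarrow> ('m list \<Rightarrow> 'b) \<Rightarrow> bool" where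
  "word_multilinear s\<^sub>1 s\<^sub>2 F \<longleftrightarrow>
     (\<forall>v w x y. F (v @ (x + y) # w) = F (v @ x # w) + F (v @ y # w)) \<and>
     (\<forall>v w c x. F (v @ s\<^sub>1 c x # w) = s\<^sub>2 c (F (v @ x # w)))"

context tensor_algebra
begin

lemma pure_tensor_Cons: "pure_tensor \<iota> (x # w) = \<iota> x * pure_tensor \<iota> w"
  by (simp add: pure_tensor_def)

lemma pure_tensor_append: "pure_tensor \<iota> (v @ w) = pure_tensor \<iota> v * pure_tensor \<iota> w"
  by (simp add: pure_tensor_def)

lemma pure_tensor_zero: "0 \<in> set w \<Longrightarrow> pure_tensor \<iota> w = 0"
  by (induction w) (auto simp: pure_tensor_Cons zero)

text \<open>By \<open>presented\<close>, every formal combination that evaluates to 0 in the tensor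
  algebra is spanned by relators, which the linear extension of \<open>F\<close> kills; by
  \<open>generated\<close>, evaluation is surjective. Hence the extension factors through
  evaluation.\<close>

lemma universal_property:
  assumes "module s" and F: "word_multilinear mscale s F"
  shows "\<exists>f. module_hom tscale s f \<and> (\<forall>w. f (pure_tensor \<iota> w) = F w)"
proof -
  interpret N: module s by fact
  interpret P: module "\<lambda>c :: 'k. Poly_Mapping.map ((*) c) :: ('m list \<Rightarrow>\<^sub>0 'k) \<Rightarrow> _"
    by (rule module_poly_mapping)
  interpret ev: module_hom "\<lambda>c. Poly_Mapping.map ((*) c)" tscale "lincomb tscale (pure_tensor \<iota>)"
    by (rule m2.module_hom_lincomb)
  interpret evF: module_hom "\<lambda>c. Poly_Mapping.map ((*) c)" s "lincomb s F"
    by (rule N.module_hom_lincomb)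
  let ?ev = "lincomb tscale (pure_tensor \<iota>)" and ?evF = "lincomb s F"
  have ker: "?evF p = 0" if "?ev p = 0" for p
  proof -
    have "p \<in> P.span (multilinear_relators mscale)"
      using that by (intro presented) (simp add: lincomb_def)
    then show ?thesis
    proof (induction rule: P.span_induct)
      case base
      show ?case by (auto simp: P.subspace_def evF.add evF.zero evF.scale)
    next
      case (step p)
      then show ?case
        using F by (auto simp: multilinear_relators_def word_multilinear_def N.lincomb_diff N.lincomb_single)
    qed
  qed
  have eq: "?evF p = ?evF q" if "?ev p = ?ev q" for p q
    using ker[of "p - q"] that by (simp add: m2.lincomb_diff N.lincomb_diff)
  have surj: "\<exists>p. ?ev p = t" for t
  proof -
    have "t \<in> m2.span (range (pure_tensor \<iota>))" using generated by simp
    then show ?thesis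
    proof (induction rule: m2.span_induct_alt)
      case base
      show ?case by (intro exI[of _ 0]) (rule ev.zero)
    next
      case (step c x y)
      then obtain w p where "x = pure_tensor \<iota> w" "?ev p = y" by auto
      then show ?case
        by (intro exI[of _ "Poly_Mapping.single w c + p"]) (simp add: ev.add m2.lincomb_single)
    qed
  qed
  \<comment> \<open>Any preimage under evaluation may be chosen, as \<open>eq\<close> shows that the
    value does not depend on it.\<close>
  define f where "f t = ?evF (SOME p. ?ev p = t)" for t
  have f: "f (?ev p) = ?evF p" for p
    unfolding f_def by (rule eq) (rule someI_ex[of "\<lambda>q. ?ev q = ?ev p"], blast)
  have "module_hom tscale s f"
  proof (intro module_hom.intro module_hom_axioms.intro m2.module_axioms N.module_axioms)
    fix x y c
    obtain p q where "?ev p = x" "?ev q = y" using surj by metis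
    then show "f (x + y) = f x + f y" "f (tscale c x) = s c (f x)"
      using f[of p] f[of q] f[of "p + q"] f[of "Poly_Mapping.map ((*) c) p"]
      by (auto simp: ev.add evF.add ev.scale evF.scale)
  qed
  moreover have "f (pure_tensor \<iota> w) = F w" for w
    using f[of "Poly_Mapping.single w 1"] by (simp add: m2.lincomb_single N.lincomb_single)
  ultimately show ?thesis by blast
qed

lemma mult_mem_span:
  assumes "x \<in> m2.span S" "y \<in> m2.span T" "\<And>a b. a \<in> S \<Longrightarrow> b \<in> T \<Longrightarrow> a * b \<in> m2.span U"
  shows "x * y \<in> m2.span U"
proof -
  have "a * y \<in> m2.span U" if "a \<in> S" for a
    using assms(2)
  proof (induction rule: m2.span_induct_alt)
    case (step c b z)
    then show ?case
      using assms(3)[OF that] by (simp add: distrib_left m2.span_add m2.span_scale flip: tscale_mult_right)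
  qed (simp add: m2.span_zero)
  note left = this
  from assms(1) show ?thesis
    by (induction x rule: m2.span_induct_alt)
      (auto simp: left distrib_right m2.span_zero m2.span_add m2.span_scale simp flip: tscale_mult_left)
qed

lemma pure_tensor_mem_span:
  assumes "set w \<subseteq> m1.span G"
  shows "pure_tensor \<iota> w \<in> m2.span (pure_tensor \<iota> ` {u. length u = length w \<and> set u \<subseteq> G})"
  using assms
proof (induction w)
  case Nil
  then show ?case by (auto intro: m2.span_base)
next
  case (Cons x w)
  have "\<iota> x \<in> m2.span (\<iota> ` G)"
    using Cons.prems span_image[of G] by auto
  then show ?case
    unfolding pure_tensor_Cons using Cons
    by (elim mult_mem_span)
       (auto intro!: m2.span_base simp flip: pure_tensor_Cons intro!: image_eqI)
qed

end

section \<open>Existence of the action of the symmetric group\<close>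

lemma (in module) independent_Un:
  assumes S: "independent S" and T: "independent T" and int: "span S \<inter> span T \<subseteq> {0}"
  shows "independent (S \<union> T)"
  unfolding independent_explicit_module
proof (intro allI impI)
  fix t u v
  assume t: "finite t" "t \<subseteq> S \<union> T" "(\<Sum>v\<in>t. scale (u v) v) = 0" "v \<in> t"
  let ?x = "\<Sum>v\<in>t \<inter> S. scale (u v) v" and ?y = "\<Sum>v\<in>t - S. scale (u v) v"
  have "?x + ?y = 0"
    using t(3) sum.Int_Diff[OF t(1), of "\<lambda>v. scale (u v) v" S] by simp
  moreover have "?x \<in> span S"
    by (intro span_sum span_scale span_base) auto
  moreover have y: "?y \<in> span T"
    by (intro span_sum span_scale span_base) (use t(2) in auto)
  ultimately have x0: "?x = 0"
    using int span_neg[OF y] by (metis IntI add_eq_0_iff2 singletonD subsetD)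
  with \<open>?x + ?y = 0\<close> have y0: "?y = 0" by simp
  show "u v = 0"
  proof (cases "v \<in> S")
    case True
    then show ?thesis using independentD[OF S _ _ x0] t by auto
  next
    case False
    then show ?thesis using independentD[OF T _ _ y0] t by auto
  qed
qed

section \<open>Parity components\<close>

lemma UNIV_bit: "(UNIV :: bit set) = {0, 1}"
  by (metis (full_types) UNIV_eq_I bit_not_one_iff insert_iff)

lemma sum_UNIV_bit: "(\<Sum>p\<in>(UNIV :: bit set). f p) = f 0 + (f 1 :: 'b::comm_monoid_add)"
  unfolding UNIV_bit by simp

context superalgebra
begin

lemma parity_decomposition: "\<exists>!u. (\<forall>p. u p \<in> A p) \<and> x = u 0 + u 1"
proof -
  have "\<exists>u. (\<forall>p. u p \<in> A p) \<and> x = u 0 + u 1"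
  proof -
    have "x \<in> {\<Sum>i\<in>UNIV. u i | u. \<forall>i\<in>UNIV. u i \<in> A i}"
      using parity_direct_sum by (simp add: is_direct_sum_def)
    then show ?thesis by (auto simp: sum_UNIV_bit)
  qed
  moreover have "u = v" if "\<forall>p. u p \<in> A p" "\<forall>p. v p \<in> A p" "u 0 + u 1 = v 0 + v 1" for u v
  proof -
    have "\<forall>p\<in>UNIV. u p - v p \<in> A p"
      using that subspace_parity by (auto intro: subspace_diff)
    moreover have "(\<Sum>p\<in>UNIV. u p - v p) = 0"
      using that(3) by (simp add: sum_UNIV_bit algebra_simps)
    ultimately have "\<forall>p\<in>UNIV. u p - v p = 0"
      using parity_direct_sum unfolding is_direct_sum_def
      by (elim conjE allE[of _ "\<lambda>p. u p - v p"]) blast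
    then show "u = v" by auto
  qed
  ultimately show ?thesis by blast
qed

definition parity_part :: "'a \<Rightarrow> bit \<Rightarrow> 'a" where
  "parity_part x = (THE u. (\<forall>p. u p \<in> A p) \<and> x = u 0 + u 1)"

lemma parity_part: "parity_part x p \<in> A p" "parity_part x 0 + parity_part x 1 = x"
  using theI'[OF parity_decomposition, of x] by (auto simp: parity_part_def)

text \<open>Uniqueness of the decomposition yields linearity of the projections: it suffices to
  exhibit a decomposition of the right shape.\<close>

lemma parity_part_eqI: "(\<And>p. u p \<in> A p) \<Longrightarrow> x = u 0 + u 1 \<Longrightarrow> parity_part x = u"
  unfolding parity_part_def by (rule the1_equality[OF parity_decomposition]) auto

lemma parity_part_add: "parity_part (x + y) p = parity_part x p + parity_part y p"
proof -
  have "parity_part (x + y) = (\<lambda>p. parity_part x p + parity_part y p)"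
    by (rule parity_part_eqI) (use parity_part[of x] parity_part[of y] subspace_parity in
      \<open>auto simp: algebra_simps intro: subspace_add dest: sym\<close>)
  then show ?thesis by simp
qed

lemma parity_part_scale: "parity_part (smul c x) p = smul c (parity_part x p)"
proof -
  have "parity_part (smul c x) = (\<lambda>p. smul c (parity_part x p))"
    by (rule parity_part_eqI) (use parity_part[of x] subspace_parity in
      \<open>auto intro: subspace_scale simp flip: scale_right_distrib\<close>)
  then show ?thesis by simp
qed

lemma parity_part_homogeneous:
  assumes "x \<in> A p"
  shows "parity_part x q = (if q = p then x else 0)"
proof -
  have "parity_part x = (\<lambda>q. if q = p then x else 0)"
    by (rule parity_part_eqI) (use assms subspace_parity in \<open>cases p; auto intro: subspace_0\<close>)+
  then show ?thesis by simp
qed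

lemma parity_part_zero: "parity_part 0 p = 0"
  using parity_part_homogeneous[OF subspace_0[OF subspace_parity], of p p] by simp

lemma parity_inter: "p \<noteq> q \<Longrightarrow> x \<in> A p \<Longrightarrow> x \<in> A q \<Longrightarrow> x = 0"
  using parity_part_homogeneous[of x p p] parity_part_homogeneous[of x q p] by auto

end

section \<open>Matrix entries and the construction of the action\<close>

lemma mat_scale_nth: "mat_scale smul c X $ i $ j = smul c (X $ i $ j)"
  by (simp add: mat_scale_def)

lemma mat_elt_nth: "mat_elt a r s $ i $ j = (if i = r \<and> j = s then a else 0)"
  by (simp add: mat_elt_def)

lemma mat_elt_sum: "(\<Sum>r\<in>UNIV. \<Sum>s\<in>UNIV. mat_elt (X $ r $ s) r s) = (X :: 'a::ab_group_add^'n::finite^'n)"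
proof -
  have "(\<Sum>r\<in>UNIV. \<Sum>s\<in>UNIV. if i = r \<and> j = s then X $ r $ s else 0) = X $ i $ j" for i j
  proof -
    have "(\<Sum>s\<in>UNIV. if i = r \<and> j = s then X $ r $ s else 0) = (if i = r then X $ r $ j else 0)" for r
      by (simp add: sum.delta)
    then show ?thesis by (simp add: sum.delta)
  qed
  then show ?thesis
    by (simp add: vec_eq_iff mat_elt_nth)
qed

text \<open>A permutation moves the varying letter to a place that does not depend on the letter, so
  linearity in one letter survives permutation.\<close>

lemma permute_list_replace_letter:
  assumes "\<sigma> \<in> sym_grp (Suc (length v + length w))"
  shows "\<exists>v' w'. \<forall>x. permute_list \<sigma> (v @ x # w) = v' @ x # w'"
proof -
  let ?N = "Suc (length v + length w)"
  have p: "\<sigma> permutes {..<?N}" using assms by (simp add: sym_grp_def)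
  define i where "i = inv \<sigma> (length v)"
  have \<sigma>i: "\<sigma> i = length v" using permutes_inverses[OF p] by (simp add: i_def)
  have i: "i < ?N" using permutes_in_image[OF p, of i] \<sigma>i by simp
  \<comment> \<open>\<open>undefined\<close> is a placeholder: all other letters of the permuted
    word are independent of x.\<close>
  define u where "u = permute_list \<sigma> (v @ undefined # w)"
  have len: "length u = ?N" by (simp add: u_def)
  have "permute_list \<sigma> (v @ x # w) = take i u @ x # drop (Suc i) u" for x
  proof -
    have "permute_list \<sigma> (v @ x # w) = u[i := x]"
    proof (rule nth_equalityI)
      fix k assume "k < length (permute_list \<sigma> (v @ x # w))"
      then have k: "k < ?N" by simp
      have nth: "permute_list \<sigma> (v @ z # w) ! k = (v @ z # w) ! \<sigma> k" for z
        using p k by (simp add: permute_list_nth)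
      show "permute_list \<sigma> (v @ x # w) ! k = u[i := x] ! k"
      proof (cases "k = i")
        case True
        then show ?thesis using k len nth[of x] by (simp add: \<sigma>i)
      next
        case False
        then have "\<sigma> k \<noteq> length v"
          using \<sigma>i inj_eq[OF permutes_inj[OF p], of k i] by simp
        then have "(v @ x # w) ! \<sigma> k = (v @ undefined # w) ! \<sigma> k"
          by (simp add: nth_append nth_Cons')
        then show ?thesis using False by (simp add: nth u_def)
      qed
    qed (simp add: len)
    then show ?thesis using i len by (simp add: upd_conv_take_nth_drop)
  qed
  then show ?thesis by blast
qed

context tensor_algebra
begin

text \<open>Each letter is transformed by its own linear map, and the word is then permuted; both
  preserve linearity in a single letter. The value 0 in the other lengths extends the function to
  all words, as the universal property requires.\<close>

lemma word_multilinear_permute: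
  assumes \<sigma>: "\<sigma> \<in> sym_grp d" and ps: "length ps = d"
    and f: "\<And>p. p \<in> set ps \<Longrightarrow> module_hom mscale mscale (f p)"
  shows "word_multilinear mscale tscale (\<lambda>w. if length w = d then tscale c (pure_tensor \<iota> (permute_list \<sigma> (map2 f ps w))) else 0)"
    (is "word_multilinear _ _ ?F")
proof -
  have "\<exists>g. module_hom mscale tscale g \<and> (\<forall>x. ?F (v @ x # w) = g x)" for v w
  proof (cases "Suc (length v + length w) = d")
    case True
    let ?v = "map2 f (take (length v) ps) v" and ?w = "map2 f (drop (Suc (length v)) ps) w"
    let ?f = "f (ps ! length v)"
    have len: "length v < length ps" using True ps by simp
    have map2_eq: "map2 f ps (v @ x # w) = ?v @ ?f x # ?w" for x
      by (simp add: zip_append2 len flip: Cons_nth_drop_Suc[OF len])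
    interpret f: module_hom mscale mscale ?f
      using f len by simp
    have "Suc (length ?v + length ?w) = d" using True ps by simp
    then obtain v' w' where vw: "\<And>x. permute_list \<sigma> (?v @ x # ?w) = v' @ x # w'"
      using permute_list_replace_letter[of \<sigma> ?v ?w] \<sigma> by auto
    let ?g = "\<lambda>x. tscale c (pure_tensor \<iota> v' * (\<iota> (?f x) * pure_tensor \<iota> w'))"
    have "module_hom mscale tscale ?g"
      by (simp add: module_hom_iff m1.module_axioms m2.module_axioms f.add f.scale add scale
          distrib_left distrib_right m2.scale_right_distrib mult.commute[of c]
          flip: tscale_mult_left tscale_mult_right)
    moreover have "?F (v @ x # w) = ?g x" for x
      using True by (simp add: map2_eq vw pure_tensor_append pure_tensor_Cons)
    ultimately show ?thesis by blast
  next
    case False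
    then show ?thesis
      by (intro exI[of _ "\<lambda>_. 0"]) (simp add: module_hom_iff m1.module_axioms m2.module_axioms)
  qed
  note hom = this
  show ?thesis
    unfolding word_multilinear_def
  proof (intro conjI allI)
    fix v w x y c'
    obtain g where g: "module_hom mscale tscale g" "\<And>x. ?F (v @ x # w) = g x"
      using hom[of v w] by blast
    show "?F (v @ (x + y) # w) = ?F (v @ x # w) + ?F (v @ y # w)"
      unfolding g(2) by (rule module_hom.add[OF g(1)])
    show "?F (v @ mscale c' x # w) = tscale c' (?F (v @ x # w))"
      unfolding g(2) by (rule module_hom.scale[OF g(1)])
  qed
qed

end

lemma (in module) word_multilinear_sum:
  assumes "\<And>i. i \<in> I \<Longrightarrow> word_multilinear s scale (F i)"
  shows "word_multilinear s scale (\<lambda>w. \<Sum>i\<in>I. F i w)"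
  using assms by (simp add: word_multilinear_def sum.distrib scale_sum_right)

lemma finite_lists_bit: "finite {ps :: bit list. length ps = d}"
proof -
  have "finite (UNIV :: bit set)" by (simp add: UNIV_bit)
  from finite_lists_length_eq[OF this, of d] show ?thesis by simp
qed

locale tensor_setup = good_pair_basis smul A \<aa> \<cc> B\<^sub>\<aa> B\<^sub>\<cc> B\<^sub>1 + tensor_algebra "mat_scale smul" tscale \<iota>
  for smul :: "'k::{idom,ring_char_0} \<Rightarrow> 'a::ring \<Rightarrow> 'a" and A :: "bit \<Rightarrow> 'a set" and \<aa> \<cc> B\<^sub>\<aa> B\<^sub>\<cc> B\<^sub>1 :: "'a set"
    and tscale :: "'k \<Rightarrow> 't::ring_1 \<Rightarrow> 't" and \<iota> :: "'a^'n::finite^'n \<Rightarrow> 't"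
begin

abbreviation elt :: "'a \<times> 'n \<times> 'n \<Rightarrow> 'a^'n^'n" where
  "elt \<equiv> \<lambda>(a, r, s). mat_elt a r s"

abbreviation E :: "('a \<times> 'n \<times> 'n) list \<Rightarrow> 't" where
  "E \<equiv> elt_tensor \<iota>"

abbreviation act :: "nat \<Rightarrow> (nat \<Rightarrow> nat) \<Rightarrow> 't \<Rightarrow> 't" where
  "act \<equiv> perm_act A tscale \<iota>"

definition mat_parity_part :: "bit \<Rightarrow> 'a^'n^'n \<Rightarrow> 'a^'n^'n" where
  "mat_parity_part p X = (\<chi> i j. parity_part (X $ i $ j) p)"

lemma module_hom_mat_parity_part: "module_hom (mat_scale smul) (mat_scale smul) (mat_parity_part p)"
  by (simp add: module_hom_iff m1.module_axioms vec_eq_iff mat_parity_part_def mat_scale_nth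
      parity_part_add parity_part_scale)

text \<open>The sign makes sense only for homogeneous letters. So every letter is split into its
  parity components, each resulting word is permuted with its own sign, and the signed sum is
  multilinear. On a homogeneous word only the given parities survive.\<close>

lemma perm_act_exists:
  assumes \<sigma>: "\<sigma> \<in> sym_grp d"
  shows "\<exists>f. module_hom tscale tscale f \<and>
     (\<forall>w ps. length w = d \<longrightarrow> length ps = d \<longrightarrow> (\<forall>k<d. fst (w ! k) \<in> A (ps ! k)) \<longrightarrow>
        f (E w) = tscale ((- 1) ^ odd_inversions \<sigma> ps) (E (permute_list \<sigma> w)))"
proof -
  let ?G = "\<lambda>ps w. if length w = d then tscale ((- 1) ^ odd_inversions \<sigma> ps)
      (pure_tensor \<iota> (permute_list \<sigma> (map2 mat_parity_part ps w))) else 0"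
  let ?F = "\<lambda>w. \<Sum>ps\<in>{ps. length ps = d}. ?G ps w"
  have "word_multilinear (mat_scale smul) tscale ?F"
    by (intro m2.word_multilinear_sum word_multilinear_permute \<sigma> module_hom_mat_parity_part) auto
  then obtain f where f: "module_hom tscale tscale f" "\<And>w. f (pure_tensor \<iota> w) = ?F w"
    using universal_property[OF m2.module_axioms] by blast
  have "f (E w) = tscale ((- 1) ^ odd_inversions \<sigma> ps) (E (permute_list \<sigma> w))"
    if len: "length w = d" "length ps = d" and hom: "\<forall>k<d. fst (w ! k) \<in> A (ps ! k)" for w ps
  proof -
    have nth: "mat_parity_part (qs ! k) (elt (w ! k)) = (if qs ! k = ps ! k then elt (w ! k) else 0)"
      if "k < d" for k and qs :: "bit list"
    proof -
      obtain a r s where ars: "w ! k = (a, r, s)" by (cases "w ! k")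
      then have "a \<in> A (ps ! k)" using hom that by force
      then show ?thesis
        by (simp add: ars vec_eq_iff mat_parity_part_def mat_elt_nth parity_part_homogeneous
            parity_part_zero)
    qed
    have p: "\<sigma> permutes {..<length (map2 mat_parity_part qs (map elt w))}" if "length qs = d" for qs
      using \<sigma> len that by (simp add: sym_grp_def)
    \<comment> \<open>One wrong parity projects its letter to 0, which kills the whole
      tensor.\<close>
    have zero: "?G qs (map elt w) = 0" if "length qs = d" "qs \<noteq> ps" for qs
    proof -
      obtain k where k: "k < d" "qs ! k \<noteq> ps ! k"
        using \<open>length qs = d\<close> \<open>qs \<noteq> ps\<close> len nth_equalityI by metis
      have "map2 mat_parity_part qs (map elt w) ! k = mat_parity_part (qs ! k) (elt (w ! k))"
        using k(1) len(1) that(1) by simp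
      also have "\<dots> = 0"
        using nth[OF k(1), of qs] k(2) by simp
      finally have "0 \<in> set (map2 mat_parity_part qs (map elt w))"
        unfolding in_set_conv_nth using k(1) len(1) that(1) by (intro exI[of _ k]) simp
      then have "0 \<in> set (permute_list \<sigma> (map2 mat_parity_part qs (map elt w)))"
        unfolding set_permute_list[OF p[OF that(1)]] .
      from pure_tensor_zero[OF this] show ?thesis by simp
    qed
    have "map2 mat_parity_part ps (map elt w) = map elt w"
      by (rule nth_equalityI) (use nth len in auto)
    then have "?G ps (map elt w) = tscale ((- 1) ^ odd_inversions \<sigma> ps) (E (permute_list \<sigma> w))"
      using \<sigma> len by (simp add: elt_tensor_def permute_list_map sym_grp_def)
    moreover have "?F (map elt w) = ?G ps (map elt w)"
      using sum.remove[OF finite_lists_bit, of ps d "\<lambda>qs. ?G qs (map elt w)"] zero len by simp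
    ultimately show ?thesis
      by (simp add: elt_tensor_def f(2))
  qed
  with f(1) show ?thesis by blast
qed

text \<open>Linearity and the values on homogeneous words are all that is used about
  \<open>perm_act\<close> from here on.\<close>

lemma
  assumes "\<sigma> \<in> sym_grp d"
  shows module_hom_act: "module_hom tscale tscale (act d \<sigma>)"
    and act_elt_tensor: "\<And>w ps. length w = d \<Longrightarrow> length ps = d \<Longrightarrow> (\<And>k. k < d \<Longrightarrow> fst (w ! k) \<in> A (ps ! k)) \<Longrightarrow>
        act d \<sigma> (E w) = tscale ((- 1) ^ odd_inversions \<sigma> ps) (E (permute_list \<sigma> w))"
  using someI_ex[OF perm_act_exists[OF assms]] unfolding perm_act_def by blast+

end

section \<open>Symmetrization and coordinates\<close>

text \<open>The tensor product of a list of functionals, as a function on words. The value 0 for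
  unequal lengths makes it multilinear on words of every length.\<close>

fun prod_functionals :: "('m \<Rightarrow> 'k::comm_ring_1) list \<Rightarrow> 'm list \<Rightarrow> 'k" where
  "prod_functionals [] [] = 1"
| "prod_functionals (f # fs) (x # xs) = f x * prod_functionals fs xs"
| "prod_functionals _ _ = 0"

lemma word_multilinear_prod_functionals:
  assumes "\<And>f. f \<in> set fs \<Longrightarrow> module_hom s (*) f"
  shows "word_multilinear s (*) (prod_functionals fs)"
proof -
  have "prod_functionals fs (v @ (x + y) # w) = prod_functionals fs (v @ x # w) + prod_functionals fs (v @ y # w) \<and>
      prod_functionals fs (v @ s c x # w) = c * prod_functionals fs (v @ x # w)" for v w x y c
    using assms
  proof (induction fs arbitrary: v)
    case Nil
    then show ?case by (cases v) auto
  next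
    case (Cons f fs)
    have f: "module_hom s (*) f"
      by (rule Cons.prems) simp
    from Cons.IH[OF Cons.prems, of "tl v"] show ?case
      by (cases v) (auto simp: module_hom.add[OF f] module_hom.scale[OF f] algebra_simps)
  qed
  then show ?thesis
    by (simp add: word_multilinear_def)
qed

section \<open>The homogeneous basis of the superalgebra\<close>

context good_pair_basis
begin

abbreviation "B \<equiv> B\<^sub>\<aa> \<union> B\<^sub>\<cc> \<union> B\<^sub>1"

lemma independent_parts: "independent B\<^sub>\<aa>" "independent B\<^sub>\<cc>" "independent B\<^sub>1"
  and span_parts: "span B\<^sub>\<aa> = \<aa>" "span B\<^sub>\<cc> = \<cc>" "span B\<^sub>1 = A 1"
  using basis_subalgebra basis_complement basis_odd by (auto simp: module_basis_def)

lemma span_even: "span (B\<^sub>\<aa> \<union> B\<^sub>\<cc>) = A 0"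
  using complement(2) by (auto simp: span_Un span_parts)

lemma independent_even: "independent (B\<^sub>\<aa> \<union> B\<^sub>\<cc>)"
  by (rule independent_Un[OF independent_parts(1,2)]) (simp add: span_parts complement(1))

lemma parity_inter_0_1: "x \<in> A 0 \<Longrightarrow> x \<in> A 1 \<Longrightarrow> x = 0"
  using parity_inter[of 0 1 x] by simp

lemma independent_B: "independent B"
proof (rule independent_Un[OF independent_even independent_parts(3)])
  show "span (B\<^sub>\<aa> \<union> B\<^sub>\<cc>) \<inter> span B\<^sub>1 \<subseteq> {0}"
    unfolding span_even span_parts using parity_inter_0_1 by blast
qed

lemma span_B: "span B = UNIV"
proof -
  have "x \<in> span B" for x
  proof -
    have "parity_part x 0 \<in> span (B\<^sub>\<aa> \<union> B\<^sub>\<cc>)" "parity_part x 1 \<in> span B\<^sub>1"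
      by (simp_all add: span_even span_parts parity_part)
    then have "parity_part x 0 + parity_part x 1 \<in> span B"
      by (intro span_add) (auto intro: subsetD[OF span_mono, rotated])
    then show ?thesis by (simp add: parity_part)
  qed
  then show ?thesis by blast
qed

lemma zero_notin_B: "0 \<notin> B"
  using independent_B dependent_zero[of B] by argo

lemma basis_even: "b \<in> B\<^sub>\<aa> \<union> B\<^sub>\<cc> \<Longrightarrow> b \<in> A 0"
  using span_base[of b "B\<^sub>\<aa> \<union> B\<^sub>\<cc>"] by (simp add: span_even)

lemma odd_basis: "b \<in> B\<^sub>1 \<Longrightarrow> b \<in> A 1"
  using span_base[of b B\<^sub>1] by (simp add: span_parts)

lemma odd_basis_not_even:
  assumes "b \<in> B\<^sub>1"
  shows "b \<notin> A 0"
proof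
  assume "b \<in> A 0"
  then have "b = 0" using parity_inter_0_1 odd_basis[OF assms] by simp
  then show False using assms zero_notin_B by simp
qed

text \<open>A common element would lie in two submodules that meet in 0, and a basis does not
  contain 0.\<close>

lemma disjoint_subalgebra_basis: "B\<^sub>\<aa> \<inter> (B\<^sub>\<cc> \<union> B\<^sub>1) = {}"
proof -
  have "b \<notin> B\<^sub>\<cc>" if b: "b \<in> B\<^sub>\<aa>" for b
  proof
    assume "b \<in> B\<^sub>\<cc>"
    then have "b \<in> \<aa> \<inter> \<cc>"
      using span_base[OF b] span_base[of b B\<^sub>\<cc>] by (simp add: span_parts)
    then have "b = 0" unfolding complement(1) by simp
    then show False using b zero_notin_B by blast
  qed
  moreover have "b \<notin> B\<^sub>1" if "b \<in> B\<^sub>\<aa>" for b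
    using that basis_even odd_basis_not_even by blast
  ultimately show ?thesis by blast
qed

definition parity :: "'a \<Rightarrow> bit" where
  "parity b = (if b \<in> B\<^sub>1 then 1 else 0)"

lemma basis_parity: "b \<in> B \<Longrightarrow> b \<in> A (parity b)"
  using basis_even odd_basis by (auto simp: parity_def)

text \<open>Links the signs, which are computed from parities, to \<open>Tri\<close>, which speaks
  of membership in \<open>A 0\<close>.\<close>

lemma parity_eq_1_iff: "b \<in> B \<Longrightarrow> parity b = 1 \<longleftrightarrow> b \<notin> A 0"
  using basis_even odd_basis_not_even by (auto simp: parity_def)

end

section \<open>The action on tensors of basis words\<close>

context tensor_setup
begin

abbreviation letters :: "('a \<times> 'n \<times> 'n) set" where
  "letters \<equiv> B \<times> UNIV"

definition parities :: "('a \<times> 'n \<times> 'n) list \<Rightarrow> bit list" where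
  "parities w = map (parity \<circ> fst) w"

lemma length_parities [simp]: "length (parities w) = length w"
  by (simp add: parities_def)

lemma parities_permute_list: "\<sigma> \<in> sym_grp (length w) \<Longrightarrow> parities (permute_list \<sigma> w) = permute_list \<sigma> (parities w)"
  by (simp add: parities_def permute_list_map sym_grp_def)

lemma parities_append: "parities (v @ w) = parities v @ parities w"
  by (simp add: parities_def)

lemma set_permute_list_sym: "\<sigma> \<in> sym_grp (length w) \<Longrightarrow> set (permute_list \<sigma> w) = set w"
  by (simp add: sym_grp_def)

lemma act_E:
  assumes \<sigma>: "\<sigma> \<in> sym_grp (length w)" and w: "set w \<subseteq> letters"
  shows "act (length w) \<sigma> (E w) = tscale ((- 1) ^ odd_inversions \<sigma> (parities w)) (E (permute_list \<sigma> w))"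
proof (rule act_elt_tensor[OF \<sigma>])
  fix k assume "k < length w"
  then have "w ! k \<in> letters" using w nth_mem by blast
  then have "fst (w ! k) \<in> B" by (simp add: mem_Times_iff)
  then show "fst (w ! k) \<in> A (parities w ! k)"
    using basis_parity \<open>k < length w\<close> by (simp add: parities_def)
qed simp_all

definition words :: "('a \<times> 'n \<times> 'n) set \<Rightarrow> nat \<Rightarrow> ('a \<times> 'n \<times> 'n) list set" where
  "words L d = {w. length w = d \<and> set w \<subseteq> L}"

abbreviation TP :: "nat \<Rightarrow> 't set" where
  "TP d \<equiv> m2.span (E ` words letters d)"

lemma E_append: "E (v @ w) = E v * E w"
  by (simp add: elt_tensor_def pure_tensor_append)

lemma E_in_TP: "set w \<subseteq> letters \<Longrightarrow> E w \<in> TP (length w)"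
  by (intro m2.span_base) (auto simp: words_def)

lemma hom_eq_on_span:
  assumes "module_hom tscale tscale f" "module_hom tscale tscale g"
    and "\<And>x. x \<in> S \<Longrightarrow> f x = g x" "x \<in> m2.span S"
  shows "f x = g x"
  using module_pair.module_hom_eq_on_span[OF module_pair.intro[OF m2.module_axioms m2.module_axioms] assms] .

lemma module_hom_comp:
  "module_hom tscale tscale f \<Longrightarrow> module_hom tscale tscale g \<Longrightarrow> module_hom tscale tscale (\<lambda>x. f (g x))"
  by (simp add: module_hom_iff)

lemma hom_mem_span:
  assumes "module_hom tscale tscale f" "\<And>x. x \<in> S \<Longrightarrow> f x \<in> m2.span U" "x \<in> m2.span S"
  shows "f x \<in> m2.span U"
proof -
  interpret f: module_hom tscale tscale f by fact
  show ?thesis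
    using assms(3)
    by (induction x rule: m2.span_induct_alt)
      (auto simp: f.add f.scale intro: m2.span_zero m2.span_add m2.span_scale assms(2))
qed

text \<open>The right action on words and the cocycle identity for the signs combine, whence the
  reversed order on the right-hand side. The claim is confined to degree d, where the choice in
  \<open>perm_act\<close> is determined.\<close>

lemma act_comp:
  assumes \<sigma>: "\<sigma> \<in> sym_grp d" and \<tau>: "\<tau> \<in> sym_grp d" and x: "x \<in> TP d"
  shows "act d (\<sigma> \<circ> \<tau>) x = act d \<tau> (act d \<sigma> x)"
proof (rule hom_eq_on_span[OF module_hom_act module_hom_comp[OF module_hom_act module_hom_act] _ x])
  fix y assume "y \<in> E ` words letters d"
  then obtain w where w: "y = E w" "length w = d" "set w \<subseteq> letters" by (auto simp: words_def)
  have "act d \<tau> (act d \<sigma> y) = tscale ((- 1) ^ odd_inversions \<sigma> (parities w))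
      (tscale ((- 1) ^ odd_inversions \<tau> (permute_list \<sigma> (parities w))) (E (permute_list \<tau> (permute_list \<sigma> w))))"
    using act_E[of \<sigma> w] act_E[of \<tau> "permute_list \<sigma> w"] w \<sigma> \<tau>
    by (simp add: module_hom.scale[OF module_hom_act[OF \<tau>]] set_permute_list_sym parities_permute_list)
  also have "\<dots> = act d (\<sigma> \<circ> \<tau>) y"
    using act_E[of "\<sigma> \<circ> \<tau>" w] w \<sigma> \<tau>
    by (simp add: sym_grp_comp permute_list_comp neg_one_power_odd_inversions_comp)
  finally show "act d (\<sigma> \<circ> \<tau>) y = act d \<tau> (act d \<sigma> y)" ..
qed (use \<sigma> \<tau> in \<open>auto intro: sym_grp_comp\<close>)

lemma mult_in_TP: "x \<in> TP d \<Longrightarrow> y \<in> TP e \<Longrightarrow> x * y \<in> TP (d + e)"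
  by (erule mult_mem_span, assumption)
    (auto simp: words_def simp flip: E_append intro!: m2.span_base)

text \<open>Bilinearity reduces the claim to basis words. There the signs multiply, because no odd
  letter of the left factor passes one of the right factor.\<close>

lemma act_block_perm:
  assumes \<sigma>: "\<sigma> \<in> sym_grp d" and \<tau>: "\<tau> \<in> sym_grp e" and x: "x \<in> TP d" and y: "y \<in> TP e"
  shows "act (d + e) (block_perm d \<sigma> \<tau>) (x * y) = act d \<sigma> x * act e \<tau> y"
proof -
  have \<rho>: "block_perm d \<sigma> \<tau> \<in> sym_grp (d + e)"
    using block_perm_mem_young_subgrp[OF \<sigma> \<tau>] by (rule young_subgrp_sym_grp)
  interpret \<rho>: module_hom tscale tscale "act (d + e) (block_perm d \<sigma> \<tau>)"
    by (rule module_hom_act[OF \<rho>])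
  interpret \<sigma>: module_hom tscale tscale "act d \<sigma>"
    by (rule module_hom_act[OF \<sigma>])
  interpret \<tau>: module_hom tscale tscale "act e \<tau>"
    by (rule module_hom_act[OF \<tau>])
  have EE: "act (d + e) (block_perm d \<sigma> \<tau>) (E v * E w) = act d \<sigma> (E v) * act e \<tau> (E w)"
    if "v \<in> words letters d" "w \<in> words letters e" for v w
  proof -
    from that have v: "length v = d" "set v \<subseteq> letters" and w: "length w = e" "set w \<subseteq> letters"
      by (auto simp: words_def)
    have "act (d + e) (block_perm d \<sigma> \<tau>) (E (v @ w)) =
        tscale ((- 1) ^ (odd_inversions \<sigma> (parities v) + odd_inversions \<tau> (parities w)))
          (E (permute_list \<sigma> v @ permute_list \<tau> w))"
      using act_E[of "block_perm d \<sigma> \<tau>" "v @ w"] v w \<rho> \<sigma> \<tau>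
        permute_list_block_perm[of \<sigma> v \<tau> w] odd_inversions_block_perm[of \<sigma> "parities v" \<tau> "parities w"]
      by (simp add: parities_append)
    then show ?thesis
      using act_E[of \<sigma> v] act_E[of \<tau> w] v w \<sigma> \<tau>
      by (simp add: E_append power_add mult.commute[of "(- 1 :: 'k) ^ odd_inversions \<sigma> (parities v)"]
          flip: tscale_mult_left tscale_mult_right)
  qed
  have "act (d + e) (block_perm d \<sigma> \<tau>) (E v * y) = act d \<sigma> (E v) * act e \<tau> y"
    if "v \<in> words letters d" for v
    by (rule hom_eq_on_span[of "\<lambda>y. act (d + e) (block_perm d \<sigma> \<tau>) (E v * y)" "\<lambda>y. act d \<sigma> (E v) * act e \<tau> y", OF _ _ _ y])
      (auto simp: module_hom_iff m2.module_axioms distrib_left \<rho>.add \<rho>.scale \<tau>.add \<tau>.scale EE that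
        simp flip: tscale_mult_right)
  note Ey = this
  show ?thesis
    by (rule hom_eq_on_span[of "\<lambda>x. act (d + e) (block_perm d \<sigma> \<tau>) (x * y)" "\<lambda>x. act d \<sigma> x * act e \<tau> y", OF _ _ _ x])
      (auto simp: module_hom_iff m2.module_axioms distrib_right \<rho>.add \<rho>.scale \<sigma>.add \<sigma>.scale Ey
        simp flip: tscale_mult_left)
qed

section \<open>The symmetrizer\<close>

text \<open>It is not divided by d!, since factorials need not be invertible in the ground
  ring.\<close>

definition Sym :: "nat \<Rightarrow> 't \<Rightarrow> 't" where
  "Sym d x = (\<Sum>\<sigma>\<in>sym_grp d. act d \<sigma> x)"

lemma module_hom_sum_act:
  assumes "S \<subseteq> sym_grp d"
  shows "module_hom tscale tscale (\<lambda>x. \<Sum>\<sigma>\<in>S. act d \<sigma> x)"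
  using assms module_hom_act
  by (auto simp: module_hom_iff m2.module_axioms sum.distrib m2.scale_sum_right subset_iff)

lemma module_hom_Sym: "module_hom tscale tscale (Sym d)"
  unfolding Sym_def[abs_def] by (rule module_hom_sum_act) simp

lemma Sym_act: "\<sigma> \<in> sym_grp d \<Longrightarrow> x \<in> TP d \<Longrightarrow> Sym d (act d \<sigma> x) = Sym d x"
  unfolding Sym_def
  using sum.reindex_bij_betw[OF bij_betw_sym_grp_comp(1), of \<sigma> d "\<lambda>\<tau>. act d \<tau> x"]
  by (simp add: act_comp)

lemma act_Sym: "\<sigma> \<in> sym_grp d \<Longrightarrow> x \<in> TP d \<Longrightarrow> act d \<sigma> (Sym d x) = Sym d x"
  unfolding Sym_def
  using sum.reindex_bij_betw[OF bij_betw_sym_grp_comp(2), of \<sigma> d "\<lambda>\<tau>. act d \<tau> x"]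
  by (simp add: act_comp module_hom.sum[OF module_hom_act])

lemma star_Sym:
  assumes x: "x \<in> TP d" and y: "y \<in> TP e"
  shows "star A tscale \<iota> d e (Sym d x) (Sym e y) = Sym (d + e) (x * y)"
proof -
  have \<rho>: "\<rho> \<in> sym_grp (d + e)" if "\<rho> \<in> shortest_reps d e" for \<rho>
    using that by (simp add: shortest_reps_def)
  have "Sym (d + e) (x * y) = (\<Sum>\<rho>\<in>shortest_reps d e. \<Sum>\<sigma>\<in>sym_grp d. \<Sum>\<tau>\<in>sym_grp e.
      act (d + e) (block_perm d \<sigma> \<tau> \<circ> \<rho>) (x * y))"
    unfolding Sym_def by (rule sum_sym_grp_shortest_reps)
  \<comment> \<open>In a right action the left factor of a composite acts first: the block
    permutation acts on the two tensor factors separately, and the representative acts on the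
    result.\<close>
  also have "\<dots> = (\<Sum>\<rho>\<in>shortest_reps d e. act (d + e) \<rho>
      (\<Sum>\<sigma>\<in>sym_grp d. \<Sum>\<tau>\<in>sym_grp e. act d \<sigma> x * act e \<tau> y))"
    using x y
    by (intro sum.cong refl)
      (simp add: \<rho> module_hom.sum[OF module_hom_act] act_comp mult_in_TP act_block_perm
        young_subgrp_sym_grp[OF block_perm_mem_young_subgrp])
  also have "\<dots> = star A tscale \<iota> d e (Sym d x) (Sym e y)"
    by (simp add: star_def Sym_def sum_product)
  finally show ?thesis ..
qed

section \<open>Coordinate functionals\<close>

definition coord :: "'a \<times> 'n \<times> 'n \<Rightarrow> 'a^'n^'n \<Rightarrow> 'k" where
  "coord = (\<lambda>(b, r, s) X. representation B (X $ r $ s) b)"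

lemma module_coefficients: "module ((*) :: 'k \<Rightarrow> 'k \<Rightarrow> 'k)"
  by standard (auto simp: algebra_simps)

lemma module_hom_coord: "module_hom (mat_scale smul) (*) (coord x)"
  by (cases x) (simp add: coord_def module_hom_iff m1.module_axioms module_coefficients mat_scale_nth
      representation_add[OF independent_B] representation_scale[OF independent_B] span_B)

lemma coord_elt: "x \<in> letters \<Longrightarrow> y \<in> letters \<Longrightarrow> coord x (elt y) = (if y = x then 1 else 0)"
  by (cases x; cases y)
    (auto simp: coord_def mat_elt_nth representation_zero representation_basis[OF independent_B])

lemma prod_functionals_coord:
  "set u \<subseteq> letters \<Longrightarrow> set w \<subseteq> letters \<Longrightarrow>
    prod_functionals (map coord w) (map elt u) = (if u = w then 1 else 0)"
proof (induction w arbitrary: u)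
  case Nil
  then show ?case by (cases u) auto
next
  case (Cons x w)
  then show ?case using coord_elt by (cases u) auto
qed

text \<open>The functional dual to the basis tensor of w. It vanishes on the tensors of all other
  basis words, including those of other lengths, so coordinates are available on the whole tensor
  algebra.\<close>

definition coeff :: "('a \<times> 'n \<times> 'n) list \<Rightarrow> 't \<Rightarrow> 'k" where
  "coeff w = (SOME f. module_hom tscale (*) f \<and>
     (\<forall>u. set u \<subseteq> letters \<longrightarrow> f (E u) = (if u = w then 1 else 0)))"

lemma
  assumes "set w \<subseteq> letters"
  shows module_hom_coeff: "module_hom tscale (*) (coeff w)"
    and coeff_E: "\<And>u. set u \<subseteq> letters \<Longrightarrow> coeff w (E u) = (if u = w then 1 else 0)"
proof -
  have "word_multilinear (mat_scale smul) (*) (prod_functionals (map coord w))"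
    by (rule word_multilinear_prod_functionals) (use module_hom_coord in auto)
  then obtain f where f: "module_hom tscale (*) f" "\<And>u. f (pure_tensor \<iota> u) = prod_functionals (map coord w) u"
    using universal_property[OF module_coefficients] by blast
  then have "f (E u) = (if u = w then 1 else 0)" if "set u \<subseteq> letters" for u
    using prod_functionals_coord[OF that assms] by (simp add: elt_tensor_def)
  with f(1) have "\<exists>f. module_hom tscale (*) f \<and> (\<forall>u. set u \<subseteq> letters \<longrightarrow> f (E u) = (if u = w then 1 else 0))"
    by blast
  from someI_ex[OF this] show "module_hom tscale (*) (coeff w)"
    "\<And>u. set u \<subseteq> letters \<Longrightarrow> coeff w (E u) = (if u = w then 1 else 0)"
    unfolding coeff_def by blast+
qed

lemma mat_mem_span:
  assumes "\<And>i j. X $ i $ j \<in> span C"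
  shows "X \<in> m1.span (elt ` (C \<times> UNIV))"
proof -
  have "mat_elt x r s \<in> m1.span (elt ` (C \<times> UNIV))" if "x \<in> span C" for x r s
  proof -
    have "module_hom smul (mat_scale smul) (\<lambda>x. mat_elt x r s)"
      by (simp add: module_hom_iff module_axioms m1.module_axioms vec_eq_iff mat_elt_nth mat_scale_nth)
    then interpret h: module_hom smul "mat_scale smul" "\<lambda>x. mat_elt x r s" .
    have "mat_elt x r s \<in> (\<lambda>x. mat_elt x r s) ` span C" using that by blast
    also have "\<dots> = m1.span ((\<lambda>x. mat_elt x r s) ` C)" by (rule h.span_image[symmetric])
    also have "\<dots> \<subseteq> m1.span (elt ` (C \<times> UNIV))"
      by (intro m1.span_mono image_subsetI) (rule image_eqI[of _ _ "(_, r, s)"], auto)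
    finally show ?thesis .
  qed
  then have "(\<Sum>r\<in>UNIV. \<Sum>s\<in>UNIV. mat_elt (X $ r $ s) r s) \<in> m1.span (elt ` (C \<times> UNIV))"
    using assms by (intro m1.span_sum) blast
  then show ?thesis by (simp add: mat_elt_sum)
qed

text \<open>The set \<open>C\<close> is left open: \<open>B\<close> yields the whole tensor algebra,
  \<open>B\<^sub>\<aa>\<close> the tensor powers of matrices over \<open>\<aa>\<close>.\<close>

lemma pure_tensor_mem_span_E:
  assumes "\<And>X i j. X \<in> set w \<Longrightarrow> X $ i $ j \<in> span C"
  shows "pure_tensor \<iota> w \<in> m2.span (E ` words (C \<times> UNIV) (length w))"
proof -
  have "set w \<subseteq> m1.span (elt ` (C \<times> UNIV))"
    using assms mat_mem_span by blast
  then have "pure_tensor \<iota> w \<in> m2.span (pure_tensor \<iota> ` {u. length u = length w \<and> set u \<subseteq> elt ` (C \<times> UNIV)})"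
    by (rule pure_tensor_mem_span)
  also have "{u. length u = length w \<and> set u \<subseteq> elt ` (C \<times> UNIV)} = map elt ` words (C \<times> UNIV) (length w)"
  proof (rule set_eqI)
    fix u
    have "set u \<subseteq> elt ` (C \<times> UNIV) \<longleftrightarrow> u \<in> map elt ` lists (C \<times> UNIV)"
      by (simp only: lists_image[symmetric] in_lists_conv_set subset_iff Ball_def)
    then show "u \<in> {u. length u = length w \<and> set u \<subseteq> elt ` (C \<times> UNIV)} \<longleftrightarrow> u \<in> map elt ` words (C \<times> UNIV) (length w)"
      unfolding words_def lists_eq_set by (auto simp del: set_map)
  qed
  also have "pure_tensor \<iota> ` map elt ` words (C \<times> UNIV) (length w) = E ` words (C \<times> UNIV) (length w)"
    by (simp add: image_image elt_tensor_def)
  finally show ?thesis .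
qed

lemma span_E: "m2.span (E ` {w. set w \<subseteq> letters}) = UNIV"
proof -
  have "pure_tensor \<iota> w \<in> m2.span (E ` {w. set w \<subseteq> letters})" for w
    using pure_tensor_mem_span_E[of w B] m2.span_mono[of "E ` words letters (length w)" "E ` {w. set w \<subseteq> letters}"]
    by (auto simp: span_B words_def)
  then have "m2.span (range (pure_tensor \<iota>)) \<subseteq> m2.span (E ` {w. set w \<subseteq> letters})"
    by (intro m2.span_minimal) auto
  then show ?thesis using generated by auto
qed

text \<open>Makes \<open>coeff\<close> the coordinates of an actual expansion, whose support stays
  within the words \<open>W\<close> that were used to span the element.\<close>

lemma span_E_expansion:
  assumes W: "\<And>w. w \<in> W \<Longrightarrow> set w \<subseteq> letters" and x: "x \<in> m2.span (E ` W)"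
  shows "finite {w. set w \<subseteq> letters \<and> coeff w x \<noteq> 0} \<and> {w. set w \<subseteq> letters \<and> coeff w x \<noteq> 0} \<subseteq> W \<and>
    x = (\<Sum>w | set w \<subseteq> letters \<and> coeff w x \<noteq> 0. tscale (coeff w x) (E w))"
proof -
  \<comment> \<open>The induction carries a finite set containing the support, because adding a term
    may cancel a coefficient. It is cut down to the support afterwards.\<close>
  have "\<exists>t. finite t \<and> t \<subseteq> W \<and> x = (\<Sum>w\<in>t. tscale (coeff w x) (E w)) \<and> (\<forall>w. set w \<subseteq> letters \<longrightarrow> w \<notin> t \<longrightarrow> coeff w x = 0)"
    using x
  proof (induction x rule: m2.span_induct_alt)
    case base
    show ?case
      by (rule exI[of _ "{}"]) (auto intro: module_hom.zero[OF module_hom_coeff])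
  next
    case (step c x y)
    then obtain t u where t: "finite t" "t \<subseteq> W" "y = (\<Sum>w\<in>t. tscale (coeff w y) (E w))"
        "\<And>w. set w \<subseteq> letters \<Longrightarrow> w \<notin> t \<Longrightarrow> coeff w y = 0"
      by blast
    from step obtain u where u: "x = E u" "u \<in> W" by blast
    have co: "coeff w (tscale c x + y) = (if w = u then c else 0) + coeff w y" if "set w \<subseteq> letters" for w
      using coeff_E[OF that W[OF u(2)]]
      by (simp add: module_hom.add[OF module_hom_coeff[OF that]] module_hom.scale[OF module_hom_coeff[OF that]] u)
    have mem: "set w \<subseteq> letters" if "w \<in> insert u t" for w
      by (rule W) (use that t(2) u(2) in blast)
    have "(\<Sum>w\<in>insert u t. tscale (coeff w (tscale c x + y)) (E w)) =
        (\<Sum>w\<in>insert u t. (if w = u then tscale c (E w) else 0) + tscale (coeff w y) (E w))"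
      by (rule sum.cong[OF refl]) (simp add: co[OF mem] m2.scale_left_distrib)
    also have "\<dots> = (\<Sum>w\<in>insert u t. if w = u then tscale c (E w) else 0) +
        (\<Sum>w\<in>insert u t. tscale (coeff w y) (E w))"
      by (rule sum.distrib)
    finally have split: "(\<Sum>w\<in>insert u t. tscale (coeff w (tscale c x + y)) (E w)) =
        (\<Sum>w\<in>insert u t. if w = u then tscale c (E w) else 0) +
        (\<Sum>w\<in>insert u t. tscale (coeff w y) (E w))" .
    have 1: "(\<Sum>w\<in>insert u t. if w = u then tscale c (E w) else 0) = tscale c x"
      using sum.delta[of "insert u t" u "\<lambda>w. tscale c (E w)"] t(1) u(1) by simp
    have "(\<Sum>w\<in>insert u t. tscale (coeff w y) (E w)) = (\<Sum>w\<in>t. tscale (coeff w y) (E w))"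
    proof (rule sum.mono_neutral_right)
      show "\<forall>w\<in>insert u t - t. tscale (coeff w y) (E w) = 0"
      proof
        fix w assume w: "w \<in> insert u t - t"
        then have "coeff w y = 0" by (intro t(4) mem) auto
        then show "tscale (coeff w y) (E w) = 0" by simp
      qed
    qed (use t(1) in auto)
    then have 2: "(\<Sum>w\<in>insert u t. tscale (coeff w y) (E w)) = y"
      by (rule trans) (rule t(3)[symmetric])
    have sum_eq: "tscale c x + y = (\<Sum>w\<in>insert u t. tscale (coeff w (tscale c x + y)) (E w))"
      unfolding split 1 2 ..
    have "coeff w (tscale c x + y) = 0" if "set w \<subseteq> letters" "w \<notin> insert u t" for w
      using co[OF that(1)] t(4)[OF that(1)] that(2) by simp
    moreover have "finite (insert u t)" "insert u t \<subseteq> W"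
      using t(1,2) u(2) by auto
    ultimately show ?case
      by (intro exI[of _ "insert u t"] conjI sum_eq allI impI)
  qed
  then obtain t where t: "finite t" "t \<subseteq> W" "x = (\<Sum>w\<in>t. tscale (coeff w x) (E w))"
    "\<And>w. set w \<subseteq> letters \<Longrightarrow> w \<notin> t \<Longrightarrow> coeff w x = 0" by blast
  let ?S = "{w. set w \<subseteq> letters \<and> coeff w x \<noteq> 0}"
  have sub: "?S \<subseteq> t" using t(4) by blast
  have "(\<Sum>w\<in>t. tscale (coeff w x) (E w)) = (\<Sum>w\<in>?S. tscale (coeff w x) (E w))"
  proof (rule sum.mono_neutral_right[OF t(1) sub], rule ballI)
    fix w assume "w \<in> t - ?S"
    then have "coeff w x = 0" using W t(2) by blast
    then show "tscale (coeff w x) (E w) = 0" by simp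
  qed
  then show ?thesis
    by (intro conjI finite_subset[OF sub t(1)] order.trans[OF sub t(2)] trans[OF t(3)])
qed

lemma eq_zero_by_coeff:
  assumes "\<And>w. set w \<subseteq> letters \<Longrightarrow> coeff w x = 0"
  shows "x = 0"
proof -
  have empty: "{w. set w \<subseteq> letters \<and> coeff w x \<noteq> 0} = {}"
    using assms by blast
  have "x \<in> m2.span (E ` {w. set w \<subseteq> letters})"
    by (simp add: span_E)
  then have "x = (\<Sum>w | set w \<subseteq> letters \<and> coeff w x \<noteq> 0. tscale (coeff w x) (E w))"
    using span_E_expansion[of "{w. set w \<subseteq> letters}" x] by blast
  then show ?thesis
    unfolding empty by simp
qed

text \<open>In a domain of characteristic 0 a positive integer can be cancelled from each
  coordinate.\<close>

lemma torsion_free: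
  assumes "m \<noteq> 0" "tscale (of_nat m) x = 0"
  shows "x = 0"
proof (rule eq_zero_by_coeff)
  fix w assume w: "set w \<subseteq> letters"
  have "of_nat m * coeff w x = coeff w (tscale (of_nat m) x)"
    by (simp add: module_hom.scale[OF module_hom_coeff[OF w]])
  then show "coeff w x = 0"
    using assms by (simp add: module_hom.zero[OF module_hom_coeff[OF w]])
qed

lemma tscale_of_nat_cancel: "m \<noteq> 0 \<Longrightarrow> tscale (of_nat m) x = tscale (of_nat m) y \<Longrightarrow> x = y"
  using torsion_free[of m "x - y"] by (simp add: m2.scale_right_diff_distrib)

end

section \<open>Symmetrized basis words\<close>

lemma count_list_le_1_iff:
  "count_list w x \<le> 1 \<longleftrightarrow> (\<forall>k<length w. \<forall>l<length w. w ! k = x \<longrightarrow> w ! l = x \<longrightarrow> k = l)"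
proof -
  let ?K = "{k. k < length w \<and> w ! k = x}"
  have "count_list w x = card {k. k < length w \<and> x = w ! k}"
    unfolding count_list_eq_length_filter length_filter_conv_card ..
  also have "{k. k < length w \<and> x = w ! k} = ?K"
    by (rule Collect_cong, rule conj_cong[OF refl], rule eq_commute)
  finally have "count_list w x \<le> 1 \<longleftrightarrow> (\<forall>k\<in>?K. \<forall>l\<in>?K. k = l)"
    using card_le_Suc0_iff_eq[of ?K] by simp
  also have "\<dots> \<longleftrightarrow> (\<forall>k<length w. \<forall>l<length w. w ! k = x \<longrightarrow> w ! l = x \<longrightarrow> k = l)"
    unfolding Ball_def mem_Collect_eq by iprover
  finally show ?thesis .
qed

text \<open>Expressed by multiplicities, the condition visibly depends only on the multiset of
  letters.\<close>

lemma mem_Tri_iff: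
  "w \<in> Tri A S d \<longleftrightarrow> length w = d \<and> fst ` set w \<subseteq> S \<and> (\<forall>x. fst x \<notin> A 0 \<longrightarrow> count_list w x \<le> 1)"
proof -
  have "(\<forall>k<d. \<forall>l<d. k \<noteq> l \<longrightarrow> w ! k = w ! l \<longrightarrow> fst (w ! k) \<in> A 0) \<longleftrightarrow>
      (\<forall>x. fst x \<notin> A 0 \<longrightarrow> (\<forall>k<d. \<forall>l<d. w ! k = x \<longrightarrow> w ! l = x \<longrightarrow> k = l))" (is "?L \<longleftrightarrow> ?R")
  proof
    assume L: ?L
    show ?R
    proof (intro allI impI, rule ccontr)
      fix x k l assume a: "fst x \<notin> A 0" "k < d" "l < d" "w ! k = x" "w ! l = x" "k \<noteq> l"
      have "fst (w ! k) \<in> A 0"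
        by (rule L[rule_format, OF a(2,3,6)]) (simp only: a(4,5))
      then show False using a(1) unfolding a(4) by (rule notE[rotated])
    qed
  next
    assume R: ?R
    show ?L
    proof (intro allI impI, rule ccontr)
      fix k l assume a: "k < d" "l < d" "k \<noteq> l" "w ! k = w ! l" "fst (w ! k) \<notin> A 0"
      have "k = l"
        by (rule R[rule_format, OF a(5,1,2) refl a(4)[symmetric]])
      with a(3) show False by (rule notE)
    qed
  qed
  note L_iff_R = this
  show ?thesis
  proof (cases "length w = d")
    case True
    show ?thesis
      unfolding Tri_def count_list_le_1_iff mem_Collect_eq True L_iff_R by (rule refl)
  qed (simp add: Tri_def)
qed

lemma count_list_mset_cong:
  assumes "mset v = mset w"
  shows "count_list v x = count_list w x"
  unfolding count_mset[symmetric] assms ..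

lemma mem_Tri_mset_cong:
  assumes "mset v = mset w"
  shows "v \<in> Tri A S d \<longleftrightarrow> w \<in> Tri A S d"
  unfolding mem_Tri_iff count_list_mset_cong[OF assms] mset_eq_setD[OF assms] mset_eq_length[OF assms] ..

lemma fact_mult_mset_cong:
  assumes "mset v = mset w"
  shows "fact_mult S v = fact_mult S w"
  unfolding fact_mult_def count_list_mset_cong[OF assms] mset_eq_setD[OF assms] ..

lemma permute_list_inject:
  assumes "\<sigma> \<in> sym_grp d" "length u = d" "length w = d" "permute_list \<sigma> u = permute_list \<sigma> w"
  shows "u = w"
proof -
  have "permute_list (\<sigma> \<circ> inv \<sigma>) u = permute_list (\<sigma> \<circ> inv \<sigma>) w"
    using assms by (simp add: permute_list_comp sym_grp_inv)
  then show ?thesis by (simp add: sym_grp_inv_o[OF assms(1)])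
qed

lemma odd_inversions_eq_0I:
  assumes "\<And>k l. k < l \<Longrightarrow> l < length ps \<Longrightarrow> inv \<sigma> l < inv \<sigma> k \<Longrightarrow> ps ! k = 1 \<Longrightarrow> ps ! l = 1 \<Longrightarrow> False"
  shows "odd_inversions \<sigma> ps = 0"
proof -
  have "{(k, l). k < l \<and> l < length ps \<and> inv \<sigma> k > inv \<sigma> l \<and> ps ! k = 1 \<and> ps ! l = 1} = {}"
    by (rule equals0I) (use assms in blast)
  then show ?thesis
    unfolding odd_inversions_def by (simp only: card.empty)
qed

lemma odd_inversions_transpose_0_1: "odd_inversions (transpose 0 1) (1 # 1 # ps) = 1"
proof -
  have iff: "k < l \<and> transpose 0 1 l < transpose 0 1 k \<longleftrightarrow> k = 0 \<and> l = 1" for k l :: nat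
    by (cases "k = 0"; cases "k = 1"; cases "l = 1"; cases "l = 0") simp_all
  have "{(k, l). k < l \<and> l < length (1 # 1 # ps) \<and> inv (transpose 0 1) k > inv (transpose 0 1) l \<and>
      (1 # 1 # ps) ! k = 1 \<and> (1 # 1 # ps) ! l = 1} = {(0, 1)}" (is "?S = _")
  proof (rule set_eqI, clarify)
    fix k l
    have "(k, l) \<in> ?S \<longleftrightarrow> (k < l \<and> transpose 0 1 l < transpose 0 1 k) \<and> l < length (1 # 1 # ps) \<and>
        (1 # 1 # ps) ! k = 1 \<and> (1 # 1 # ps) ! l = 1"
      by (simp only: mem_Collect_eq prod.case inv_transpose_eq conj_ac)
    also have "\<dots> \<longleftrightarrow> (k, l) \<in> {(0, 1)}"
      unfolding iff by (cases "k = 0"; cases "l = 1") simp_all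
    finally show "(k, l) \<in> ?S \<longleftrightarrow> (k, l) \<in> {(0, 1)}" .
  qed
  then show ?thesis
    unfolding odd_inversions_def by simp
qed

context tensor_setup
begin

abbreviation xi :: "('a \<times> 'n \<times> 'n) list \<Rightarrow> 't" where
  "xi \<equiv> xi_elt A tscale \<iota>"

abbreviation eta :: "('a \<times> 'n \<times> 'n) list \<Rightarrow> 't" where
  "eta \<equiv> eta_elt A tscale \<iota> B\<^sub>\<cc>"

abbreviation letters\<^sub>\<aa> :: "('a \<times> 'n \<times> 'n) set" where
  "letters\<^sub>\<aa> \<equiv> B\<^sub>\<aa> \<times> UNIV"

abbreviation letters\<^sub>Y :: "('a \<times> 'n \<times> 'n) set" where
  "letters\<^sub>Y \<equiv> (B\<^sub>\<cc> \<union> B\<^sub>1) \<times> UNIV"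

lemma mem_words: "w \<in> words L d \<longleftrightarrow> length w = d \<and> set w \<subseteq> L"
  by (simp add: words_def)

lemma letters_subset: "letters\<^sub>\<aa> \<subseteq> letters" "letters\<^sub>Y \<subseteq> letters"
  by auto

lemma Tri_words:
  assumes "w \<in> Tri A B d"
  shows "length w = d" "set w \<subseteq> letters"
  using assms by (auto simp: Tri_def)

lemma words_even_Tri:
  assumes "u \<in> words letters\<^sub>\<aa> d"
  shows "u \<in> Tri A B d"
proof -
  have u: "length u = d" "set u \<subseteq> letters\<^sub>\<aa>" using assms by (auto simp: mem_words)
  have "count_list u x \<le> 1" if "fst x \<notin> A 0" for x
  proof -
    have "fst x \<notin> B\<^sub>\<aa>" using that basis_even by blast
    then have "x \<notin> set u" using u(2) by auto
    then show ?thesis by simp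
  qed
  then show ?thesis using u by (auto simp: mem_Tri_iff)
qed

lemma parities_nth_eq_1:
  assumes "set w \<subseteq> letters" "k < length w"
  shows "parities w ! k = 1 \<longleftrightarrow> fst (w ! k) \<notin> A 0"
proof -
  have "w ! k \<in> letters" using assms nth_mem by blast
  then show ?thesis using assms(2) parity_eq_1_iff[of "fst (w ! k)"] by (simp add: parities_def mem_Times_iff)
qed

section \<open>Symmetrized words and orbit sums\<close>

text \<open>An odd letter occurs only once in a word of \<open>Tri\<close>, so a permutation that
  preserves the word fixes the position of that letter.\<close>

lemma odd_inversions_stabilizer:
  assumes w: "w \<in> Tri A B d" and \<tau>: "\<tau> \<in> stabilizer w"
  shows "odd_inversions \<tau> (parities w) = 0"
proof -
  have p: "\<tau> permutes {..<d}" and fix_w: "permute_list \<tau> w = w"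
    using \<tau> Tri_words(1)[OF w] by (auto simp: stabilizer_def sym_grp_def)
  have fixed: "inv \<tau> k = k" if k: "k < d" "parities w ! k = 1" for k
  proof (rule ccontr)
    assume ne: "inv \<tau> k \<noteq> k"
    have inv_k: "inv \<tau> k < d"
      using permutes_in_image[OF permutes_inv[OF p], of k] k by simp
    then have "w ! inv \<tau> k = w ! k"
      using permute_list_nth[of \<tau> w "inv \<tau> k"] p fix_w Tri_words(1)[OF w] permutes_inverses(1)[OF p, of k]
      by simp
    then have "fst (w ! k) \<in> A 0"
      using w inv_k k(1) ne unfolding Tri_def by fastforce
    then show False
      using k parities_nth_eq_1[of w k] Tri_words[OF w] by simp
  qed
  show ?thesis
  proof (rule odd_inversions_eq_0I)
    fix k l
    assume "k < l" "l < length (parities w)" "inv \<tau> l < inv \<tau> k" "parities w ! k = 1" "parities w ! l = 1"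
    then show False
      using fixed[of k] fixed[of l] Tri_words(1)[OF w] by simp
  qed
qed

text \<open>The stabilizer fixes the tensor of w, without sign by
  \<open>odd_inversions_stabilizer\<close>. So all members of a coset contribute the same term as
  the chosen representative.\<close>

lemma Sym_E_eq_xi:
  assumes w: "w \<in> Tri A B d"
  shows "Sym d (E w) = tscale (of_nat (card (stabilizer w))) (xi w)"
proof -
  have len: "length w = d" and sub: "set w \<subseteq> letters" using Tri_words[OF w] .
  have TP: "E w \<in> TP d" using E_in_TP[OF sub] len by simp
  have const: "act d \<sigma> (E w) = act d (SOME \<sigma>. \<sigma> \<in> C) (E w)" if C: "C \<in> stabilizer_cosets w" and \<sigma>: "\<sigma> \<in> C" for C \<sigma>
  proof -
    let ?\<rho> = "SOME \<sigma>. \<sigma> \<in> C"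
    obtain \<sigma>' where \<sigma>': "\<sigma>' \<in> sym_grp (length w)" "C = stabilizer_coset w \<sigma>'"
      using C by (auto simp: stabilizer_cosets_eq)
    have \<rho>: "?\<rho> \<in> sym_grp (length w)" "permute_list ?\<rho> w = permute_list \<sigma>' w"
      using some_mem_stabilizer_coset[OF \<sigma>'] by auto
    have "stabilizer_coset w ?\<rho> = stabilizer_coset w \<sigma>'"
      by (simp only: stabilizer_coset_eq[OF \<rho>(1)] stabilizer_coset_eq[OF \<sigma>'(1)] \<rho>(2))
    then have "C = stabilizer_coset w ?\<rho>"
      using \<sigma>'(2) by (rule trans[OF _ sym, rotated])
    then obtain \<tau> where \<tau>: "\<tau> \<in> stabilizer w" "\<sigma> = \<tau> \<circ> ?\<rho>"
      using \<sigma> unfolding stabilizer_coset_def by blast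
    have \<tau>': "\<tau> \<in> sym_grp d" "permute_list \<tau> w = w"
      using \<tau>(1) len by (auto simp: stabilizer_def)
    have "act d \<tau> (E w) = E w"
      using act_E[of \<tau> w] \<tau>' sub len odd_inversions_stabilizer[OF w \<tau>(1)] by simp
    then show ?thesis
      unfolding \<tau>(2) using act_comp[OF \<tau>'(1) _ TP] \<rho>(1) len by simp
  qed
  have "Sym d (E w) = (\<Sum>C\<in>stabilizer_cosets w. \<Sum>\<sigma>\<in>C. act d \<sigma> (E w))"
    unfolding Sym_def using sum_sym_grp_stabilizer_cosets[of "\<lambda>\<sigma>. act d \<sigma> (E w)" w] len by simp
  also have "\<dots> = (\<Sum>C\<in>stabilizer_cosets w. tscale (of_nat (card (stabilizer w))) (act d (SOME \<sigma>. \<sigma> \<in> C) (E w)))"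
  proof (rule sum.cong[OF refl])
    fix C assume C: "C \<in> stabilizer_cosets w"
    then have card: "card C = card (stabilizer w)"
      by (auto simp: stabilizer_cosets_eq card_stabilizer_coset)
    have "(\<Sum>\<sigma>\<in>C. act d \<sigma> (E w)) = (\<Sum>\<sigma>\<in>C. act d (SOME \<sigma>. \<sigma> \<in> C) (E w))"
      by (rule sum.cong[OF refl const[OF C]])
    then show "(\<Sum>\<sigma>\<in>C. act d \<sigma> (E w)) = tscale (of_nat (card (stabilizer w))) (act d (SOME \<sigma>. \<sigma> \<in> C) (E w))"
      unfolding m2.sum_constant_scale card .
  qed
  also have "\<dots> = tscale (of_nat (card (stabilizer w))) (xi w)"
    by (simp add: xi_elt_def m2.scale_sum_right len)
  finally show ?thesis .
qed

text \<open>The permutation that rearranges the word is absorbed by the symmetrizer and leaves only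
  its sign.\<close>

lemma Sym_E_mset:
  assumes v: "v \<in> words letters d" and mset: "mset w = mset v"
  shows "\<exists>n. Sym d (E v) = tscale ((- 1) ^ n) (Sym d (E w))"
proof -
  have len: "length v = d" and sub: "set v \<subseteq> letters" using v by (auto simp: mem_words)
  obtain \<sigma> where \<sigma>: "\<sigma> permutes {..<length v}" "permute_list \<sigma> v = w"
    using mset_eq_permutation[OF mset] by blast
  then have sg: "\<sigma> \<in> sym_grp d" using len by (simp add: sym_grp_def)
  have "Sym d (E v) = Sym d (act d \<sigma> (E v))"
    using Sym_act[OF sg] E_in_TP[OF sub] len by simp
  also have "\<dots> = tscale ((- 1) ^ odd_inversions \<sigma> (parities v)) (Sym d (E w))"
    using act_E[of \<sigma> v] sg len sub \<sigma>(2) by (simp add: module_hom.scale[OF module_hom_Sym])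
  finally show ?thesis by blast
qed

text \<open>Two equal odd letters can be brought to the front at the cost of a sign. Exchanging them
  fixes the word but changes the sign of its tensor, so twice the symmetrization is 0, and there is
  no torsion.\<close>

lemma Sym_E_eq_0:
  assumes v: "v \<in> words letters d" and nTri: "v \<notin> Tri A B d"
  shows "Sym d (E v) = 0"
proof -
  have len: "length v = d" and sub: "set v \<subseteq> letters" using v by (auto simp: mem_words)
  have "fst ` set v \<subseteq> B" using sub by auto
  then obtain x where x: "fst x \<notin> A 0" "\<not> count_list v x \<le> 1"
    using nTri len unfolding mem_Tri_iff by blast
  have "x \<in> set v"
  proof (rule ccontr)
    assume "x \<notin> set v"
    then have "count_list v x = 0" by simp
    then show False using x(2) by simp
  qed
  then obtain N where N: "mset v = add_mset x N"
    by (metis mset_add set_mset_mset)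
  have "count N x \<noteq> 0"
    using x(2) N by (simp flip: count_mset)
  then obtain M where "N = add_mset x M"
    by (metis count_eq_zero_iff mset_add)
  moreover obtain u where "mset u = M" using ex_mset by blast
  ultimately have mset: "mset (x # x # u) = mset v" using N by simp
  let ?w = "x # x # u"
  have w: "length ?w = d" "set ?w \<subseteq> letters"
    using mset_eq_length[OF mset] mset_eq_setD[OF mset] len sub by auto
  then have x1: "parity (fst x) = 1"
    using x(1) parity_eq_1_iff by auto
  define \<tau> :: "nat \<Rightarrow> nat" where "\<tau> = transpose 0 1"
  have p: "\<tau> permutes {..<length ?w}" unfolding \<tau>_def by (rule permutes_swap_id) auto
  then have \<tau>: "\<tau> \<in> sym_grp d" using w(1) by (simp add: sym_grp_def)
  have "permute_list \<tau> ?w = ?w"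
  proof (rule nth_equalityI)
    fix k assume "k < length (permute_list \<tau> ?w)"
    then have "permute_list \<tau> ?w ! k = ?w ! \<tau> k"
      using p by (simp add: permute_list_nth)
    also have "\<dots> = ?w ! k"
      by (cases "k = 0"; cases "k = 1") (simp_all add: \<tau>_def transpose_def)
    finally show "permute_list \<tau> ?w ! k = ?w ! k" .
  qed simp
  moreover have "odd_inversions \<tau> (parities ?w) = 1"
    unfolding \<tau>_def parities_def by (simp add: x1 odd_inversions_transpose_0_1[unfolded One_nat_def])
  ultimately have "act d \<tau> (E ?w) = - E ?w"
    using act_E[of \<tau> ?w] \<tau> w by simp
  moreover have "Sym d (act d \<tau> (E ?w)) = Sym d (E ?w)"
    using Sym_act[OF \<tau>] E_in_TP[OF w(2)] w(1) by simp
  ultimately have "Sym d (E ?w) = - Sym d (E ?w)"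
    by (simp add: module_hom.neg[OF module_hom_Sym])
  then have "Sym d (E ?w) + Sym d (E ?w) = 0"
    unfolding eq_neg_iff_add_eq_0 .
  moreover have "tscale (of_nat 2) (Sym d (E ?w)) = Sym d (E ?w) + Sym d (E ?w)"
    using m2.scale_left_distrib[of 1 1 "Sym d (E ?w)"] by simp
  ultimately have "tscale (of_nat 2) (Sym d (E ?w)) = 0"
    by (rule trans[rotated])
  then have "Sym d (E ?w) = 0"
    by (rule torsion_free[rotated]) simp
  moreover obtain n where "Sym d (E v) = tscale ((- 1) ^ n) (Sym d (E ?w))"
    using Sym_E_mset[OF v mset] by blast
  ultimately show ?thesis by simp
qed

text \<open>Explains the factor in \<open>eta_elt\<close>. The letters of u do not lie over
  \<open>B\<^sub>\<cc>\<close>, and those letters of v that do not are odd, so that they occur once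
  and contribute 1! = 1.\<close>

lemma fact_mult_eq_card_stabilizer:
  assumes u: "set u \<subseteq> letters\<^sub>\<aa>" and v: "set v \<subseteq> letters\<^sub>Y" and Tri: "u @ v \<in> Tri A B d"
  shows "fact_mult B\<^sub>\<cc> (u @ v) = card (stabilizer v)"
proof -
  let ?w = "u @ v"
  let ?C = "(B\<^sub>\<cc> \<inter> fst ` set ?w) \<times> (UNIV :: ('n \<times> 'n) set)"
  have disj: "B\<^sub>\<aa> \<inter> B\<^sub>\<cc> = {}" using disjoint_subalgebra_basis by blast
  have "fact_mult B\<^sub>\<cc> ?w = (\<Prod>b\<in>B\<^sub>\<cc> \<inter> fst ` set ?w. \<Prod>p\<in>UNIV. fact (count_list ?w (b, p)))"
    unfolding fact_mult_def UNIV_Times_UNIV[symmetric] by (simp add: prod.cartesian_product case_prod_beta)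
  also have "\<dots> = (\<Prod>x\<in>?C. fact (count_list ?w x))"
    by (simp add: prod.cartesian_product case_prod_beta)
  \<comment> \<open>The product set also contains triples that do not occur in the word; they
    contribute 0! = 1.\<close>
  also have "\<dots> = (\<Prod>x\<in>?C \<inter> set ?w. fact (count_list ?w x))"
  proof (rule prod.mono_neutral_right)
    show "\<forall>x\<in>?C - ?C \<inter> set ?w. fact (count_list ?w x) = 1"
      by (auto simp del: set_append count_list_append)
  qed auto
  also have "?C \<inter> set ?w = ?C \<inter> set v"
    using u disj by auto
  also have "(\<Prod>x\<in>?C \<inter> set v. fact (count_list ?w x)) = (\<Prod>x\<in>?C \<inter> set v. fact (count_list v x))"
  proof (rule prod.cong[OF refl])
    fix x assume "x \<in> ?C \<inter> set v"
    then have "x \<notin> set u" using u disj by auto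
    then show "fact (count_list ?w x) = fact (count_list v x)" by simp
  qed
  also have "\<dots> = (\<Prod>x\<in>set v. fact (count_list v x))"
  proof (rule prod.mono_neutral_left)
    show "\<forall>x\<in>set v - ?C \<inter> set v. fact (count_list v x) = 1"
    proof
      fix x assume x: "x \<in> set v - ?C \<inter> set v"
      then have "fst x \<notin> B\<^sub>\<cc>" by (auto simp: mem_Times_iff)
      moreover have "x \<in> letters\<^sub>Y" using x v by blast
      ultimately have "fst x \<in> B\<^sub>1" by (auto simp: mem_Times_iff)
      then have "count_list ?w x \<le> 1"
        using Tri odd_basis_not_even unfolding mem_Tri_iff by blast
      then have "count_list v x \<le> 1" by simp
      then show "fact (count_list v x) = 1"
        by (metis fact_0 fact_1 le_Suc_eq le_zero_eq One_nat_def)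
    qed
  qed auto
  finally show ?thesis by (simp add: card_stabilizer)
qed

lemma coeff_Sym_E:
  assumes v: "v \<in> words letters d" and w: "set w \<subseteq> letters" and ne: "mset w \<noteq> mset v"
  shows "coeff w (Sym d (E v)) = 0"
proof -
  have len: "length v = d" and sub: "set v \<subseteq> letters" using v by (auto simp: mem_words)
  have "coeff w (act d \<sigma> (E v)) = 0" if \<sigma>: "\<sigma> \<in> sym_grp d" for \<sigma>
  proof -
    have "mset (permute_list \<sigma> v) = mset v"
      using \<sigma> len by (simp add: sym_grp_def)
    then have "permute_list \<sigma> v \<noteq> w" using ne by blast
    then have "coeff w (E (permute_list \<sigma> v)) = 0"
      using coeff_E[OF w, of "permute_list \<sigma> v"] set_permute_list_sym[of \<sigma> v] \<sigma> len sub by simp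
    then show ?thesis
      using act_E[of \<sigma> v] \<sigma> len sub by (simp add: module_hom.scale[OF module_hom_coeff[OF w]])
  qed
  then show ?thesis
    by (simp add: Sym_def module_hom.sum[OF module_hom_coeff[OF w]])
qed

text \<open>The source of directness. The vanishing passes from \<open>Sym d (E v)\<close> to
  \<open>xi v\<close> because the order of the stabilizer is nonzero in the ground domain.\<close>

lemma coeff_eta:
  assumes v: "v \<in> Tri A B d" and w: "set w \<subseteq> letters" and ne: "mset w \<noteq> mset v"
  shows "coeff w (eta v) = 0"
proof -
  have "v \<in> words letters d" using Tri_words[OF v] by (simp add: mem_words)
  then have "coeff w (tscale (of_nat (card (stabilizer v))) (xi v)) = 0"
    unfolding Sym_E_eq_xi[OF v, symmetric] by (rule coeff_Sym_E[OF _ w ne])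
  then have "coeff w (xi v) = 0"
    using card_stabilizer_pos[of v] by (simp add: module_hom.scale[OF module_hom_coeff[OF w]])
  then show ?thesis
    by (simp add: eta_elt_def module_hom.scale[OF module_hom_coeff[OF w]])
qed

lemma act_E_even:
  assumes u: "u \<in> words letters\<^sub>\<aa> d" and \<sigma>: "\<sigma> \<in> sym_grp d"
  shows "act d \<sigma> (E u) = E (permute_list \<sigma> u)"
proof -
  have len: "length u = d" and sub: "set u \<subseteq> letters\<^sub>\<aa>" using u by (auto simp: mem_words)
  have "parities u ! k \<noteq> 1" if "k < d" for k
  proof -
    have "u ! k \<in> letters\<^sub>\<aa>" using sub that len nth_mem by blast
    then have "fst (u ! k) \<in> A 0" using basis_even by (auto simp: mem_Times_iff)
    then show ?thesis
      using parities_nth_eq_1[of u k] sub len that by auto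
  qed
  then have "odd_inversions \<sigma> (parities u) = 0"
    by (intro odd_inversions_eq_0I) (simp add: len)
  then show ?thesis
    using act_E[of \<sigma> u] \<sigma> len sub letters_subset(1) by auto
qed

text \<open>Without odd letters there are no signs, and the cosets run through the distinct
  rearrangements, each exactly once.\<close>

lemma xi_even:
  assumes u: "u \<in> words letters\<^sub>\<aa> d"
  shows "xi u = (\<Sum>w\<in>permutations_of_multiset (mset u). E w)"
proof -
  have len: "length u = d" using u by (simp add: mem_words)
  have "xi u = (\<Sum>C\<in>stabilizer_cosets u. E (permute_list (SOME \<sigma>. \<sigma> \<in> C) u))"
    unfolding xi_elt_def len
  proof (rule sum.cong[OF refl])
    fix C assume "C \<in> stabilizer_cosets u"
    then obtain \<sigma> where "\<sigma> \<in> sym_grp (length u)" "C = stabilizer_coset u \<sigma>"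
      by (auto simp: stabilizer_cosets_eq)
    then have "(SOME \<sigma>. \<sigma> \<in> C) \<in> sym_grp d"
      using some_mem_stabilizer_coset(1) len by metis
    then show "act d (SOME \<sigma>. \<sigma> \<in> C) (E u) = E (permute_list (SOME \<sigma>. \<sigma> \<in> C) u)"
      by (rule act_E_even[OF u])
  qed
  also have "\<dots> = (\<Sum>w\<in>permutations_of_multiset (mset u). E w)"
    by (rule sum.reindex_bij_betw[OF bij_betw_stabilizer_cosets])
  finally show ?thesis .
qed

end

section \<open>The decomposition\<close>

text \<open>Brings the span of a finite union of generating sets into the shape that
  \<open>is_direct_sum\<close> demands.\<close>

lemma (in module) span_UN_eq_sums:
  assumes "finite I"
  shows "span (\<Union>i\<in>I. H i) = {\<Sum>i\<in>I. u i | u. \<forall>i\<in>I. u i \<in> span (H i)}"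
proof (intro equalityI subsetI)
  fix x assume "x \<in> span (\<Union>i\<in>I. H i)"
  then show "x \<in> {\<Sum>i\<in>I. u i | u. \<forall>i\<in>I. u i \<in> span (H i)}"
  proof (induction x rule: span_induct_alt)
    case base
    show ?case
      by (rule CollectI, rule exI[of _ "\<lambda>_. 0"]) (simp add: span_zero)
  next
    case (step c x y)
    then obtain i u where i: "i \<in> I" "x \<in> H i" and u: "y = sum u I" "\<forall>i\<in>I. u i \<in> span (H i)"
      by blast
    let ?u = "u(i := scale c x + u i)"
    have "sum ?u I = ?u i + sum ?u (I - {i})"
      by (rule sum.remove[OF assms i(1)])
    also have "sum ?u (I - {i}) = sum u (I - {i})"
      by (rule sum.cong) auto
    also have "?u i + sum u (I - {i}) = scale c x + (u i + sum u (I - {i}))"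
      by (simp add: add.assoc)
    also have "u i + sum u (I - {i}) = y"
      unfolding u(1) by (rule sum.remove[OF assms i(1), symmetric])
    finally have "scale c x + y = sum ?u I" ..
    moreover have "\<forall>j\<in>I. ?u j \<in> span (H j)"
      using u(2) i by (auto intro: span_add span_scale span_base)
    ultimately show ?case by (intro CollectI exI[of _ ?u] conjI)
  qed
next
  fix x assume "x \<in> {\<Sum>i\<in>I. u i | u. \<forall>i\<in>I. u i \<in> span (H i)}"
  then obtain u where u: "x = sum u I" "\<forall>i\<in>I. u i \<in> span (H i)" by blast
  have "u i \<in> span (\<Union>i\<in>I. H i)" if "i \<in> I" for i
  proof -
    have "span (H i) \<subseteq> span (\<Union>i\<in>I. H i)" using that by (intro span_mono) blast
    then show ?thesis using u(2) that by blast
  qed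
  then show "x \<in> span (\<Union>i\<in>I. H i)"
    unfolding u(1) by (rule span_sum)
qed

context tensor_setup
begin

lemma star_left_hom: "module_hom tscale tscale (\<lambda>x. star A tscale \<iota> d e x y)"
  and star_right_hom: "module_hom tscale tscale (star A tscale \<iota> d e x)"
proof -
  have hom: "module_hom tscale tscale (\<lambda>z. \<Sum>\<sigma>\<in>shortest_reps d e. act (d + e) \<sigma> z)"
    by (rule module_hom_sum_act) (auto simp: shortest_reps_def)
  have "module_hom tscale tscale (\<lambda>x. x * y)" "module_hom tscale tscale (\<lambda>y. x * y)"
    by (simp_all add: module_hom_iff m2.module_axioms distrib_left distrib_right
        tscale_mult_left[symmetric] tscale_mult_right[symmetric])
  from this[THEN module_hom_comp[OF hom]]
  show "module_hom tscale tscale (\<lambda>x. star A tscale \<iota> d e x y)"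
    "module_hom tscale tscale (star A tscale \<iota> d e x)"
    unfolding star_def by auto
qed

lemma star_span_span:
  "star_span A tscale \<iota> d e (m2.span P) (m2.span Q) = m2.span {star A tscale \<iota> d e p q | p q. p \<in> P \<and> q \<in> Q}"
    (is "_ = m2.span ?R")
proof
  have "star A tscale \<iota> d e x y \<in> m2.span ?R" if x: "x \<in> m2.span P" and y: "y \<in> m2.span Q" for x y
  proof (rule hom_mem_span[OF star_left_hom _ x])
    fix p assume p: "p \<in> P"
    show "star A tscale \<iota> d e p y \<in> m2.span ?R"
    proof (rule hom_mem_span[OF star_right_hom _ y])
      fix q assume "q \<in> Q"
      with p show "star A tscale \<iota> d e p q \<in> m2.span ?R" by (intro m2.span_base) blast
    qed
  qed
  then show "star_span A tscale \<iota> d e (m2.span P) (m2.span Q) \<subseteq> m2.span ?R"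
    unfolding star_span_def by (intro m2.span_minimal m2.subspace_span) blast
  show "m2.span ?R \<subseteq> star_span A tscale \<iota> d e (m2.span P) (m2.span Q)"
    unfolding star_span_def by (intro m2.span_mono) (use m2.span_base in blast)
qed

lemma tensor_power_eq:
  "tensor_power tscale \<iota> {X. \<forall>i j. X $ i $ j \<in> span C} d = m2.span (E ` words (C \<times> UNIV) d)"
proof
  have "pure_tensor \<iota> w \<in> m2.span (E ` words (C \<times> UNIV) d)"
    if "length w = d" "set w \<subseteq> {X. \<forall>i j. X $ i $ j \<in> span C}" for w
    using pure_tensor_mem_span_E[of w C] that by blast
  then show "tensor_power tscale \<iota> {X. \<forall>i j. X $ i $ j \<in> span C} d \<subseteq> m2.span (E ` words (C \<times> UNIV) d)"
    unfolding tensor_power_def by (intro m2.span_minimal m2.subspace_span) blast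
  have "E u \<in> {pure_tensor \<iota> w | w. length w = d \<and> set w \<subseteq> {X. \<forall>i j. X $ i $ j \<in> span C}}"
    if "u \<in> words (C \<times> UNIV) d" for u
  proof -
    have "elt x $ i $ j \<in> span C" if "x \<in> C \<times> UNIV" for x i j
      using that by (cases x) (simp add: mat_elt_nth span_base span_zero)
    then have "set (map elt u) \<subseteq> {X. \<forall>i j. X $ i $ j \<in> span C}"
      using that unfolding mem_words set_map by blast
    then show ?thesis
      using that unfolding mem_words elt_tensor_def by (intro CollectI exI[of _ "map elt u"]) simp
  qed
  then show "m2.span (E ` words (C \<times> UNIV) d) \<subseteq> tensor_power tscale \<iota> {X. \<forall>i j. X $ i $ j \<in> span C} d"
    unfolding tensor_power_def by (intro m2.span_mono) blast
qed

section \<open>Orbit sums span the invariants over the subalgebra\<close>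

lemma schur_alg_eq:
  "schur_alg A tscale \<iota> \<aa> d = {x \<in> m2.span (E ` words letters\<^sub>\<aa> d). \<forall>\<sigma>\<in>sym_grp d. act d \<sigma> x = x}"
  using tensor_power_eq[of B\<^sub>\<aa> d] unfolding schur_alg_def perm_invariants_def span_parts by simp

lemma permute_list_words: "w \<in> words L d \<Longrightarrow> \<sigma> \<in> sym_grp d \<Longrightarrow> permute_list \<sigma> w \<in> words L d"
  by (auto simp: mem_words set_permute_list_sym)

lemma words_mset_cong:
  assumes "mset v = mset w"
  shows "v \<in> words L d \<longleftrightarrow> w \<in> words L d"
  unfolding mem_words mset_eq_length[OF assms] mset_eq_setD[OF assms] ..

lemma words_even_letters: "w \<in> words letters\<^sub>\<aa> d \<Longrightarrow> set w \<subseteq> letters"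
  unfolding mem_words by blast

text \<open>On even words the action permutes the basis tensors injectively and without signs. For
  an invariant element it follows that the coefficient of a word depends only on its multiset of
  letters.\<close>

lemma coeff_permute_list_act:
  assumes w: "w \<in> words letters\<^sub>\<aa> d" and \<sigma>: "\<sigma> \<in> sym_grp d" and x: "x \<in> m2.span (E ` words letters\<^sub>\<aa> d)"
  shows "coeff (permute_list \<sigma> w) (act d \<sigma> x) = coeff w x"
proof -
  have sub: "set w \<subseteq> letters" "set (permute_list \<sigma> w) \<subseteq> letters"
    using words_even_letters[OF w] words_even_letters[OF permute_list_words[OF w \<sigma>]] by auto
  note [simp] = module_hom.zero[OF module_hom_act[OF \<sigma>]] module_hom.add[OF module_hom_act[OF \<sigma>]]
    module_hom.scale[OF module_hom_act[OF \<sigma>]]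
    module_hom.zero[OF module_hom_coeff[OF sub(1)]] module_hom.add[OF module_hom_coeff[OF sub(1)]]
    module_hom.scale[OF module_hom_coeff[OF sub(1)]]
    module_hom.zero[OF module_hom_coeff[OF sub(2)]] module_hom.add[OF module_hom_coeff[OF sub(2)]]
    module_hom.scale[OF module_hom_coeff[OF sub(2)]]
  show ?thesis
    using x
  proof (induction x rule: m2.span_induct_alt)
    case base
    show ?case by simp
  next
    case (step c x y)
    then obtain u where u: "x = E u" "u \<in> words letters\<^sub>\<aa> d" by blast
    have eq: "permute_list \<sigma> u = permute_list \<sigma> w \<longleftrightarrow> u = w"
      using permute_list_inject[OF \<sigma>, of u w] u(2) w by (auto simp: mem_words)
    have "coeff (permute_list \<sigma> w) (act d \<sigma> (E u)) = coeff w (E u)"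
      unfolding act_E_even[OF u(2) \<sigma>]
        coeff_E[OF sub(1) words_even_letters[OF u(2)]]
        coeff_E[OF sub(2) words_even_letters[OF permute_list_words[OF u(2) \<sigma>]]] eq ..
    then show ?case
      using step(2) by (simp add: u(1))
  qed
qed

text \<open>Invariance is checked after multiplication by the order of the stabilizer, which turns
  \<open>xi u\<close> into a symmetrization and avoids any reindexing of cosets.\<close>

lemma xi_mem_schur_alg:
  assumes u: "u \<in> words letters\<^sub>\<aa> d"
  shows "xi u \<in> schur_alg A tscale \<iota> \<aa> d"
proof -
  have "E w \<in> m2.span (E ` words letters\<^sub>\<aa> d)" if "w \<in> permutations_of_multiset (mset u)" for w
    using that u words_mset_cong[of w u letters\<^sub>\<aa> d]
    by (intro m2.span_base imageI) (simp add: permutations_of_multiset_def)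
  then have "xi u \<in> m2.span (E ` words letters\<^sub>\<aa> d)"
    unfolding xi_even[OF u] by (rule m2.span_sum)
  moreover have "act d \<sigma> (xi u) = xi u" if \<sigma>: "\<sigma> \<in> sym_grp d" for \<sigma>
  proof (rule tscale_of_nat_cancel)
    have "E u \<in> TP d"
      using u E_in_TP[OF words_even_letters[OF u]] by (simp add: mem_words)
    then show "tscale (of_nat (card (stabilizer u))) (act d \<sigma> (xi u)) = tscale (of_nat (card (stabilizer u))) (xi u)"
      unfolding module_hom.scale[OF module_hom_act[OF \<sigma>], symmetric] Sym_E_eq_xi[OF words_even_Tri[OF u], symmetric]
      by (rule act_Sym[OF \<sigma>])
    show "card (stabilizer u) \<noteq> 0" using card_stabilizer_pos[of u] by simp
  qed
  ultimately show ?thesis by (simp add: schur_alg_eq)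
qed

lemma schur_alg_eq_span: "schur_alg A tscale \<iota> \<aa> d = m2.span (xi ` words letters\<^sub>\<aa> d)"
proof
  have "m2.subspace (schur_alg A tscale \<iota> \<aa> d)"
    unfolding schur_alg_eq m2.subspace_def
    by (auto simp: m2.span_zero m2.span_add m2.span_scale module_hom.zero[OF module_hom_act]
        module_hom.add[OF module_hom_act] module_hom.scale[OF module_hom_act])
  then show "m2.span (xi ` words letters\<^sub>\<aa> d) \<subseteq> schur_alg A tscale \<iota> \<aa> d"
    using xi_mem_schur_alg by (intro m2.span_minimal) blast
  show "schur_alg A tscale \<iota> \<aa> d \<subseteq> m2.span (xi ` words letters\<^sub>\<aa> d)"
  proof
    fix x assume "x \<in> schur_alg A tscale \<iota> \<aa> d"
    then have x: "x \<in> m2.span (E ` words letters\<^sub>\<aa> d)" and inv: "\<And>\<sigma>. \<sigma> \<in> sym_grp d \<Longrightarrow> act d \<sigma> x = x"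
      by (simp_all add: schur_alg_eq)
    let ?S = "{w. set w \<subseteq> letters \<and> coeff w x \<noteq> 0}"
    have expansion: "finite ?S \<and> ?S \<subseteq> words letters\<^sub>\<aa> d \<and> x = (\<Sum>w\<in>?S. tscale (coeff w x) (E w))"
      by (rule span_E_expansion[OF _ x]) (rule words_even_letters)
    have S: "finite ?S" "?S \<subseteq> words letters\<^sub>\<aa> d"
      by (rule conjunct1[OF expansion]) (rule conjunct1[OF conjunct2[OF expansion]])
    have sum: "x = (\<Sum>w\<in>?S. tscale (coeff w x) (E w))"
      by (rule conjunct2[OF conjunct2[OF expansion]])
    have coeff_mset: "coeff v x = coeff w x" if w: "w \<in> words letters\<^sub>\<aa> d" and mset: "mset v = mset w" for v w
    proof -
      obtain \<sigma> where \<sigma>: "\<sigma> permutes {..<length w}" "permute_list \<sigma> w = v"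
        using mset_eq_permutation[OF mset] by blast
      then have sg: "\<sigma> \<in> sym_grp d" using w by (simp add: mem_words sym_grp_def)
      show ?thesis
        using coeff_permute_list_act[OF w sg x] unfolding inv[OF sg] \<sigma>(2) .
    qed
    have "(\<Sum>w\<in>{w\<in>?S. mset w = mset v}. tscale (coeff w x) (E w)) \<in> m2.span (xi ` words letters\<^sub>\<aa> d)"
      if v: "v \<in> ?S" for v
    proof -
      have vw: "v \<in> words letters\<^sub>\<aa> d" using S(2) v by blast
      \<comment> \<open>The coefficient is constant and nonzero on the rearrangements of v, so all
        of them lie in the support and their terms add up to a multiple of the full orbit
        sum.\<close>
      have "{w\<in>?S. mset w = mset v} = permutations_of_multiset (mset v)"
      proof (intro equalityI subsetI)
        fix w assume "w \<in> permutations_of_multiset (mset v)"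
        then have mset: "mset w = mset v" by (simp add: permutations_of_multiset_def)
        have "coeff v x \<noteq> 0" using v by blast
        then have "coeff w x \<noteq> 0" unfolding coeff_mset[OF vw mset] .
        moreover have "set w \<subseteq> letters" using mset_eq_setD[OF mset] v by simp
        ultimately show "w \<in> {w\<in>?S. mset w = mset v}" using mset by simp
      qed (simp add: permutations_of_multiset_def)
      then have "(\<Sum>w\<in>{w\<in>?S. mset w = mset v}. tscale (coeff w x) (E w)) =
          (\<Sum>w\<in>permutations_of_multiset (mset v). tscale (coeff v x) (E w))"
      proof (rule sum.cong)
        fix w assume "w \<in> permutations_of_multiset (mset v)"
        then have "coeff w x = coeff v x"
          by (intro coeff_mset[OF vw]) (simp add: permutations_of_multiset_def)
        then show "tscale (coeff w x) (E w) = tscale (coeff v x) (E w)" by (rule arg_cong)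
      qed
      also have "\<dots> = tscale (coeff v x) (xi v)"
        by (simp add: xi_even[OF vw] m2.scale_sum_right)
      also have "\<dots> \<in> m2.span (xi ` words letters\<^sub>\<aa> d)"
        using vw by (intro m2.span_scale m2.span_base imageI)
      finally show ?thesis .
    qed
    note class_sum = this
    have "(\<Sum>m\<in>mset ` ?S. \<Sum>w\<in>{w\<in>?S. mset w = m}. tscale (coeff w x) (E w)) \<in> m2.span (xi ` words letters\<^sub>\<aa> d)"
    proof (rule m2.span_sum)
      fix m assume "m \<in> mset ` ?S"
      then obtain v where v: "m = mset v" "v \<in> ?S" by (rule imageE)
      show "(\<Sum>w\<in>{w\<in>?S. mset w = m}. tscale (coeff w x) (E w)) \<in> m2.span (xi ` words letters\<^sub>\<aa> d)"
        unfolding v(1) by (rule class_sum[OF v(2)])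
    qed
    moreover have "x = (\<Sum>m\<in>mset ` ?S. \<Sum>w\<in>{w\<in>?S. mset w = m}. tscale (coeff w x) (E w))"
      by (rule trans[OF sum sum.image_gen[OF S(1)]])
    ultimately show "x \<in> m2.span (xi ` words letters\<^sub>\<aa> d)"
      by (rule back_subst[OF _ sym, of "\<lambda>z. z \<in> m2.span (xi ` words letters\<^sub>\<aa> d)"])
  qed
qed

section \<open>Star powers of Y\<close>

lemma sym_grp_1: "sym_grp (Suc 0) = {id}" and sym_grp_0: "sym_grp 0 = {id}"
proof -
  have "{..<Suc 0} = {0}" by auto
  then show "sym_grp (Suc 0) = {id}" by (simp add: sym_grp_def)
qed (simp add: sym_grp_def)

lemma act_id:
  assumes "set w \<subseteq> letters"
  shows "act (length w) id (E w) = E w"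
proof -
  have "odd_inversions id (parities w) = 0"
    by (rule odd_inversions_eq_0I) simp
  then show ?thesis using act_E[OF sym_grp_id assms] by simp
qed

lemma Y_sub_eq: "Y_sub smul \<iota> (B\<^sub>\<cc> \<union> B\<^sub>1) = m2.span ((\<lambda>x. E [x]) ` letters\<^sub>Y)"
proof -
  have "{mat_elt b r s | b r s. b \<in> B\<^sub>\<cc> \<union> B\<^sub>1} = elt ` letters\<^sub>Y"
  proof (intro equalityI subsetI)
    fix X :: "'a^'n^'n" assume "X \<in> {mat_elt b r s | b r s. b \<in> B\<^sub>\<cc> \<union> B\<^sub>1}"
    then obtain b r s where "b \<in> B\<^sub>\<cc> \<union> B\<^sub>1" "X = mat_elt b r s" by blast
    then show "X \<in> elt ` letters\<^sub>Y" by (intro image_eqI[of _ _ "(b, r, s)"]) simp_all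
  next
    fix X :: "'a^'n^'n" assume "X \<in> elt ` letters\<^sub>Y"
    then obtain b r s where "b \<in> B\<^sub>\<cc> \<union> B\<^sub>1" "X = mat_elt b r s" by auto
    then show "X \<in> {mat_elt b r s | b r s. b \<in> B\<^sub>\<cc> \<union> B\<^sub>1}" by blast
  qed
  then have "Y_sub smul \<iota> (B\<^sub>\<cc> \<union> B\<^sub>1) = m2.span (\<iota> ` elt ` letters\<^sub>Y)"
    unfolding Y_sub_def span_image by simp
  also have "\<iota> ` elt ` letters\<^sub>Y = (\<lambda>x. E [x]) ` letters\<^sub>Y"
    unfolding image_image by (rule image_cong) (auto simp: elt_tensor_def pure_tensor_def)
  finally show ?thesis .
qed

text \<open>A single letter is its own symmetrization, so each further star factor appends a letter
  under the symmetrizer.\<close>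

lemma star_power_eq_span:
  "star_power A tscale \<iota> e (Y_sub smul \<iota> (B\<^sub>\<cc> \<union> B\<^sub>1)) = m2.span ((\<lambda>v. Sym e (E v)) ` words letters\<^sub>Y e)"
proof (induction e)
  case 0
  have "words letters\<^sub>Y 0 = {[]}" by (auto simp: words_def)
  moreover have "Sym 0 (E []) = 1"
    using act_id[of "[]"] by (simp add: Sym_def sym_grp_0 elt_tensor_def pure_tensor_def)
  ultimately show ?case by simp
next
  case (Suc e)
  have *: "star A tscale \<iota> e 1 (Sym e (E v)) (E [x]) = Sym (Suc e) (E (v @ [x]))"
    if v: "v \<in> words letters\<^sub>Y e" and x: "x \<in> letters\<^sub>Y" for v x
  proof -
    have sub: "set v \<subseteq> letters" "set [x] \<subseteq> letters" "length v = e"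
      using v x by (auto simp: mem_words)
    have "Sym 1 (E [x]) = E [x]"
      using act_id[OF sub(2)] by (simp add: Sym_def sym_grp_1)
    then show ?thesis
      using star_Sym[OF E_in_TP[OF sub(1)] E_in_TP[OF sub(2)]] sub(3) by (simp add: E_append)
  qed
  have "{star A tscale \<iota> e 1 p q | p q. p \<in> (\<lambda>v. Sym e (E v)) ` words letters\<^sub>Y e \<and> q \<in> (\<lambda>x. E [x]) ` letters\<^sub>Y} =
      (\<lambda>v. Sym (Suc e) (E v)) ` words letters\<^sub>Y (Suc e)" (is "?P = ?Q")
  proof (intro equalityI subsetI)
    fix z assume "z \<in> ?P"
    then obtain v x where v: "v \<in> words letters\<^sub>Y e" and x: "x \<in> letters\<^sub>Y"
      and z: "z = star A tscale \<iota> e 1 (Sym e (E v)) (E [x])"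
      by blast
    have "v @ [x] \<in> words letters\<^sub>Y (Suc e)" using v x by (simp add: mem_words)
    then show "z \<in> ?Q" unfolding z *[OF v x] by (rule imageI)
  next
    fix z assume "z \<in> ?Q"
    then obtain w where w: "w \<in> words letters\<^sub>Y (Suc e)" and z: "z = Sym (Suc e) (E w)" by blast
    have "w \<noteq> []" using w by (auto simp: mem_words)
    have bl: "butlast w \<in> words letters\<^sub>Y e"
      using w by (auto simp: mem_words dest: in_set_butlastD)
    have la: "last w \<in> letters\<^sub>Y" using w \<open>w \<noteq> []\<close> last_in_set unfolding mem_words by blast
    have z_eq: "z = star A tscale \<iota> e 1 (Sym e (E (butlast w))) (E [last w])"
      unfolding *[OF bl la] z append_butlast_last_id[OF \<open>w \<noteq> []\<close>] ..
    show "z \<in> ?P"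
      by (rule CollectI, rule exI, rule exI, rule conjI, rule z_eq, rule conjI, rule imageI[OF bl], rule imageI[OF la])
  qed
  then show ?case
    unfolding star_power.simps Suc.IH unfolding Y_sub_eq star_span_span by (rule arg_cong)
qed

section \<open>The summands and their sum\<close>

text \<open>Normal forms for the e-th summand. The intersection with \<open>Tri\<close> discards the
  words with a repeated odd letter, whose star products vanish.\<close>

definition split_words :: "nat \<Rightarrow> nat \<Rightarrow> ('a \<times> 'n \<times> 'n) list set" where
  "split_words d e = {u @ v | u v. u \<in> words letters\<^sub>\<aa> (d - e) \<and> v \<in> words letters\<^sub>Y e} \<inter> Tri A B d"

lemma star_xi_Sym_E:
  assumes e: "e \<le> d" and u: "u \<in> words letters\<^sub>\<aa> (d - e)" and v: "v \<in> words letters\<^sub>Y e"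
  shows "star A tscale \<iota> (d - e) e (xi u) (Sym e (E v)) = (if u @ v \<in> Tri A B d then eta (u @ v) else 0)"
proof -
  let ?s = "star A tscale \<iota> (d - e) e"
  have u': "length u = d - e" "set u \<subseteq> letters\<^sub>\<aa>" "set u \<subseteq> letters" and v': "length v = e" "set v \<subseteq> letters\<^sub>Y" "set v \<subseteq> letters"
    using u v by (auto simp: mem_words)
  have uv: "u @ v \<in> words letters d" using u' v' e by (simp add: mem_words)
  have "tscale (of_nat (card (stabilizer u))) (?s (xi u) (Sym e (E v))) = ?s (Sym (d - e) (E u)) (Sym e (E v))"
    unfolding Sym_E_eq_xi[OF words_even_Tri[OF u]] by (rule module_hom.scale[OF star_left_hom, symmetric])
  also have "\<dots> = Sym d (E (u @ v))"
    using star_Sym[OF E_in_TP[OF u'(3)] E_in_TP[OF v'(3)]] e by (simp add: u'(1) v'(1) E_append)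
  finally have eq: "tscale (of_nat (card (stabilizer u))) (?s (xi u) (Sym e (E v))) = Sym d (E (u @ v))" .
  have pos: "card (stabilizer u) \<noteq> 0" using card_stabilizer_pos[of u] by simp
  show ?thesis
  proof (cases "u @ v \<in> Tri A B d")
    case False
    then have "tscale (of_nat (card (stabilizer u))) (?s (xi u) (Sym e (E v))) = 0"
      using eq Sym_E_eq_0[OF uv] by simp
    then have "?s (xi u) (Sym e (E v)) = 0" by (rule torsion_free[OF pos])
    then show ?thesis using False by simp
  next
    case True
    \<comment> \<open>As u and v share no letter, the order of the stabilizer of
      \<open>u @ v\<close> is a product. The factor of u is cancelled; the factor of v becomes the
      one in \<open>eta_elt\<close>.\<close>
    have "set u \<inter> set v = {}"
      using u'(2) v'(2) disjoint_subalgebra_basis by auto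
    then have card: "card (stabilizer (u @ v)) = card (stabilizer u) * card (stabilizer v)"
      by (rule card_stabilizer_append)
    have "tscale (of_nat (card (stabilizer u))) (?s (xi u) (Sym e (E v))) =
        tscale (of_nat (card (stabilizer u))) (tscale (of_nat (card (stabilizer v))) (xi (u @ v)))"
      unfolding eq Sym_E_eq_xi[OF True] card by simp
    then have "?s (xi u) (Sym e (E v)) = tscale (of_nat (card (stabilizer v))) (xi (u @ v))"
      by (rule tscale_of_nat_cancel[OF pos])
    then show ?thesis
      using True fact_mult_eq_card_stabilizer[OF u'(2) v'(2) True] by (simp add: eta_elt_def)
  qed
qed

lemma summand_eq_span:
  assumes e: "e \<le> d"
  shows "star_span A tscale \<iota> (d - e) e (schur_alg A tscale \<iota> \<aa> (d - e))
      (star_power A tscale \<iota> e (Y_sub smul \<iota> (B\<^sub>\<cc> \<union> B\<^sub>1))) = m2.span (eta ` split_words d e)"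
proof -
  let ?s = "star A tscale \<iota> (d - e) e"
  let ?P = "{?s p q | p q. p \<in> xi ` words letters\<^sub>\<aa> (d - e) \<and> q \<in> (\<lambda>v. Sym e (E v)) ` words letters\<^sub>Y e}"
  have "?P \<subseteq> m2.span (eta ` split_words d e)"
  proof
    fix z assume "z \<in> ?P"
    then obtain u v where u: "u \<in> words letters\<^sub>\<aa> (d - e)" and v: "v \<in> words letters\<^sub>Y e"
      and z: "z = ?s (xi u) (Sym e (E v))" by blast
    show "z \<in> m2.span (eta ` split_words d e)"
    proof (cases "u @ v \<in> Tri A B d")
      case True
      then have "u @ v \<in> split_words d e" using u v unfolding split_words_def by blast
      then show ?thesis
        unfolding z star_xi_Sym_E[OF e u v] using True by (simp add: m2.span_base)
    next
      case False
      then show ?thesis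
        unfolding z star_xi_Sym_E[OF e u v] by (simp add: m2.span_zero)
    qed
  qed
  moreover have "eta ` split_words d e \<subseteq> ?P"
  proof
    fix z assume "z \<in> eta ` split_words d e"
    then obtain u v where u: "u \<in> words letters\<^sub>\<aa> (d - e)" and v: "v \<in> words letters\<^sub>Y e"
      and uv: "u @ v \<in> Tri A B d" and z: "z = eta (u @ v)"
      unfolding split_words_def by blast
    have z_eq: "z = ?s (xi u) (Sym e (E v))"
      unfolding z star_xi_Sym_E[OF e u v] using uv by simp
    show "z \<in> ?P"
      by (rule CollectI, rule exI, rule exI, rule conjI, rule z_eq, rule conjI, rule imageI[OF u], rule imageI[OF v])
  qed
  ultimately have "m2.span ?P = m2.span (eta ` split_words d e)"
    by (intro subset_antisym m2.span_minimal m2.span_mono m2.subspace_span)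
  then show ?thesis
    unfolding schur_alg_eq_span star_power_eq_span star_span_span .
qed

text \<open>The stabilizer order and \<open>fact_mult\<close> depend only on the multiset of
  letters, so the sign from the symmetrizations carries over once the former is cancelled.\<close>

lemma eta_mset:
  assumes w: "w \<in> Tri A B d" and mset: "mset v = mset w"
  shows "\<exists>n. eta w = tscale ((- 1) ^ n) (eta v)"
proof -
  have v: "v \<in> Tri A B d" using w mem_Tri_mset_cong[OF mset] by simp
  have "w \<in> words letters d" using Tri_words[OF w] by (simp add: mem_words)
  then obtain n where n: "Sym d (E w) = tscale ((- 1) ^ n) (Sym d (E v))"
    using Sym_E_mset[OF _ mset] by blast
  have "tscale (of_nat (card (stabilizer w))) (xi w) = tscale (of_nat (card (stabilizer w))) (tscale ((- 1) ^ n) (xi v))"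
    using n unfolding Sym_E_eq_xi[OF w] Sym_E_eq_xi[OF v] card_stabilizer_mset_cong[OF mset]
    by (rule trans[OF _ m2.scale_left_commute])
  then have xi_eq: "xi w = tscale ((- 1) ^ n) (xi v)"
    by (rule tscale_of_nat_cancel[rotated]) (use card_stabilizer_pos[of w] in simp)
  have "eta w = tscale ((- 1) ^ n) (eta v)"
    unfolding eta_elt_def fact_mult_mset_cong[OF mset] xi_eq by (rule m2.scale_left_commute)
  then show ?thesis by blast
qed

lemma T_alg_eq_span: "T_alg A tscale \<iota> B\<^sub>\<aa> B\<^sub>\<cc> B\<^sub>1 d = m2.span (\<Union>e\<in>{0..d}. eta ` split_words d e)"
proof
  have "eta w \<in> m2.span (\<Union>e\<in>{0..d}. eta ` split_words d e)" if w: "w \<in> Tri A B d" for w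
  proof -
    \<comment> \<open>The length of \<open>?v\<close> is the index of the summand that contains
      \<open>eta w\<close>; the rearrangement costs only a sign.\<close>
    let ?u = "filter (\<lambda>x. fst x \<in> B\<^sub>\<aa>) w" and ?v = "filter (\<lambda>x. fst x \<notin> B\<^sub>\<aa>) w"
    have mset: "mset (?u @ ?v) = mset w" by simp
    have uv: "?u @ ?v \<in> Tri A B d" using w mem_Tri_mset_cong[OF mset] by simp
    have len: "length ?u + length ?v = d"
      using sum_length_filter_compl[of "\<lambda>x. fst x \<in> B\<^sub>\<aa>" w] Tri_words(1)[OF w] by simp
    have "?u \<in> words letters\<^sub>\<aa> (d - length ?v)"
      using len by (auto simp: mem_words)
    moreover have "?v \<in> words letters\<^sub>Y (length ?v)"
      using Tri_words(2)[OF w] by (auto simp: mem_words)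
    ultimately have "?u @ ?v \<in> split_words d (length ?v)"
      unfolding split_words_def using uv by blast
    moreover have "length ?v \<in> {0..d}" using len by auto
    ultimately have "eta (?u @ ?v) \<in> m2.span (\<Union>e\<in>{0..d}. eta ` split_words d e)"
      by (intro m2.span_base) blast
    moreover obtain n where "eta w = tscale ((- 1) ^ n) (eta (?u @ ?v))"
      using eta_mset[OF w mset] by blast
    ultimately show ?thesis by (simp add: m2.span_scale)
  qed
  then show "T_alg A tscale \<iota> B\<^sub>\<aa> B\<^sub>\<cc> B\<^sub>1 d \<subseteq> m2.span (\<Union>e\<in>{0..d}. eta ` split_words d e)"
    unfolding T_alg_def by (intro m2.span_minimal m2.subspace_span) blast
  show "m2.span (\<Union>e\<in>{0..d}. eta ` split_words d e) \<subseteq> T_alg A tscale \<iota> B\<^sub>\<aa> B\<^sub>\<cc> B\<^sub>1 d"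
    unfolding T_alg_def by (intro m2.span_mono) (auto simp: split_words_def)
qed

section \<open>Directness of the sum\<close>

text \<open>Recovers the index of the summand. It is defined through the multiset of letters, which
  makes it invariant under rearrangement.\<close>

definition grade :: "('a \<times> 'n \<times> 'n) list \<Rightarrow> nat" where
  "grade w = size (filter_mset (\<lambda>x. fst x \<notin> B\<^sub>\<aa>) (mset w))"

lemma grade_split_words:
  assumes "w \<in> split_words d e"
  shows "grade w = e"
proof -
  obtain u v where w: "w = u @ v" and u: "set u \<subseteq> letters\<^sub>\<aa>" and v: "set v \<subseteq> letters\<^sub>Y" "length v = e"
    using assms by (auto simp: split_words_def mem_words)
  have "filter (\<lambda>x. fst x \<notin> B\<^sub>\<aa>) u = []"
    using u by (auto simp: filter_empty_conv)
  moreover have "filter (\<lambda>x. fst x \<notin> B\<^sub>\<aa>) v = v"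
    unfolding filter_id_conv using v(1) disjoint_subalgebra_basis by auto
  ultimately have "filter (\<lambda>x. fst x \<notin> B\<^sub>\<aa>) w = v" by (simp add: w)
  then show ?thesis
    using v(2) by (simp add: grade_def flip: mset_filter)
qed

lemma coeff_summand_eq_0:
  assumes x: "x \<in> m2.span (eta ` split_words d e)" and w: "set w \<subseteq> letters" "grade w \<noteq> e"
  shows "coeff w x = 0"
proof (rule module_hom.eq_0_on_span[OF module_hom_coeff[OF w(1)] _ x])
  fix y assume "y \<in> eta ` split_words d e"
  then obtain v where y: "y = eta v" and v: "v \<in> split_words d e" by (rule imageE)
  have "mset w \<noteq> mset v"
    using grade_split_words[OF v] w(2) by (auto simp: grade_def)
  moreover have "v \<in> Tri A B d" using v by (simp add: split_words_def)
  ultimately show "coeff w y = 0" unfolding y by (intro coeff_eta[OF _ w(1)])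
qed

lemma direct_sum_decomposition:
  "is_direct_sum {0..d}
      (\<lambda>e. star_span A tscale \<iota> (d - e) e
             (schur_alg A tscale \<iota> \<aa> (d - e))
             (star_power A tscale \<iota> e (Y_sub smul \<iota> (B\<^sub>\<cc> \<union> B\<^sub>1))))
      (T_alg A tscale \<iota> B\<^sub>\<aa> B\<^sub>\<cc> B\<^sub>1 d)"
  (is "is_direct_sum _ ?U _")
proof -
  have U: "u e \<in> ?U e \<longleftrightarrow> u e \<in> m2.span (eta ` split_words d e)" if "e \<in> {0..d}" for u e
    using that summand_eq_span[of e d] by simp
  have "u e = 0" if u: "\<And>e. e \<in> {0..d} \<Longrightarrow> u e \<in> m2.span (eta ` split_words d e)"
    and sum: "sum u {0..d} = 0" and e: "e \<in> {0..d}" for u e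
  proof (rule eq_zero_by_coeff)
    fix w assume w: "set w \<subseteq> letters"
    show "coeff w (u e) = 0"
    proof (cases "grade w = e")
      case False
      then show ?thesis by (rule coeff_summand_eq_0[OF u[OF e] w])
    next
      case True
      \<comment> \<open>A word of grade e receives a coefficient from the e-th component only, so
        this coefficient equals that of the total sum, which is 0.\<close>
      have "coeff w (u i) = 0" if "i \<in> {0..d} - {e}" for i
        using that True by (intro coeff_summand_eq_0[OF u w]) auto
      then have "coeff w (u e) = (\<Sum>i\<in>{0..d}. coeff w (u i))"
        using sum.remove[of "{0..d}" e "\<lambda>i. coeff w (u i)"] e by simp
      also have "\<dots> = coeff w (sum u {0..d})"
        by (rule module_hom.sum[OF module_hom_coeff[OF w], symmetric])
      also have "\<dots> = 0"
        unfolding sum by (rule module_hom.zero[OF module_hom_coeff[OF w]])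
      finally show ?thesis .
    qed
  qed
  note independent = this
  have U_all: "(\<forall>e\<in>{0..d}. u e \<in> ?U e) \<longleftrightarrow> (\<forall>e\<in>{0..d}. u e \<in> m2.span (eta ` split_words d e))" for u
    by (rule ball_cong[OF refl U])
  show ?thesis
    unfolding is_direct_sum_def T_alg_eq_span m2.span_UN_eq_sums[OF finite_atLeastAtMost] U_all
    by (intro conjI refl allI impI ballI, rule independent) (auto dest: bspec)
qed

end

theorem lemma4p9:
  fixes smul :: "'k::{idom,ring_char_0} \<Rightarrow> 'a::ring \<Rightarrow> 'a"
    and A :: "bit \<Rightarrow> 'a set"
    and \<aa> \<cc> B\<^sub>\<aa> B\<^sub>\<cc> B\<^sub>1 :: "'a set"
    and tscale :: "'k \<Rightarrow> 't::ring_1 \<Rightarrow> 't"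
    and \<iota> :: "'a^'n::finite^'n \<Rightarrow> 't"
    and d :: nat
  assumes "good_pair_basis smul A \<aa> \<cc> B\<^sub>\<aa> B\<^sub>\<cc> B\<^sub>1"
    and "tensor_algebra (mat_scale smul) tscale \<iota>"
  shows "is_direct_sum {0..d}
      (\<lambda>e. star_span A tscale \<iota> (d - e) e
             (schur_alg A tscale \<iota> \<aa> (d - e))
             (star_power A tscale \<iota> e (Y_sub smul \<iota> (B\<^sub>\<cc> \<union> B\<^sub>1))))
      (T_alg A tscale \<iota> B\<^sub>\<aa> B\<^sub>\<cc> B\<^sub>1 d)"
proof -
  interpret tensor_setup smul A \<aa> \<cc> B\<^sub>\<aa> B\<^sub>\<cc> B\<^sub>1 tscale \<iota>
    using assms by (rule tensor_setup.intro)
  show ?thesis by (rule direct_sum_decomposition)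
qed

end
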